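(* The decorated hexagonal monotile $P_0$ is aperiodic. That is, there exists a tiling of the plane $\mathbb{R}^2$ using only direct isometries of $P_0$ that satisfies both R1 and R2, and every tiling $T$ of the plane by direct isometries of $P_0$ that satisfies R1 and R2 is nonperiodic.
   Context: The monotile $P_0$. Let $H\subset\mathbb{R}^2$ be the closed regular hexagon centred at the origin with apothem $1/2$ whose edges $E_0,\dots,E_5$ have midpoints $m_k=\tfrac12(\cos\tfrac{k\pi}{3},\sin\tfrac{k\pi}{3})$, and let $t_k=(-\sin\tfrac{k\pi}{3},\cos\tfrac{k\pi}{3})$ be the counterclockwise unit tangent direction along $E_k$. Fix $0<\delta<\tfrac{1}{2\sqrt3}$ and signs $(\varepsilon_0,\dots,\varepsilon_5)=(-1,-1,+1,-1,+1,+1)$, and put $p_k=m_k+\varepsilon_k\delta t_k\in E_k$ (an off-centre point of $E_k$). The monotile $P_0$ is $H$ carrying the following decorations. (i) Three pairwise disjoint R1-curves: the straight segment from $p_1$ to $p_4$ (the straight R1-segment), and two corner curves (R1-corners), one joining $p_2$ to $p_3$ and one joining $p_5$ to $p_0$. Each R1-corner turns with interior angle $\pi/3$; for definiteness, the corner through $p_2,p_3$ consists of the two segments joining $p_2$ and $p_3$ to the point $2\delta(\cos\tfrac{5\pi}{6},\sin\tfrac{5\pi}{6})$, and the corner through $p_5,p_0$ consists of the two segments joining $p_5$ and $p_0$ to the point $2\delta(\cos\tfrac{11\pi}{6},\sin\tfrac{11\pi}{6})$. (ii) The R2-tree: the union of the four segments from the origin to $m_0,m_1,m_3,m_4$. Tilings.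 A tile is the image of $P_0$, together with its decorations, under a direct (orientation-preserving) isometry of $\mathbb{R}^2$; reflections are not allowed. A tiling is a collection of tiles covering the plane and intersecting only on their boundaries. A tiling $T$ is nonperiodic if no nonzero $v\in\mathbb{R}^2$ satisfies $T+v=T$ (as decorated tilings). Rules. $T$ satisfies R1 if the R1-curves are continuous across tiles: whenever two tiles share an edge, the endpoints of their R1-curves on that edge coincide. $T$ satisfies R2 if the union of the R2-trees of all tiles of $T$ is a connected subset of the plane (equivalently, every patch of $T$, i.e. every finite connected collection of tiles of $T$, is contained in a patch of $T$ that can be built one tile at a time so that the R2-tree of each added tile connects continuously, through the midpoint of a common edge, with the R2-tree of at least one adjacent tile already placed). *)

theory Defs
  imports "HOL-Analysis.Analysis"
begin

type_synonym plane = "real^2"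

definition dir :: "real \<Rightarrow> plane" where
  "dir \<theta> = vector [cos \<theta>, sin \<theta>]"

definition mid :: "nat \<Rightarrow> plane" where
  "mid k = (1/2) *\<^sub>R dir (real k * pi / 3)"

definition tang :: "nat \<Rightarrow> plane" where
  "tang k = vector [- sin (real k * pi / 3), cos (real k * pi / 3)]"

definition sgn_off :: "nat \<Rightarrow> real" where
  "sgn_off k = [-1, -1, 1, -1, 1, 1] ! k"

definition mark :: "real \<Rightarrow> nat \<Rightarrow> plane" where
  "mark \<delta> k = mid k + (sgn_off k * \<delta>) *\<^sub>R tang k"

text \<open>The half-plane description of the regular hexagon: the \<open>k\<close>-th edge lies on the line at
  distance \<open>1/2\<close> from the origin with outer unit normal \<open>dir (k\<pi>/3)\<close>.\<close>

definition hexagon :: "plane set" where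
  "hexagon = {x. \<forall>k<6. x \<bullet> dir (real k * pi / 3) \<le> 1/2}"

definition R1_straight :: "real \<Rightarrow> plane set" where
  "R1_straight \<delta> = closed_segment (mark \<delta> 1) (mark \<delta> 4)"

definition R1_corner_23 :: "real \<Rightarrow> plane set" where
  "R1_corner_23 \<delta> =
     (let q = (2 * \<delta>) *\<^sub>R dir (5 * pi / 6)
      in closed_segment (mark \<delta> 2) q \<union> closed_segment q (mark \<delta> 3))"

definition R1_corner_50 :: "real \<Rightarrow> plane set" where
  "R1_corner_50 \<delta> =
     (let q = (2 * \<delta>) *\<^sub>R dir (11 * pi / 6)
      in closed_segment (mark \<delta> 5) q \<union> closed_segment q (mark \<delta> 0))"

text \<open>The field \<open>r1_ends\<close> collects the endpoints of the R1-curves. It is determined by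
  the curves and is carried along so that the endpoints of a moved tile are directly available.\<close>

record tile =
  body :: "plane set"
  r1_curves :: "plane set set"
  r1_ends :: "plane set"
  r2_tree :: "plane set"

definition P0 :: "real \<Rightarrow> tile" where
  "P0 \<delta> =
    \<lparr> body = hexagon,
      r1_curves = {R1_straight \<delta>, R1_corner_23 \<delta>, R1_corner_50 \<delta>},
      r1_ends = mark \<delta> ` {0..5},
      r2_tree = (\<Union>k\<in>{0, 1, 3, 4}. closed_segment 0 (mid k)) \<rparr>"

definition map_tile :: "(plane \<Rightarrow> plane) \<Rightarrow> tile \<Rightarrow> tile" where
  "map_tile f t =
    \<lparr> body = f ` body t,
      r1_curves = (\<lambda>C. f ` C) ` r1_curves t,
      r1_ends = f ` r1_ends t,
      r2_tree = f ` r2_tree t \<rparr>"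

definition direct_isometry :: "(plane \<Rightarrow> plane) \<Rightarrow> bool" where
  "direct_isometry f \<longleftrightarrow> (\<exists>Q c. rotation_matrix Q \<and> f = (\<lambda>x. Q *v x + c))"

definition is_tiling :: "real \<Rightarrow> tile set \<Rightarrow> bool" where
  "is_tiling \<delta> T \<longleftrightarrow>
     (\<forall>t\<in>T. \<exists>f. direct_isometry f \<and> t = map_tile f (P0 \<delta>)) \<and>
     (\<Union>t\<in>T. body t) = UNIV \<and>
     (\<forall>s\<in>T. \<forall>t\<in>T. s \<noteq> t \<longrightarrow> body s \<inter> body t \<subseteq> frontier (body s) \<inter> frontier (body t))"

definition R1 :: "tile set \<Rightarrow> bool" where
  "R1 T \<longleftrightarrow>
     (\<forall>s\<in>T. \<forall>t\<in>T. \<forall>e. e edge_of body s \<and> e edge_of body t \<longrightarrow>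
        r1_ends s \<inter> e = r1_ends t \<inter> e)"

definition R2 :: "tile set \<Rightarrow> bool" where
  "R2 T \<longleftrightarrow> connected (\<Union>t\<in>T. r2_tree t)"

definition nonperiodic :: "tile set \<Rightarrow> bool" where
  "nonperiodic T \<longleftrightarrow> \<not> (\<exists>v. v \<noteq> 0 \<and> map_tile (\<lambda>x. x + v) ` T = T)"

end

theory Submission
  imports Defs
begin

text \<open>Why the tile is aperiodic. The plane is covered by congruent regular hexagons with disjoint
interiors only as a honeycomb: two centres are at least \<open>1\<close> apart and every point is within
\<open>1/\<surd>3\<close> of a centre, while a triangle with sides at least \<open>1\<close> and circumradius at most
\<open>1/\<surd>3\<close> is equilateral with side \<open>1\<close> (\<open>third_point\<close>). So the centres form a triangular lattice
and a tiling is a choice of one of six orientations at each lattice point (\<open>tiling_frame\<close>).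

A half-turn of the tile changes neither its R2-tree nor its axis of straight passage, so most
information sits in a colour in \<open>\<int>/3\<close>: let \<open>d\<^sub>0\<close>, \<open>d\<^sub>1\<close>, \<open>d\<^sub>2\<close> be unit steps at mutual angles
\<open>2\<pi>/3\<close> and let a tile have colour \<open>j\<close> if its straight R1-segment runs along \<open>d\<^sub>j\<close>. Follow a row of
tiles in direction \<open>d\<^sub>j\<close> and watch on which side of the row the R1-marks on the crossed edges lie:
tiles of colour \<open>j\<close> keep the side, those of colours \<open>j + 1\<close> and \<open>j + 2\<close> switch it, in opposite
senses. So R1 says that in every row of every axis the colours \<open>j + 1\<close> and \<open>j + 2\<close> alternate once
the \<open>j\<close> are deleted (\<open>alternating\<close>). The trees of two neighbours along \<open>d\<^sub>j\<close> meet unless one of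
the two has colour \<open>j + 1\<close>, so R2 says that the resulting graph on the lattice is connected
(\<open>dendrite\<close>). Everything that remains concerns colourings of the lattice.

Nonperiodicity. In a row of axis \<open>j\<close> a run of colour \<open>j\<close> from a tile of colour \<open>j + 1\<close> to one of
colour \<open>j + 2\<close> is a side of an equilateral triangle (\<open>triangle\<close>). Call the end of colour \<open>j + 2\<close>
the parent of the tiles inside the side. Every edge of the graph joins a tile to its parent or to a
tile of the same run, so under R2 the lines of ancestors of any two tiles meet
(\<open>ancestor_meet\<close>). The key fact is that the lengths of the sides increase strictly along a line of
ancestors that is not trapped in a cycle of three tiles (\<open>size_increases\<close>): when the line turns
left, the old triangle sits inside the new one with a corner on its side (\<open>left_turn\<close>); when it
turns right into a side that is not longer, it is caught in an inward spiral, which must close up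
(\<open>trapped_step\<close>). A period \<open>v\<close> preserves lengths of sides. Lines of ancestors of \<open>x\<close> and \<open>x + v\<close> meet,
and at the meeting the lengths force the same number of steps on both, so \<open>v = 0\<close>; a cycle of three
is no exception, because \<open>v\<close> would map it to itself. If some tile has no
parent, then its whole row has one colour and is parallel to \<open>v\<close>; then all lines of ancestors
end on this row, with bounded lengths and hence boundedly many steps, which is impossible for
tiles far from it (\<open>alternating_dendrite_nonperiodic\<close>).

Existence. The map \<open>(a, b) \<mapsto> (-2a - 1, -2b)\<close> is a similarity of ratio \<open>-2\<close>. Colour the points outside
its image by their class modulo \<open>2\<close>, and give the image of \<open>x\<close> the colour of \<open>x\<close>. Alternation
is inherited from half the scale. A point outside the image is joined to the base row \<open>b = 0\<close>, which
has a single colour, or to the image of a point for which this is already known, and the similarity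
carries joined points to joined points; so the graph is connected (\<open>colour_dendrite\<close>).\<close>

section \<open>Colourings of the triangular lattice\<close>

lemma three_cases: "(j::3) = 0 \<or> j = 1 \<or> j = 2"
  using exhaust_3[of j] by auto

lemma three_arith [simp]:
  fixes j :: 3
  shows "j + 1 + 1 = j + 2" "j + 1 + 2 = j" "j + 2 + 1 = j" "j + 2 + 2 = j + 1"
    "j + 1 \<noteq> j" "j + 2 \<noteq> j" "j + 1 \<noteq> j + 2" "j \<noteq> j + 1" "j \<noteq> j + 2" "j + 2 \<noteq> j + 1"
  using three_cases[of j] by auto

lemma three_other: "(i::3) = j \<or> i = j + 1 \<or> i = j + 2"
  using three_cases[of i] three_cases[of j] by auto

type_synonym point = "int \<times> int"
type_synonym colouring = "point \<Rightarrow> 3"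

text \<open>The lattice has the basis \<open>d\<^sub>0\<close>, \<open>d\<^sub>1\<close>, two unit vectors at angle \<open>2\<pi>/3\<close>. Then \<open>d\<^sub>0 + d\<^sub>1 + d\<^sub>2 = 0\<close>,
so the three axes are interchangeable and one argument serves for all \<open>j\<close>.\<close>

definition unit_step :: "3 \<Rightarrow> point" where
  "unit_step j = (if j = 0 then (1, 0) else if j = 1 then (0, 1) else (-1, -1))"

definition move :: "3 \<Rightarrow> int \<Rightarrow> point \<Rightarrow> point" where
  "move j n x = (fst x + n * fst (unit_step j), snd x + n * snd (unit_step j))"

lemma move_0 [simp]: "move j 0 x = x" by (simp add: move_def)

lemma move_move [simp]: "move j m (move j n x) = move j (m + n) x"
  by (simp add: move_def algebra_simps)

text \<open>Going \<open>n\<close> steps along two different axes amounts to going back \<open>n\<close> steps along the third. These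
equations do all the plane geometry of the combinatorial part.\<close>

lemma move_turn [simp]:
  "move (j + 1) n (move j n x) = move (j + 2) (- n) x"
  "move (j + 2) n (move j n x) = move (j + 1) (- n) x"
  "move j n (move (j + 1) n x) = move (j + 2) (- n) x"
  "move (j + 2) n (move (j + 1) n x) = move j (- n) x"
  "move j n (move (j + 2) n x) = move (j + 1) (- n) x"
  "move (j + 1) n (move (j + 2) n x) = move j (- n) x"
  using three_cases[of j] by (auto simp: move_def unit_step_def)

lemma move_translate: "move j n (x + v) = move j n x + v"
  by (simp add: move_def prod_eq_iff)

text \<open>Between two equal colours other than \<open>j\<close> in a row of axis \<open>j\<close> there is another tile that is not of
colour \<open>j\<close>: this is alternation of \<open>j + 1\<close> and \<open>j + 2\<close>, in a form that does not mention order.\<close>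

definition alternating :: "colouring \<Rightarrow> bool" where
  "alternating c \<longleftrightarrow> (\<forall>x j n. 0 < n \<and> c x \<noteq> j \<and> c (move j n x) = c x \<longrightarrow>
     (\<exists>i. 0 < i \<and> i < n \<and> c (move j i x) \<noteq> j))"

text \<open>Alternation read in either direction \<open>e = \<plusminus>1\<close> along the row.\<close>

lemma alternating_step:
  fixes e :: int
  assumes "alternating c" and e: "\<bar>e\<bar> = 1" and "0 < n" and "c x \<noteq> j"
    and run: "\<And>i. 0 < i \<Longrightarrow> i < n \<Longrightarrow> c (move j (e * i) x) = j"
  shows "c (move j (e * n) x) \<noteq> c x"
proof
  assume eq: "c (move j (e * n) x) = c x"
  show False
  proof (cases "e = 1")
    case True
    then show False using assms eq unfolding alternating_def by fastforce
  next
    case False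
    then have e: "e = -1" using e by linarith
    define y where "y = move j (-n) x"
    have "c y \<noteq> j" "c (move j n y) = c y" using eq e assms(4) by (auto simp: y_def)
    then obtain i where i: "0 < i" "i < n" "c (move j i y) \<noteq> j"
      using assms(1,3) unfolding alternating_def by blast
    have "c (move j (e * (n - i)) x) = j" using run[of "n - i"] i by auto
    then show False using i e by (simp add: y_def algebra_simps)
  qed
qed

section \<open>Triangles\<close>

text \<open>The condition is not symmetric in the two ends; \<open>e\<close> is the direction from the end of colour
\<open>j + 1\<close> to the end of colour \<open>j + 2\<close>, so \<open>e = 1\<close> and \<open>e = -1\<close> are the two kinds of triangles, pointing
up and down. The R1-curve along a side turns at its ends by the same angle towards the same hand.\<close>

definition side :: "colouring \<Rightarrow> int \<Rightarrow> 3 \<Rightarrow> point \<Rightarrow> int \<Rightarrow> bool" where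
  "side c e j x n \<longleftrightarrow> 0 < n \<and> c x = j + 1 \<and> c (move j (e * n) x) = j + 2 \<and>
     (\<forall>i. 0 < i \<and> i < n \<longrightarrow> c (move j (e * i) x) = j)"

lemma least_pos_int:
  fixes n :: int
  assumes "0 < n" "P n"
  obtains m where "0 < m" "m \<le> n" "P m" "\<And>i. 0 < i \<Longrightarrow> i < m \<Longrightarrow> \<not> P i"
proof -
  define k where "k = (LEAST k::nat. 0 < k \<and> P (int k))"
  have ex: "0 < nat n \<and> P (int (nat n))" using assms by simp
  have k: "0 < k \<and> P (int k)" unfolding k_def using ex by (rule LeastI)
  have le: "k \<le> nat n" unfolding k_def using ex by (rule Least_le)
  have min: "\<not> P i" if "0 < i" "i < int k" for i
    using not_less_Least[of "nat i" "\<lambda>k. 0 < k \<and> P (int k)"] that unfolding k_def by auto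
  show ?thesis using that[of "int k"] k le min by auto
qed

text \<open>The two neighbouring sides, along the axes \<open>j + 1\<close> and \<open>j + 2\<close>, have the same length \<open>n\<close>, and the three
sides close up. The induction is on \<open>n\<close>: a neighbouring side that is shorter would, by induction,
have \<open>n\<close> as the length of its own neighbour. So both neighbours reach the third vertex of the
triangle without having ended before, and a point that lies on both axes must be the end of both.\<close>

lemma triangle:
  assumes alt: "alternating c" and e: "\<bar>e\<bar> = 1" and "side c e j x n"
  shows "(\<forall>i. 0 < i \<and> i < n \<longrightarrow> c (move (j + 1) (e * i) (move j (e * n) x)) = j + 1) \<and>
         (\<forall>i. 0 < i \<and> i < n \<longrightarrow> c (move (j + 2) (- e * i) x) = j + 2) \<and>
         c (move (j + 2) (- e * n) x) = j"
  using assms(3)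
proof (induction "nat n" arbitrary: j x n rule: less_induct)
  case less
  define y where "y = move j (e * n) x"
  have s: "0 < n" "c x = j + 1" "c y = j + 2"
    and run: "\<And>i. 0 < i \<Longrightarrow> i < n \<Longrightarrow> c (move j (e * i) x) = j"
    using less.prems by (auto simp: side_def y_def)
  have yrun: "c (move j (- e * i) y) = j" if "0 < i" "i < n" for i
    using run[of "n - i"] that by (simp add: y_def algebra_simps)
  have A: "c (move (j + 1) (e * i) y) = j + 1" if i: "0 < i" "i < n" for i
  proof (rule ccontr)
    assume "c (move (j + 1) (e * i) y) \<noteq> j + 1"
    from least_pos_int[of i "\<lambda>i. c (move (j + 1) (e * i) y) \<noteq> j + 1", OF i(1) this]
    obtain m where m: "0 < m" "m \<le> i" "c (move (j + 1) (e * m) y) \<noteq> j + 1"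
      and mm: "\<And>i. 0 < i \<Longrightarrow> i < m \<Longrightarrow> c (move (j + 1) (e * i) y) = j + 1" by metis
    have "c (move (j + 1) (e * m) y) \<noteq> c y"
      using alternating_step[OF alt e m(1), of y "j + 1"] mm s by auto
    then have "c (move (j + 1) (e * m) y) = j" using m(3) s(3) three_other[of _ j] by metis
    then have "side c e (j + 1) y m" using m mm s by (auto simp: side_def)
    then have "c (move (j + 1 + 2) (- e * m) y) = j + 1"
      using less.hyps[of m "j + 1" y] m i by auto
    then show False using yrun[of m] m i by auto
  qed
  have B: "c (move (j + 2) (- e * i) x) = j + 2" if i: "0 < i" "i < n" for i
  proof (rule ccontr)
    assume "c (move (j + 2) (- e * i) x) \<noteq> j + 2"
    from least_pos_int[of i "\<lambda>i. c (move (j + 2) (- e * i) x) \<noteq> j + 2", OF i(1) this]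
    obtain m where m: "0 < m" "m \<le> i" "c (move (j + 2) (- e * m) x) \<noteq> j + 2"
      and mm: "\<And>i. 0 < i \<Longrightarrow> i < m \<Longrightarrow> c (move (j + 2) (- e * i) x) = j + 2" by metis
    define u where "u = move (j + 2) (- e * m) x"
    have "c u \<noteq> c x"
      using alternating_step[OF alt _ m(1), of "- e" x "j + 2"] mm s e by (auto simp: u_def)
    then have cu: "c u = j" using m(3) s(2) three_other[of _ j] unfolding u_def by metis
    have "c (move (j + 2) (e * i) u) = j + 2" if "0 < i" "i < m" for i
      using mm[of "m - i"] that by (simp add: u_def algebra_simps)
    then have "side c e (j + 2) u m" using m cu s by (auto simp: side_def u_def)
    then have "\<forall>i. 0 < i \<and> i < m \<longrightarrow> c (move j (e * i) x) = j" and
      "c (move (j + 1) (- e * m) u) = j + 2"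
      using less.hyps[of m "j + 2" u] m i by (auto simp: u_def)
    moreover have "move (j + 1) (- e * m) u = move j (e * m) x" by (simp add: u_def)
    ultimately show False using run[of m] m i by auto
  qed
  define u where "u = move (j + 2) (- e * n) x"
  have u': "u = move (j + 1) (e * n) y" by (simp add: u_def y_def)
  have "c u \<noteq> j + 2"
    using alternating_step[OF alt e s(1), of y "j + 1"] A s by (auto simp: u')
  moreover have "c u \<noteq> j + 1"
    using alternating_step[OF alt _ s(1), of "-e" x "j + 2"] B s e by (auto simp: u_def)
  ultimately have "c u = j" using three_other[of "c u" j] by auto
  then show ?case using A B by (auto simp: u_def y_def)
qed

text \<open>Lattice points are pairs only by construction, so quantifiers over them stay whole.\<close>

declare split_paired_All [simp del] split_paired_Ex [simp del]

section \<open>Parents and ancestors\<close>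

text \<open>Seen from \<open>x\<close> of colour \<open>j\<close>, the nearest other colour in direction \<open>e\<close> of axis \<open>j\<close> is \<open>j + 2\<close>, met
after \<open>l\<close> steps.\<close>

definition run :: "colouring \<Rightarrow> int \<Rightarrow> int \<Rightarrow> point \<Rightarrow> bool" where
  "run c e l x \<longleftrightarrow> \<bar>e\<bar> = 1 \<and> 0 < l \<and> c (move (c x) (e * l) x) = c x + 2 \<and>
     (\<forall>i. 0 < i \<and> i < l \<longrightarrow> c (move (c x) (e * i) x) = c x)"

text \<open>The tile \<open>x\<close> lies in the interior of a side, \<open>k\<close> steps after its start of colour \<open>j + 1\<close> and \<open>l\<close>
steps before its end of colour \<open>j + 2\<close>.\<close>

definition on_side :: "colouring \<Rightarrow> int \<Rightarrow> int \<Rightarrow> int \<Rightarrow> point \<Rightarrow> bool" where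
  "on_side c e k l x \<longleftrightarrow> run c e l x \<and> 0 < k \<and> c (move (c x) (- e * k) x) = c x + 1 \<and>
     (\<forall>i. 0 < i \<and> i < k \<longrightarrow> c (move (c x) (- e * i) x) = c x)"

lemma unit_cases: "\<bar>e::int\<bar> = 1 \<Longrightarrow> e = 1 \<or> e = -1" by linarith

lemma unit_sign_cases: "\<bar>e::int\<bar> = 1 \<Longrightarrow> \<bar>e'\<bar> = 1 \<Longrightarrow> e' = e \<or> e' = - e" by linarith

lemma on_side_run: "on_side c e k l x \<Longrightarrow> run c e l x" by (simp add: on_side_def)

lemma on_side_colour:
  assumes "on_side c e k l x" and "- k < i" "i < l"
  shows "c (move (c x) (e * i) x) = c x"
proof -
  consider "i = 0" | "0 < i" | "i < 0" by linarith
  then show ?thesis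
  proof cases
    case 3
    then have "c (move (c x) (- e * (- i)) x) = c x" using assms(1,2) unfolding on_side_def by (metis neg_0_less_iff_less minus_less_iff)
    then show ?thesis by simp
  qed (use assms in \<open>auto simp: on_side_def run_def\<close>)
qed

lemma on_side_full_side:
  assumes "on_side c e k l x"
  shows "side c e (c x) (move (c x) (- e * k) x) (k + l)"
proof -
  have "c (move (c x) (e * i) (move (c x) (- e * k) x)) = c x" if "0 < i" "i < k + l" for i
    using on_side_colour[OF assms, of "i - k"] that by (simp add: algebra_simps)
  then show ?thesis using assms by (auto simp: side_def on_side_def run_def algebra_simps)
qed

text \<open>Both directions cannot lead to colour \<open>j + 2\<close>, since \<open>j + 1\<close> and \<open>j + 2\<close> alternate.\<close>

lemma run_unique:
  assumes alt: "alternating c" and r: "run c e l x" and r': "run c e' l' x"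
  shows "e = e' \<and> l = l'"
proof (cases "e = e'")
  case True
  have "\<not> l < l'" "\<not> l' < l" using r r' True by (auto simp: run_def)
  then show ?thesis using True by auto
next
  case False
  have e: "\<bar>e\<bar> = 1" "e' = - e" using r r' False unit_sign_cases[of e e'] by (auto simp: run_def)
  define y where "y = move (c x) (- e * l') x"
  have cy: "c y = c x + 2" using r' e by (auto simp: run_def y_def)
  have "c (move (c x) (e * i) y) = c x" if i: "0 < i" "i < l' + l" for i
  proof -
    have eq: "move (c x) (e * i) y = move (c x) (e * (i - l')) x" by (simp add: y_def algebra_simps)
    consider "i = l'" | "i < l'" | "l' < i" by linarith
    then show ?thesis
    proof cases
      case 2
      then have "c (move (c x) (e' * (l' - i)) x) = c x" using r' i by (auto simp: run_def)
      then show ?thesis using e eq by (simp add: algebra_simps)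
    qed (use r i eq in \<open>auto simp: run_def\<close>)
  qed
  then have "c (move (c x) (e * (l' + l)) y) \<noteq> c y"
    using alternating_step[OF alt e(1), of "l' + l" y "c x"] r r' cy by (auto simp: run_def)
  then show ?thesis using r cy by (auto simp: run_def y_def algebra_simps)
qed

text \<open>A tile without a parent counts as its own parent, so that \<open>parent\<close> can be iterated freely.\<close>

definition parent :: "colouring \<Rightarrow> point \<Rightarrow> point" where
  "parent c x = (if \<exists>e l. run c e l x then THE z. \<exists>e l. run c e l x \<and> z = move (c x) (e * l) x else x)"

definition orphan :: "colouring \<Rightarrow> point \<Rightarrow> bool" where
  "orphan c x \<longleftrightarrow> (\<forall>e l. \<not> run c e l x)"

lemma parent_orphan: "orphan c x \<Longrightarrow> parent c x = x" by (auto simp: orphan_def parent_def)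

lemma parent_run:
  assumes "alternating c" and "run c e l x"
  shows "parent c x = move (c x) (e * l) x"
proof -
  have "(THE z. \<exists>e l. run c e l x \<and> z = move (c x) (e * l) x) = move (c x) (e * l) x"
  proof (rule the_equality)
    show "\<exists>e' l'. run c e' l' x \<and> move (c x) (e * l) x = move (c x) (e' * l') x" using assms(2) by blast
    show "z = move (c x) (e * l) x" if "\<exists>e l. run c e l x \<and> z = move (c x) (e * l) x" for z
      using that run_unique[OF assms] by auto
  qed
  then show ?thesis using assms by (auto simp: parent_def)
qed

lemma parent_colour:
  assumes "alternating c" and "\<not> orphan c x"
  shows "c (parent c x) = c x + 2"
proof -
  obtain e l where r: "run c e l x" using assms(2) by (auto simp: orphan_def)
  show ?thesis using parent_run[OF assms(1) r] r by (simp add: run_def)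
qed

lemma on_side_unique:
  assumes alt: "alternating c" and r: "on_side c e k l x" and r': "on_side c e' k' l' x"
  shows "e = e'" "k = k'" "l = l'"
proof -
  show e: "e = e'" and "l = l'" using run_unique[OF alt r[THEN on_side_run] r'[THEN on_side_run]] by auto
  have "\<not> k < k'" "\<not> k' < k" using r r' e by (auto simp: on_side_def)
  then show "k = k'" by auto
qed

text \<open>The tiles \<open>x\<close> and \<open>y\<close> are joined by an unbroken run of their common colour along the axis of that
colour. The displacement \<open>t\<close> may have either sign.\<close>

definition same_run :: "colouring \<Rightarrow> point \<Rightarrow> point \<Rightarrow> bool" where
  "same_run c x y \<longleftrightarrow> (\<exists>t. y = move (c x) t x \<and> (\<forall>i. min 0 t \<le> i \<and> i \<le> max 0 t \<longrightarrow> c (move (c x) i x) = c x))"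

lemma same_run_refl [simp]: "same_run c x x"
  unfolding same_run_def by (rule exI[of _ 0]) auto

lemma same_run_colour: "same_run c x y \<Longrightarrow> c y = c x" by (auto simp: same_run_def)

lemma same_run_sym: assumes "same_run c x y" shows "same_run c y x"
proof -
  obtain t where t: "y = move (c x) t x"
    "\<And>i. min 0 t \<le> i \<Longrightarrow> i \<le> max 0 t \<Longrightarrow> c (move (c x) i x) = c x" using assms by (auto simp: same_run_def)
  have "c (move (c x) i y) = c x" if "min 0 (- t) \<le> i" "i \<le> max 0 (- t)" for i
    using t(2)[of "i + t"] that by (auto simp: t(1) min_def max_def split: if_splits)
  then show ?thesis using same_run_colour[OF assms] unfolding same_run_def
    by (intro exI[of _ "- t"]) (auto simp: t(1))
qed

lemma same_run_trans: assumes "same_run c x y" "same_run c y z" shows "same_run c x z"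
proof -
  obtain t where t: "y = move (c x) t x"
    "\<And>i. min 0 t \<le> i \<Longrightarrow> i \<le> max 0 t \<Longrightarrow> c (move (c x) i x) = c x" using assms by (auto simp: same_run_def)
  obtain s where s: "z = move (c x) s y"
    "\<And>i. min 0 s \<le> i \<Longrightarrow> i \<le> max 0 s \<Longrightarrow> c (move (c x) i y) = c x"
    using assms same_run_colour[OF assms(1)] by (auto simp: same_run_def)
  have "c (move (c x) i x) = c x" if "min 0 (s + t) \<le> i" "i \<le> max 0 (s + t)" for i
  proof (cases "min 0 t \<le> i \<and> i \<le> max 0 t")
    case False
    then have "min 0 s \<le> i - t \<and> i - t \<le> max 0 s" using that by linarith
    then show ?thesis using s(2)[of "i - t"] by (auto simp: t(1))
  qed (use t in auto)
  then show ?thesis unfolding same_run_def by (intro exI[of _ "s + t"]) (auto simp: t(1) s(1))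
qed

text \<open>A run of one colour leads to the same end from all its tiles.\<close>

lemma same_run_parent:
  assumes alt: "alternating c" and "same_run c x y" and "\<not> orphan c x"
  shows "\<not> orphan c y" "parent c y = parent c x"
proof -
  obtain e l where r: "run c e l x" using assms by (auto simp: orphan_def)
  then have e: "e = 1 \<or> e = -1" and l: "0 < l" using unit_cases by (auto simp: run_def)
  obtain t where t: "y = move (c x) t x"
    "\<And>i. min 0 t \<le> i \<Longrightarrow> i \<le> max 0 t \<Longrightarrow> c (move (c x) i x) = c x" using assms by (auto simp: same_run_def)
  define s where "s = e * t"
  have ts: "t = e * s" using e by (auto simp: s_def)
  have cy: "c y = c x" using assms same_run_colour by blast
  have s: "s < l"
  proof (rule ccontr)
    assume "\<not> s < l"
    then have "min 0 t \<le> e * l \<and> e * l \<le> max 0 t" using l e ts by auto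
    then show False using t(2)[of "e * l"] r by (auto simp: run_def)
  qed
  have "c (move (c x) (e * i) y) = c x" if i: "0 < i" "i < l - s" for i
  proof (cases "0 < i + s")
    case True
    then have "c (move (c x) (e * (i + s)) x) = c x" using r i by (auto simp: run_def)
    then show ?thesis by (simp add: t(1) ts algebra_simps)
  next
    case False
    then have "min 0 t \<le> e * (i + s) \<and> e * (i + s) \<le> max 0 t" using i e ts by auto
    then have "c (move (c x) (e * (i + s)) x) = c x" using t(2) by auto
    then show ?thesis by (simp add: t(1) ts algebra_simps)
  qed
  moreover have "move (c x) (e * (l - s)) y = move (c x) (e * l) x" by (simp add: t(1) ts algebra_simps)
  ultimately have ry: "run c e (l - s) y" using r s unfolding run_def cy by simp
  then show "\<not> orphan c y" by (auto simp: orphan_def)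
  show "parent c y = parent c x" using parent_run[OF alt ry] parent_run[OF alt r] cy
    by (simp add: t(1) ts algebra_simps)
qed

text \<open>Connectedness of the graph that joins neighbours along axis \<open>j\<close> if neither has colour \<open>j + 1\<close>,
stated through unions of components because this is the form in which topological connectedness
enters and leaves.\<close>

definition dendrite :: "colouring \<Rightarrow> bool" where
  "dendrite c \<longleftrightarrow> (\<forall>K. (\<forall>x j. c x \<noteq> j + 1 \<and> c (move j 1 x) \<noteq> j + 1 \<longrightarrow> (x \<in> K \<longleftrightarrow> move j 1 x \<in> K)) \<longrightarrow>
     K = {} \<or> K = UNIV)"

abbreviation ancestor :: "colouring \<Rightarrow> nat \<Rightarrow> point \<Rightarrow> point" where
  "ancestor c a \<equiv> parent c ^^ a"

lemma ancestor_orphan: "orphan c x \<Longrightarrow> ancestor c a x = x"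
  by (induction a) (auto simp: parent_orphan)

text \<open>Two neighbours that the graph joins are in one run, or one is the parent of the other. So the set
of tiles whose line of ancestors meets that of \<open>z\<close>, up to a run without a parent, is a union of
components.\<close>

lemma ancestor_meet:
  assumes alt: "alternating c" and den: "dendrite c"
  shows "\<exists>a b. same_run c (ancestor c a x) (ancestor c b z)"
proof -
  define K where "K = {x. \<exists>a b. same_run c (ancestor c a x) (ancestor c b z)}"
  have s: "y \<in> K" if sg: "same_run c x y" and xK: "x \<in> K" for x y
  proof (cases "orphan c x")
    case True
    then have "\<exists>b. same_run c x (ancestor c b z)" using that(2) ancestor_orphan[OF True] by (simp add: K_def)
    then obtain b where "same_run c y (ancestor c b z)" using same_run_trans[OF same_run_sym[OF sg]] by blast
    then have "same_run c (ancestor c 0 y) (ancestor c b z)" by simp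
    then show ?thesis unfolding K_def by blast
  next
    case False
    obtain a b where ab: "same_run c (ancestor c a x) (ancestor c b z)" using xK by (auto simp: K_def)
    show ?thesis
    proof (cases a)
      case 0
      then have "same_run c (ancestor c 0 y) (ancestor c b z)" using ab same_run_trans[OF same_run_sym[OF sg]] by simp
      then show ?thesis unfolding K_def by blast
    next
      case (Suc a')
      then have "ancestor c a y = ancestor c a x" using same_run_parent[OF alt that(1) False] by (simp add: funpow_Suc_right del: funpow.simps)
      then have "same_run c (ancestor c a y) (ancestor c b z)" using ab by simp
      then show ?thesis unfolding K_def by blast
    qed
  qed
  have p1: "x \<in> K" if xK: "parent c x \<in> K" for x
  proof -
    obtain a b where "same_run c (ancestor c a (parent c x)) (ancestor c b z)" using xK by (auto simp: K_def)
    then have "same_run c (ancestor c (Suc a) x) (ancestor c b z)" by (simp add: funpow_Suc_right del: funpow.simps)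
    then show ?thesis unfolding K_def by blast
  qed
  have p2: "parent c x \<in> K" if xK: "x \<in> K" for x
  proof -
    obtain a b where ab: "same_run c (ancestor c a x) (ancestor c b z)" using xK by (auto simp: K_def)
    show ?thesis
    proof (cases a)
      case 0
      show ?thesis
      proof (cases "orphan c x")
        case True then show ?thesis using xK parent_orphan by metis
      next
        case False
        have "ancestor c (Suc b) z = parent c x" using same_run_parent[OF alt _ False, of "ancestor c b z"] ab 0 by simp
        then have "same_run c (ancestor c 0 (parent c x)) (ancestor c (Suc b) z)" by simp
        then show ?thesis unfolding K_def by blast
      qed
    next
      case (Suc a')
      then have "same_run c (ancestor c a' (parent c x)) (ancestor c b z)" using ab
        by (simp add: funpow_Suc_right del: funpow.simps)
      then show ?thesis unfolding K_def by blast
    qed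
  qed
  have "x \<in> K \<longleftrightarrow> move j 1 x \<in> K" if h: "c x \<noteq> j + 1 \<and> c (move j 1 x) \<noteq> j + 1" for x j
  proof -
    define y where "y = move j 1 x"
    have xy: "x = move j (-1) y" by (simp add: y_def)
    have cs: "c x = j \<or> c x = j + 2" "c y = j \<or> c y = j + 2"
      using h three_other[of _ j] unfolding y_def by blast+
    have "\<not> (c x = j + 2 \<and> c y = j + 2)"
      using alternating_step[OF alt, of 1 1 x j] by (auto simp: y_def)
    then consider "c x = j" "c y = j" | "c x = j" "c y = j + 2" | "c x = j + 2" "c y = j" using cs by blast
    then have "same_run c x y \<or> parent c x = y \<or> parent c y = x"
    proof cases
      case 1
      have "\<forall>i. min 0 1 \<le> i \<and> i \<le> max 0 1 \<longrightarrow> c (move j i x) = j"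
      proof (intro allI impI)
        fix i :: int assume "min 0 1 \<le> i \<and> i \<le> max 0 1"
        then have "i = 0 \<or> i = 1" by linarith
        then show "c (move j i x) = j" using 1 by (auto simp: y_def)
      qed
      then have "same_run c x y" unfolding same_run_def using 1 y_def by metis
      then show ?thesis by simp
    next
      case 2
      then have "run c 1 1 x" by (auto simp: run_def y_def)
      from parent_run[OF alt this] show ?thesis using 2 by (simp add: y_def)
    next
      case 3
      then have "run c (-1) 1 y" by (auto simp: run_def y_def)
      from parent_run[OF alt this] show ?thesis using 3 by (simp add: y_def)
    qed
    then have "x \<in> K \<longleftrightarrow> y \<in> K" using s p1 p2 same_run_sym by metis
    then show ?thesis by (simp add: y_def)
  qed
  then have "K = {} \<or> K = UNIV" using den unfolding dendrite_def by blast
  moreover have "same_run c (ancestor c 0 z) (ancestor c 0 z)" by simp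
  then have "z \<in> K" unfolding K_def by blast
  ultimately have "x \<in> K" by auto
  then show ?thesis by (auto simp: K_def)
qed

section \<open>Growth of sides along ancestors\<close>

text \<open>The line of ancestors reaches \<open>z = parent c x\<close> in direction \<open>e\<close> and leaves it in direction \<open>-e\<close> of the
next axis, a turn by \<open>\<pi>/3\<close> to the left. The new side extends behind \<open>z\<close> as far as the old side is
long. For otherwise the triangle of the new side would have a side that starts less than \<open>k + l\<close>
steps behind \<open>z\<close> and runs across the old side.\<close>

lemma left_turn:
  assumes alt: "alternating c" and x: "on_side c e k l x" and z: "on_side c (- e) k' l' (parent c x)"
  shows "k + l \<le> k'"
proof (rule ccontr)
  assume "\<not> k + l \<le> k'"
  define j where "j = c x"
  define z where "z = parent c x"
  have e: "\<bar>e\<bar> = 1" and pos: "0 < k'" "0 < l'" "0 < k" using x assms(3) by (auto simp: on_side_def run_def)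
  have zx: "z = move j (e * l) x" using parent_run[OF alt on_side_run[OF x]] by (simp add: j_def z_def)
  have cz: "c z = j + 2" using x zx by (auto simp: on_side_def run_def j_def)
  define v where "v = move (j + 2) (e * k') z"
  have "side c (- e) (j + 2) v (k' + l')" using on_side_full_side[OF assms(3)] cz by (simp add: z_def v_def)
  then have "c (move (j + 2 + 2) (- (- e) * k') v) = j + 2 + 2"
    using triangle[OF alt _ \<open>side c (- e) (j + 2) v (k' + l')\<close>] e pos by auto
  then have "c (move j (- e * k') z) = j + 1" by (simp add: v_def)
  moreover have "c (move j (e * (l - k')) x) = j"
    using on_side_colour[OF x, of "l - k'"] \<open>\<not> k + l \<le> k'\<close> pos by (simp add: j_def)
  ultimately show False by (simp add: zx algebra_simps)
qed

text \<open>Every tile is inside a finite side, or its whole row has one colour. Periodic colourings with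
connected graph are of this kind.\<close>

definition tame :: "colouring \<Rightarrow> bool" where
  "tame c \<longleftrightarrow> (\<forall>x. (\<exists>e k l. on_side c e k l x) \<or> (\<forall>i. c (move (c x) i x) = c x))"

text \<open>A right turn at \<open>z\<close>, with a wall: the row of axis \<open>c z + 1\<close>, by which the line of ancestors came to \<open>z\<close>, is
of one colour for at least as many steps as the next step \<open>l\<close> of the line is long.\<close>

definition trapped :: "colouring \<Rightarrow> int \<Rightarrow> int \<Rightarrow> point \<Rightarrow> bool" where
  "trapped c e l z \<longleftrightarrow> (\<exists>k. on_side c e k l z) \<and>
     (\<forall>t. 0 < t \<and> t \<le> l \<longrightarrow> c (move (c z + 1) (- e * t) z) = c z + 1)"

text \<open>The line cannot cross the wall. From \<open>parent c z\<close> a left turn would need a side that extends, by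
\<open>left_turn\<close>, back through the wall; so the line turns right again, towards the wall. Either it
ends on the wall exactly where the triangle closes, which gives a cycle of three, or it ends
before, and then the path just walked is the wall for a shorter step.\<close>

lemma trapped_step:
  assumes alt: "alternating c" and tame: "tame c" and t: "trapped c e l z"
  shows "(\<exists>m. m < l \<and> trapped c e m (parent c z)) \<or> ancestor c 3 z = z"
proof -
  define j where "j = c z"
  define y where "y = parent c z"
  obtain k where k: "on_side c e k l z" using t by (auto simp: trapped_def)
  have e: "\<bar>e\<bar> = 1" and pos: "0 < k" "0 < l" using k by (auto simp: on_side_def run_def)
  have yz: "y = move j (e * l) z" using parent_run[OF alt on_side_run[OF k]] by (simp add: j_def y_def)
  have cy: "c y = j + 2" using k yz by (auto simp: on_side_def run_def j_def)
  have wall: "c (move (j + 1) (- e * t) z) = j + 1" if "0 < t" "t \<le> l" for t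
    using t that by (auto simp: trapped_def j_def)
  have hit: "c (move (j + 2) (e * l) y) = j + 1" using wall[of l] pos by (simp add: yz)
  then have "\<not> (\<forall>i. c (move (c y) i y) = c y)" using cy by (metis three_arith(7))
  then obtain e' k' l' where y: "on_side c e' k' l' y" using tame unfolding tame_def by blast
  then have e': "\<bar>e'\<bar> = 1" "0 < k'" "0 < l'" by (auto simp: on_side_def run_def)
  have "e' \<noteq> - e"
  proof
    assume "e' = - e"
    then have "k + l \<le> k'" using left_turn[OF alt k] y by (simp add: y_def)
    then have "c (move (c y) (e' * (- l)) y) = c y" using pos e' by (intro on_side_colour[OF y]) auto
    then show False using hit \<open>e' = - e\<close> cy by simp
  qed
  then have ee: "e' = e" using unit_sign_cases e e' by blast
  have l': "l' \<le> l"
  proof (rule ccontr)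
    assume "\<not> l' \<le> l"
    then have "c (move (c y) (e' * l) y) = c y" using pos e' by (intro on_side_colour[OF y]) auto
    then show False using hit ee cy by simp
  qed
  show ?thesis
  proof (cases "l' = l")
    case True
    define w where "w = parent c y"
    have w: "w = move (j + 1) (- e * l) z"
      using parent_run[OF alt on_side_run[OF y]] cy ee True by (simp add: w_def yz)
    have cw: "c w = j + 1" using wall[of l] pos w by simp
    have "c (move (j + 1) (e * i) w) = j + 1" if "0 < i" "i < l" for i
      using wall[of "l - i"] that by (simp add: w algebra_simps)
    then have "run c e l w" using e pos cw by (auto simp: run_def w j_def)
    then have "parent c w = z" using parent_run[OF alt, of e l w] cw by (simp add: w)
    then show ?thesis by (simp add: w_def y_def eval_nat_numeral)
  next
    case False
    have "c (move j (- e * t) y) = j" if "0 < t" "t \<le> l'" for t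
      using on_side_colour[OF k, of "l - t"] that l' False pos by (simp add: j_def yz algebra_simps)
    then have "trapped c e l' y" using y ee cy by (auto simp: trapped_def)
    moreover have "l' < l" using l' False by simp
    ultimately show ?thesis unfolding y_def by blast
  qed
qed

text \<open>The steps get shorter each time, so the spiral has to close up.\<close>

lemma trapped_cycle:
  assumes "alternating c" "tame c" "trapped c e l z"
  shows "\<exists>y. (\<exists>e k l. on_side c e k l y) \<and> ancestor c 3 y = y"
  using assms(3)
proof (induction "nat l" arbitrary: l z rule: less_induct)
  case less
  from trapped_step[OF assms(1,2) less.prems] show ?case
  proof
    assume "ancestor c 3 z = z"
    then show ?thesis using less.prems by (auto simp: trapped_def)
  next
    assume "\<exists>m<l. trapped c e m (parent c z)"
    then obtain m where m: "m < l" "trapped c e m (parent c z)" by blast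
    moreover have "0 < l" using less.prems by (auto simp: trapped_def on_side_def run_def)
    ultimately show ?thesis using less.hyps[of m] by auto
  qed
qed

text \<open>After a left turn the new side is longer by \<open>left_turn\<close>. After a right turn into a side that is not
longer, the old side is a wall for the new step.\<close>

lemma size_increases:
  assumes alt: "alternating c" and tame: "tame c"
    and nc: "\<And>y e k l. on_side c e k l y \<Longrightarrow> ancestor c 3 y \<noteq> y"
    and x: "on_side c e k l x" and z: "on_side c e' k' l' (parent c x)"
  shows "k + l < k' + l'"
proof (rule ccontr)
  assume le: "\<not> k + l < k' + l'"
  define j where "j = c x"
  define z where "z = parent c x"
  have e: "\<bar>e\<bar> = 1" "\<bar>e'\<bar> = 1" and pos: "0 < k'" "0 < l'" "0 < k"
    using x assms(5) by (auto simp: on_side_def run_def)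
  have zx: "z = move j (e * l) x" using parent_run[OF alt on_side_run[OF x]] by (simp add: j_def z_def)
  have cz: "c z = j + 2" using x zx by (auto simp: on_side_def run_def j_def)
  have "e' \<noteq> - e" using left_turn[OF alt x] assms(5) le pos by force
  then have ee: "e' = e" using unit_sign_cases e by blast
  have "c (move j (- e * t) z) = j" if "0 < t" "t \<le> l'" for t
    using on_side_colour[OF x, of "l - t"] that le pos by (simp add: j_def zx algebra_simps)
  then have "trapped c e l' z" using assms(5) ee cz by (auto simp: trapped_def z_def)
  then show False using trapped_cycle[OF alt tame] nc by blast
qed

section \<open>Periodic colourings\<close>

definition period :: "colouring \<Rightarrow> point \<Rightarrow> bool" where
  "period c v \<longleftrightarrow> (\<forall>x. c (x + v) = c x)"

lemma periodD: "period c v \<Longrightarrow> c (x + v) = c x" by (simp add: period_def)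

lemma run_translate:
  assumes "period c v"
  shows "run c e l (x + v) \<longleftrightarrow> run c e l x"
  by (simp add: run_def move_translate periodD[OF assms])

lemma on_side_translate:
  assumes "period c v"
  shows "on_side c e k l (x + v) \<longleftrightarrow> on_side c e k l x"
  by (simp add: on_side_def run_translate[OF assms] move_translate periodD[OF assms])

lemma parent_translate:
  assumes alt: "alternating c" and per: "period c v"
  shows "parent c (x + v) = parent c x + v"
proof (cases "orphan c x")
  case True
  then show ?thesis using run_translate[OF per] by (simp add: parent_orphan orphan_def)
next
  case False
  then obtain e l where r: "run c e l x" by (auto simp: orphan_def)
  then have "run c e l (x + v)" using run_translate[OF per] by simp
  then show ?thesis using parent_run[OF alt r] parent_run[OF alt, of e l "x + v"]
    by (simp add: periodD[OF per] move_translate)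
qed

lemma ancestor_translate:
  assumes "alternating c" and "period c v"
  shows "ancestor c a (x + v) = ancestor c a x + v"
  by (induction a) (auto simp: parent_translate[OF assms])

lemma periodic_mod:
  fixes f :: "int \<Rightarrow> 'a"
  assumes "\<And>i. f (i + t) = f i"
  shows "f (i mod t) = f i"
proof -
  have shift: "f (i + t * int n) = f i" for i n
  proof (induction n)
    case (Suc n)
    then show ?case using assms[of "i + t * int n"] by (simp add: algebra_simps)
  qed simp
  show ?thesis
  proof (cases "0 \<le> i div t")
    case True
    then show ?thesis using shift[of "i mod t" "nat (i div t)"] by simp
  next
    case False
    then have "i + t * int (nat (- (i div t))) = i mod t" by (simp add: minus_mult_div_eq_mod[symmetric])
    then show ?thesis using shift[of i "nat (- (i div t))"] by simp
  qed
qed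

text \<open>The lines of ancestors of \<open>x\<close> and \<open>x + v\<close> are constant, so they can only meet because \<open>x\<close> and \<open>x + v\<close>
are in one run. The period then repeats this run along the whole row.\<close>

lemma periodic_orphan_line:
  assumes alt: "alternating c" and den: "dendrite c" and per: "period c v" and v: "v \<noteq> 0"
    and x: "orphan c x"
  obtains t where "t \<noteq> 0" "\<And>y. y + v = move (c x) t y" "\<And>i. c (move (c x) i x) = c x"
proof -
  obtain a b where "same_run c (ancestor c a x) (ancestor c b (x + v))" using ancestor_meet[OF alt den] by blast
  then have "same_run c x (x + v)" using ancestor_orphan[OF x] ancestor_translate[OF alt per] by simp
  then obtain t where t: "x + v = move (c x) t x"
    "\<And>i. min 0 t \<le> i \<Longrightarrow> i \<le> max 0 t \<Longrightarrow> c (move (c x) i x) = c x" by (auto simp: same_run_def)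
  have t0: "t \<noteq> 0" using t(1) v by auto
  have tv: "y + v = move (c x) t y" for y using t(1) by (auto simp: move_def prod_eq_iff)
  have shift: "c (move (c x) (i + t) x) = c (move (c x) i x)" for i
  proof -
    have "move (c x) (i + t) x = move (c x) i x + v" unfolding tv by (simp add: add.commute)
    then show ?thesis using periodD[OF per] by simp
  qed
  have "c (move (c x) i x) = c x" for i
  proof -
    have "c (move (c x) (i mod t) x) = c x"
    proof (rule t(2))
      have "0 \<le> i mod t \<and> i mod t < t \<or> t < i mod t \<and> i mod t \<le> 0"
        using t0 pos_mod_sign[of t i] pos_mod_bound[of t i] neg_mod_sign[of t i] neg_mod_bound[of t i] by linarith
      then show "min 0 t \<le> i mod t" "i mod t \<le> max 0 t" by linarith+
    qed
    then show ?thesis using periodic_mod[of "\<lambda>i. c (move (c x) i x)" t i, OF shift] by simp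
  qed
  then show ?thesis using that t0 tv by blast
qed

text \<open>It is to be excluded that the run of \<open>x\<close> goes on forever away from its parent \<open>z\<close>. Then the run that
leaves \<open>z\<close> along the next axis would also go on forever, since by \<open>triangle\<close> a finite side there has
neighbours of the same finite length. Its tiles have no parent, yet their row is not of one colour
because it contains \<open>z\<close>.\<close>

lemma periodic_not_orphan_on_side:
  assumes alt: "alternating c" and den: "dendrite c" and per: "period c v" and v: "v \<noteq> 0"
    and "\<not> orphan c x"
  shows "\<exists>e k l. on_side c e k l x"
proof -
  define j where "j = c x"
  obtain e l where r: "run c e l x" using assms(5) by (auto simp: orphan_def)
  then have e: "\<bar>e\<bar> = 1" and l: "0 < l" by (auto simp: run_def)
  define z where "z = move j (e * l) x"
  have cz: "c z = j + 2" using r by (simp add: run_def z_def j_def)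
  have "\<exists>k>0. c (move j (- e * k) x) \<noteq> j"
  proof (rule ccontr)
    assume "\<not> (\<exists>k>0. c (move j (- e * k) x) \<noteq> j)"
    then have ray: "c (move j (- e * k) x) = j" if "0 < k" for k using that by blast
    have run: "c (move j (- e * m) z) = j" if "0 < m" for m
    proof -
      have eq: "move j (- e * m) z = move j (- e * (m - l)) x" by (simp add: z_def algebra_simps)
      consider "m = l" | "m < l" | "l < m" by linarith
      then show ?thesis
      proof cases
        case 2
        then have "c (move j (e * (l - m)) x) = j" using r that by (auto simp: run_def j_def)
        then show ?thesis using eq by (simp add: algebra_simps)
      qed (use eq ray[of "m - l"] in \<open>auto simp: j_def\<close>)
    qed
    have ray2: "c (move (j + 1) (e * i) z) = j + 1" if "0 < i" for i
    proof (rule ccontr)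
      assume "c (move (j + 1) (e * i) z) \<noteq> j + 1"
      from least_pos_int[of i "\<lambda>i. c (move (j + 1) (e * i) z) \<noteq> j + 1", OF that this]
      obtain m where m: "0 < m" "c (move (j + 1) (e * m) z) \<noteq> j + 1"
        and mm: "\<And>i. 0 < i \<Longrightarrow> i < m \<Longrightarrow> c (move (j + 1) (e * i) z) = j + 1" by metis
      have "c (move (j + 1) (e * m) z) \<noteq> c z"
        using alternating_step[OF alt e m(1), of z "j + 1"] mm cz by auto
      then have "c (move (j + 1) (e * m) z) = j" using m(2) cz three_other[of _ j] by metis
      then have "side c e (j + 1) z m" using m mm cz by (auto simp: side_def)
      from triangle[OF alt e this] have "c (move j (- e * m) z) = j + 1" by simp
      then show False using run[OF m(1)] by simp
    qed
    \<comment> \<open>The neighbour of \<open>z\<close> on this ray: in one direction nothing else follows, in the other \<open>z\<close> is at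
      once the wrong end.\<close>
    define u where "u = move (j + 1) e z"
    have cu: "c u = j + 1" using ray2[of 1] by (simp add: u_def)
    have "orphan c u" unfolding orphan_def
    proof (intro allI notI)
      fix e' l' assume r': "run c e' l' u"
      then have "e' = e \<or> e' = - e" using unit_sign_cases[OF e] by (auto simp: run_def)
      then show False
      proof
        assume "e' = e"
        then have "c (move (j + 1) (e * (l' + 1)) z) \<noteq> j + 1"
          using r' cu by (auto simp: run_def u_def algebra_simps)
        then show False using ray2[of "l' + 1"] r' by (auto simp: run_def)
      next
        assume e': "e' = - e"
        have "move (j + 1) (e' * 1) u = z" by (simp add: u_def e')
        then show False using r' cz cu unfolding run_def by (cases "l' = 1") (auto dest!: spec[where x = 1])
      qed
    qed
    from periodic_orphan_line[OF alt den per v this] have "c (move (c u) (- e) u) = c u" by blast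
    then have "c (move (j + 1) (- e) u) = j + 1" using cu by simp
    then show False using cz by (simp add: u_def)
  qed
  then obtain k0 where "0 < k0" "c (move j (- e * k0) x) \<noteq> j" by blast
  from least_pos_int[of k0 "\<lambda>k. c (move j (- e * k) x) \<noteq> j", OF this]
  obtain k where k: "0 < k" "c (move j (- e * k) x) \<noteq> j"
    and kk: "\<And>i. 0 < i \<Longrightarrow> i < k \<Longrightarrow> c (move j (- e * i) x) = j" by metis
  have "c (move j (- e * k) x) \<noteq> j + 2"
  proof
    assume "c (move j (- e * k) x) = j + 2"
    then have "run c (- e) k x" using k kk e by (auto simp: run_def j_def)
    from run_unique[OF alt r this] show False using e by simp
  qed
  then have "on_side c e k l x" using r k kk three_other[of _ j] by (auto simp: on_side_def j_def)
  then show ?thesis by blast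
qed

text \<open>The distance from the row of axis \<open>j\<close> through the origin, in units of the distance between
adjacent rows.\<close>

definition height :: "3 \<Rightarrow> point \<Rightarrow> int" where
  "height j u = (if j = 0 then snd u else if j = 1 then fst u else fst u - snd u)"

lemma height_move [simp]: "height j (move j i u) = height j u"
  using three_cases[of j] by (auto simp: height_def move_def unit_step_def)

lemma height_move_le: "\<bar>height j (move k i u) - height j u\<bar> \<le> \<bar>i\<bar>"
  using three_cases[of j] three_cases[of k] by (auto simp: height_def move_def unit_step_def)

lemma height_move_next: "\<bar>height j (move (j + 1) i u) - height j u\<bar> = \<bar>i\<bar>"
  using three_cases[of j] by (auto simp: height_def move_def unit_step_def)

text \<open>The length of the side that has \<open>x\<close> in its interior; meaningful for tiles inside a finite side,
where it is unique.\<close>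

definition size_of :: "colouring \<Rightarrow> point \<Rightarrow> int" where
  "size_of c x = (THE n. \<exists>e k l. on_side c e k l x \<and> n = k + l)"

lemma size_of_on_side:
  assumes "alternating c" and "on_side c e k l x"
  shows "size_of c x = k + l"
  unfolding size_of_def
proof (rule the_equality)
  show "\<exists>e' k' l'. on_side c e' k' l' x \<and> k + l = k' + l'" using assms by blast
  show "n = k + l" if "\<exists>e k l. on_side c e k l x \<and> n = k + l" for n
    using that on_side_unique[OF assms(1) _ assms(2)] by blast
qed

lemma funpow_fixed: "(f ^^ n) x = x \<Longrightarrow> (f ^^ (n * m)) x = x"
  by (induction m) (auto simp: funpow_add)

lemma funpow_funpow: "(f ^^ m) ((f ^^ n) x) = (f ^^ (m + n)) x"
  by (simp add: funpow_add)

text \<open>Lengths of sides are invariant under a period and increase along lines of ancestors.\<close>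

theorem alternating_dendrite_nonperiodic:
  assumes alt: "alternating c" and den: "dendrite c" and per: "period c v"
  shows "v = 0"
proof (rule ccontr)
  assume v: "v \<noteq> 0"
  note ancestor_tr = ancestor_translate[OF alt per]
  have ins: "\<exists>e k l. on_side c e k l x" if "\<not> orphan c x" for x
    using periodic_not_orphan_on_side[OF alt den per v that] .
  have not_orphan: "\<not> orphan c x" if "on_side c e k l x" for e k l x
    using on_side_run[OF that] by (auto simp: orphan_def)
  have tame: "tame c" unfolding tame_def
  proof
    fix x
    show "(\<exists>e k l. on_side c e k l x) \<or> (\<forall>i. c (move (c x) i x) = c x)"
    proof (cases "orphan c x")
      case True
      from periodic_orphan_line[OF alt den per v this] show ?thesis by blast
    qed (use ins in blast)
  qed
  have nc: "ancestor c 3 y \<noteq> y" if y: "on_side c e k l y" for y e k l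
  proof
    assume cyc: "ancestor c 3 y = y"
    have nr: "\<not> orphan c (ancestor c a y)" for a
    proof
      assume "orphan c (ancestor c a y)"
      then have "ancestor c m (ancestor c a y) = ancestor c a y" for m by (rule ancestor_orphan)
      then have "ancestor c (m + a) y = ancestor c a y" for m by (simp add: funpow_add)
      then have "ancestor c (1 + 2 * a + a) y = ancestor c (2 * a + a) y" by metis
      moreover have "ancestor c (3 * a) y = y" using funpow_fixed[OF cyc] .
      ultimately have "parent c y = y" by (simp add: algebra_simps)
      then show False using parent_colour[OF alt not_orphan[OF y]] by simp
    qed
    obtain a b where "same_run c (ancestor c a y) (ancestor c b (y + v))" using ancestor_meet[OF alt den] by blast
    then have "parent c (ancestor c b (y + v)) = parent c (ancestor c a y)" using same_run_parent(2)[OF alt _ nr] by blast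
    then have ab: "ancestor c (Suc a) y = ancestor c (Suc b) y + v"
      by (simp add: ancestor_tr parent_translate[OF alt per])
    define w where "w = ancestor c (Suc b) y"
    \<comment> \<open>Modulo 3 this is the difference of the two step counts, so \<open>m\<close> steps lead from \<open>w\<close> to \<open>w + v\<close>.\<close>
    define m where "m = Suc a + 2 * Suc b"
    have m: "m + Suc b = Suc a + 3 * Suc b" by (simp add: m_def)
    have "ancestor c m w = ancestor c (Suc a) (ancestor c (3 * Suc b) y)" by (simp only: w_def funpow_funpow m)
    also have "\<dots> = w + v" using funpow_fixed[OF cyc, of "Suc b"] ab by (simp only: w_def)
    finally have mw: "ancestor c m w = w + v" .
    have "ancestor c 3 w = ancestor c (Suc b) (ancestor c 3 y)" unfolding w_def funpow_funpow by (simp only: add.commute)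
    then have "ancestor c 3 w = w" by (simp only: cyc w_def)
    then have "ancestor c (3 * m) w = w" by (rule funpow_fixed)
    moreover have "ancestor c (3 * m) w = ancestor c m (ancestor c m (ancestor c m w))"
      unfolding funpow_funpow by (rule arg_cong[where f = "\<lambda>n. ancestor c n w"]) simp
    moreover have "\<dots> = w + v + v + v" by (simp add: mw ancestor_tr)
    ultimately have "v + v + v = 0" by (simp add: add.assoc)
    then have "v = 0" by (auto simp: prod_eq_iff)
    then show False using v by simp
  qed
  have grow: "size_of c x < size_of c (parent c x)" if nx: "\<not> orphan c x" and nz: "\<not> orphan c (parent c x)" for x
  proof -
    obtain e k l where x: "on_side c e k l x" using ins[OF nx] by blast
    obtain e' k' l' where z: "on_side c e' k' l' (parent c x)" using ins[OF nz] by blast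
    show ?thesis
      using size_increases[OF alt tame nc x z] size_of_on_side[OF alt x] size_of_on_side[OF alt z] by simp
  qed
  show False
  proof (cases "\<exists>x. orphan c x")
    case False
    then have nr: "\<not> orphan c x" for x by blast
    define x :: "point" where "x = 0"
    obtain a b where "same_run c (ancestor c a x) (ancestor c b (x + v))" using ancestor_meet[OF alt den] by blast
    then have "parent c (ancestor c b (x + v)) = parent c (ancestor c a x)" using same_run_parent(2)[OF alt _ nr] by blast
    then have ab: "ancestor c (Suc a) x = ancestor c (Suc b) x + v"
      by (simp add: ancestor_tr parent_translate[OF alt per])
    have mono: "strict_mono (\<lambda>i. size_of c (ancestor c i x))"
      unfolding strict_mono_Suc_iff using grow nr by auto
    have "size_of c (y + v) = size_of c y" for y
      by (simp add: size_of_def on_side_translate[OF per])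
    then have "size_of c (ancestor c (Suc a) x) = size_of c (ancestor c (Suc b) x)" by (simp only: ab)
    then have "Suc a = Suc b" by (simp only: strict_mono_eq[OF mono, of "Suc a" "Suc b"])
    then show False using ab v by simp
  next
    case True
    then obtain x where x: "orphan c x" by blast
    define j where "j = c x"
    obtain t where t: "t \<noteq> 0" "\<And>y. y + v = move j t y" "\<And>i. c (move j i x) = j"
      using periodic_orphan_line[OF alt den per v x] unfolding j_def by blast
    have on_line: "\<exists>i. y = move j i x" if ry: "orphan c y" for y
    proof -
      obtain a b where "same_run c (ancestor c a x) (ancestor c b y)" using ancestor_meet[OF alt den] by blast
      then have "same_run c x y" using ancestor_orphan[OF x] ancestor_orphan[OF ry] by simp
      then show ?thesis by (auto simp: same_run_def j_def)
    qed
    \<comment> \<open>Lengths of the last sides before the row of \<open>x\<close> is reached, at its \<open>i\<close>-th tile: at most two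
      values, and periodic in \<open>i\<close>, hence bounded by some \<open>N\<close>.\<close>
    define S where "S i = {size_of c y |y. \<not> orphan c y \<and> parent c y = move j i x}" for i
    have S_fin: "finite (S i)" for i
    proof -
      define z where "z = move j i x"
      define U where "U e = {n. side c e (j + 1) (move (j + 1) (- e * n) z) n}" for e
      have U1: "n = n'" if "n \<in> U e" "n' \<in> U e" for n n' e
      proof -
        have *: "\<not> n < n'" if "n \<in> U e" "n' \<in> U e" for n n'
        proof
          assume "n < n'"
          have "c (move (j + 1) (e * (n' - n)) (move (j + 1) (- e * n') z)) = j + 1"
            using that \<open>n < n'\<close> by (auto simp: U_def side_def)
          moreover have "move (j + 1) (e * (n' - n)) (move (j + 1) (- e * n') z) = move (j + 1) (- e * n) z"
            by (simp add: algebra_simps)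
          ultimately show False using that by (auto simp: U_def side_def)
        qed
        then show ?thesis using *[OF that] *[OF that(2,1)] by linarith
      qed
      have U_fin: "finite (U e)" for e
      proof (cases "U e = {}")
        case False
        then obtain n where "n \<in> U e" by blast
        then have "U e \<subseteq> {n}" using U1 by blast
        then show ?thesis using finite_subset by blast
      qed simp
      have "S i \<subseteq> U 1 \<union> U (-1)"
      proof
        fix n assume "n \<in> S i"
        then obtain y where y: "n = size_of c y" "\<not> orphan c y" "parent c y = z" by (auto simp: S_def z_def)
        obtain e k l where i: "on_side c e k l y" using ins y by blast
        have e: "e = 1 \<or> e = -1" using i unit_cases by (auto simp: on_side_def run_def)
        have n: "n = k + l" using y size_of_on_side[OF alt i] by simp
        have "c z = j" using t(3) by (simp add: z_def)
        then have "c y + 2 = j" using parent_colour[OF alt y(2)] y(3) by simp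
        then have cy: "c y = j + 1" by (metis three_arith(3))
        have "z = move (j + 1) (e * l) y" using parent_run[OF alt on_side_run[OF i]] cy y by simp
        then have "move (j + 1) (- e * k) y = move (j + 1) (- e * n) z" by (simp add: n algebra_simps)
        then have "n \<in> U e" using on_side_full_side[OF i] cy by (simp add: U_def n)
        then show "n \<in> U 1 \<union> U (-1)" using e by auto
      qed
      then show ?thesis using U_fin finite_subset by blast
    qed
    have S_per: "S (i + t) = S i" for i
    proof -
      have m: "move j (i + t) x = move j i x + v" unfolding t(2) by (simp add: add.commute)
      have rt: "orphan c (y + v) = orphan c y" for y by (simp add: orphan_def run_translate[OF per])
      have sz: "size_of c (y + v) = size_of c y" for y
        by (simp add: size_of_def on_side_translate[OF per])
      show ?thesis
      proof
        show "S (i + t) \<subseteq> S i"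
        proof
          fix n assume "n \<in> S (i + t)"
          then obtain y where y: "n = size_of c y" "\<not> orphan c y" "parent c y = move j i x + v"
            by (auto simp: S_def m)
          define z where "z = y - v"
          have yz: "y = z + v" by (simp add: z_def)
          have "n = size_of c z" "\<not> orphan c z" "parent c z = move j i x"
            using y by (simp_all add: yz sz rt parent_translate[OF alt per])
          then show "n \<in> S i" unfolding S_def by blast
        qed
        show "S i \<subseteq> S (i + t)"
        proof
          fix n assume "n \<in> S i"
          then obtain y where "n = size_of c y" "\<not> orphan c y" "parent c y = move j i x" by (auto simp: S_def)
          then have "n = size_of c (y + v)" "\<not> orphan c (y + v)" "parent c (y + v) = move j (i + t) x"
            by (simp_all add: m sz rt parent_translate[OF alt per])
          then show "n \<in> S (i + t)" unfolding S_def by blast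
        qed
      qed
    qed
    have S_mod: "S i = S (i mod t)" for i
      using periodic_mod[of S t i, OF S_per] by simp
    define N where "N = Max (insert 1 (\<Union>i\<in>{- \<bar>t\<bar>..\<bar>t\<bar>}. S i))"
    have fin: "finite (insert 1 (\<Union>i\<in>{- \<bar>t\<bar>..\<bar>t\<bar>}. S i))" using S_fin by simp
    have N: "n \<le> N" if "n \<in> S i" for n i
    proof -
      have "i mod t \<in> {- \<bar>t\<bar>..\<bar>t\<bar>}"
        using t(1) abs_mod_less[of t i] by auto
      then have "n \<in> (\<Union>i\<in>{- \<bar>t\<bar>..\<bar>t\<bar>}. S i)" using that S_mod[of i] by blast
      then show ?thesis unfolding N_def using fin by (intro Max_ge) auto
    qed
    have N1: "1 \<le> N" unfolding N_def using fin by (intro Max_ge) auto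
    have step: "\<bar>height j (parent c y) - height j y\<bar> \<le> size_of c y" "0 < size_of c y" if ny: "\<not> orphan c y" for y
    proof -
      obtain e k l where i: "on_side c e k l y" using ins[OF ny] by blast
      then have "\<bar>e * l\<bar> \<le> size_of c y" "0 < size_of c y" using size_of_on_side[OF alt i]
        by (auto simp: on_side_def run_def abs_mult)
      then show "\<bar>height j (parent c y) - height j y\<bar> \<le> size_of c y" "0 < size_of c y"
        using parent_run[OF alt on_side_run[OF i]] height_move_le[of j "c y" "e * l" y] by auto
    qed
    \<comment> \<open>A tile with a side of length \<open>s\<close> reaches the row in at most \<open>N + 1 - s\<close> steps, none longer than \<open>N\<close>.\<close>
    have bound: "size_of c y \<le> N \<and> \<bar>height j y - height j x\<bar> \<le> N * (N + 1 - size_of c y)"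
      if "orphan c (ancestor c a y)" "\<not> orphan c y" for a y
      using that
    proof (induction a arbitrary: y)
      case (Suc a)
      define z where "z = parent c y"
      have r: "orphan c (ancestor c a z)" using Suc.prems(1) by (simp add: z_def funpow_Suc_right del: funpow.simps)
      have st: "\<bar>height j z - height j y\<bar> \<le> size_of c y" using step[OF Suc.prems(2)] by (simp add: z_def)
      show ?case
      proof (cases "orphan c z")
        case True
        then obtain i where i: "z = move j i x" using on_line by blast
        then have "size_of c y \<in> S i" using Suc.prems(2) by (auto simp: S_def z_def)
        then have le: "size_of c y \<le> N" by (rule N)
        then have "N * 1 \<le> N * (N + 1 - size_of c y)" using N1 by (intro mult_left_mono) auto
        then show ?thesis using le st i by auto
      next
        case False
        have IH: "size_of c z \<le> N" "\<bar>height j z - height j x\<bar> \<le> N * (N + 1 - size_of c z)"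
          using Suc.IH[OF r False] by auto
        have gr: "size_of c y < size_of c z" using grow[OF Suc.prems(2)] False by (simp add: z_def)
        then have "N * (N + 1 - size_of c z) \<le> N * (N - size_of c y)" using N1 by (intro mult_left_mono) auto
        then show ?thesis using IH gr st by (simp add: algebra_simps)
      qed
    qed simp
    define y where "y = move (j + 1) (N * N + 1) x"
    have hy: "\<bar>height j y - height j x\<bar> = N * N + 1" using height_move_next[of j "N * N + 1" x] N1 by (simp add: y_def)
    have "\<not> orphan c y"
    proof
      assume "orphan c y"
      then obtain i where "y = move j i x" using on_line by blast
      then have "N * N + 1 = 0" using hy by simp
      then show False using zero_le_square[of N] by linarith
    qed
    obtain a b where "same_run c (ancestor c a x) (ancestor c b y)" using ancestor_meet[OF alt den] by blast
    then have "same_run c x (ancestor c b y)" using ancestor_orphan[OF x] by simp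
    then have "same_run c (ancestor c b y) x" by (rule same_run_sym)
    then have "orphan c (ancestor c b y)" using same_run_parent(1)[OF alt, of "ancestor c b y" x] x by blast
    then have "\<bar>height j y - height j x\<bar> \<le> N * (N + 1 - size_of c y)"
      using bound[OF _ \<open>\<not> orphan c y\<close>] by blast
    also have "\<dots> \<le> N * N" using step(2)[OF \<open>\<not> orphan c y\<close>] N1 by (intro mult_left_mono) auto
    finally show False using hy by simp
  qed
qed

section \<open>Marks on the crossed edges\<close>

text \<open>The value \<open>\<sigma> j x\<close> tells on which side of the row of axis \<open>j\<close> the mark lies on the edge between \<open>x\<close>
and the next tile. The three clauses say how a tile of each colour transmits the mark.\<close>

definition consistent :: "colouring \<Rightarrow> (3 \<Rightarrow> point \<Rightarrow> bool) \<Rightarrow> bool" where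
  "consistent c \<sigma> \<longleftrightarrow> (\<forall>x j.
     (c x = j \<longrightarrow> \<sigma> j x = \<sigma> j (move j (-1) x)) \<and>
     (c x = j + 1 \<longrightarrow> \<sigma> j x \<and> \<not> \<sigma> j (move j (-1) x)) \<and>
     (c x = j + 2 \<longrightarrow> \<not> \<sigma> j x \<and> \<sigma> j (move j (-1) x)))"

lemma consistentD:
  assumes "consistent c \<sigma>"
  shows "c x = j \<Longrightarrow> \<sigma> j x = \<sigma> j (move j (-1) x)"
    and "c x = j + 1 \<Longrightarrow> \<sigma> j x \<and> \<not> \<sigma> j (move j (-1) x)"
    and "c x = j + 2 \<Longrightarrow> \<not> \<sigma> j x \<and> \<sigma> j (move j (-1) x)"
  using assms by (auto simp: consistent_def)

text \<open>A tile of colour \<open>j + 1\<close> leaves the mark on one side, colour \<open>j\<close> keeps it there, and the next tile of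
colour \<open>j + 1\<close> would need it on the other side.\<close>

lemma consistent_alternating:
  assumes con: "consistent c \<sigma>"
  shows "alternating c"
  unfolding alternating_def
proof (intro allI impI, rule ccontr)
  fix x j and n :: int
  assume h: "0 < n \<and> c x \<noteq> j \<and> c (move j n x) = c x"
    and "\<not> (\<exists>i. 0 < i \<and> i < n \<and> c (move j i x) \<noteq> j)"
  then have run: "c (move j i x) = j" if "0 < i" "i < n" for i using that by blast
  have "int k < n \<longrightarrow> \<sigma> j (move j (int k) x) = \<sigma> j x" for k
  proof (induction k)
    case (Suc k)
    show ?case
    proof
      assume k: "int (Suc k) < n"
      have "\<sigma> j (move j (int (Suc k)) x) = \<sigma> j (move j (-1) (move j (int (Suc k)) x))"
        using consistentD(1)[OF con run[of "int (Suc k)"]] k by simp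
      then show "\<sigma> j (move j (int (Suc k)) x) = \<sigma> j x" using Suc k by simp
    qed
  qed simp
  from this[of "nat (n - 1)"] have "\<sigma> j (move j (-1) (move j n x)) = \<sigma> j x" using h by simp
  moreover have "c x = j + 1 \<or> c x = j + 2" using h three_other by blast
  ultimately show False
    using consistentD(2,3)[OF con, of x j] consistentD(2,3)[OF con, of "move j n x" j] h by auto
qed

text \<open>The row of axis \<open>j\<close> through \<open>x\<close>, read from \<open>x\<close> on in direction \<open>e\<close>, consists of tiles of colour \<open>j\<close>
up to one of colour \<open>a\<close>.\<close>

inductive leads :: "colouring \<Rightarrow> int \<Rightarrow> 3 \<Rightarrow> 3 \<Rightarrow> point \<Rightarrow> bool" for c e a j where
  "c x = a \<Longrightarrow> leads c e a j x"
| "c x = j \<Longrightarrow> leads c e a j (move j e x) \<Longrightarrow> leads c e a j x"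

lemma leads_run:
  assumes "leads c e a j x"
  shows "\<exists>n\<ge>0. c (move j (e * n) x) = a \<and> (\<forall>i. 0 \<le> i \<and> i < n \<longrightarrow> c (move j (e * i) x) = j)"
  using assms
proof induction
  case (1 x)
  then show ?case by (intro exI[of _ 0]) auto
next
  case (2 x)
  then obtain n where n: "n \<ge> 0" "c (move j (e * n) (move j e x)) = a"
    "\<And>i. 0 \<le> i \<Longrightarrow> i < n \<Longrightarrow> c (move j (e * i) (move j e x)) = j" by blast
  have "c (move j (e * i) x) = j" if "0 \<le> i" "i < n + 1" for i
    using n(3)[of "i - 1"] 2(1) that by (cases "i = 0") (auto simp: algebra_simps)
  then show ?case using n(1,2) by (intro exI[of _ "n + 1"]) (auto simp: algebra_simps)
qed

lemma not_leads_to_same: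
  assumes alt: "alternating c" and e: "\<bar>e\<bar> = 1" and "c x \<noteq> j"
  shows "\<not> leads c e (c x) j (move j e x)"
proof
  assume "leads c e (c x) j (move j e x)"
  from leads_run[OF this] obtain n where n: "n \<ge> 0" "c (move j (e * n) (move j e x)) = c x"
    "\<And>i. 0 \<le> i \<Longrightarrow> i < n \<Longrightarrow> c (move j (e * i) (move j e x)) = j" by blast
  have "c (move j (e * (n + 1)) x) \<noteq> c x"
  proof (rule alternating_step[OF alt e])
    fix i assume "0 < i" "i < n + 1"
    then show "c (move j (e * i) x) = j" using n(3)[of "i - 1"] by (simp add: algebra_simps)
  qed (use n(1) assms(3) in auto)
  then show False using n(2) by (simp add: algebra_simps)
qed

text \<open>The mark after \<open>x\<close> can be read off from the last tile of another colour up to \<open>x\<close> (\<open>B\<close>) or, if there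
is none, from the first one after it (\<open>F\<close>). In a row of colour \<open>j\<close> alone neither exists and the
constant choice is \<open>False\<close>.\<close>

lemma alternating_consistent:
  assumes alt: "alternating c"
  shows "\<exists>\<sigma>. consistent c \<sigma>"
proof -
  define B where "B j = leads c (-1) (j + 1) j" for j
  define F where "F j x = leads c 1 (j + 2) j (move j 1 x)" for j x
  have B: "B j x \<longleftrightarrow> c x = j + 1 \<or> c x = j \<and> B j (move j (-1) x)" for j x
    unfolding B_def by (subst leads.simps) auto
  have F: "F j (move j (-1) x) \<longleftrightarrow> c x = j + 2 \<or> c x = j \<and> F j x" for j x
    unfolding F_def move_move by (subst leads.simps) auto
  have noB: "\<not> B j (move j (-1) x)" if "c x = j + 1" for j x
    using not_leads_to_same[OF alt, of "-1" x j] that by (simp add: B_def)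
  have noF: "\<not> F j x" if "c x = j + 2" for j x
    using not_leads_to_same[OF alt, of 1 x j] that by (simp add: F_def)
  have "consistent c (\<lambda>j x. B j x \<or> F j x)"
    unfolding consistent_def
  proof (intro allI conjI impI)
    fix x j
    show "(B j x \<or> F j x) = (B j (move j (-1) x) \<or> F j (move j (-1) x))" if "c x = j"
      using that B[of j x] F[of j x] by auto
    show "B j x \<or> F j x" "\<not> (B j (move j (-1) x) \<or> F j (move j (-1) x))" if "c x = j + 1"
      using that B[of j x] F[of j x] noB[OF that] by auto
    show "\<not> (B j x \<or> F j x)" "B j (move j (-1) x) \<or> F j (move j (-1) x)" if "c x = j + 2"
      using that B[of j x] F[of j x] noF[OF that] by auto
  qed
  then show ?thesis by blast
qed

section \<open>A self-similar colouring\<close>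

text \<open>In the coordinate \<open>w = (3a + 1, 3b)\<close> this is multiplication by \<open>-2\<close>. The points \<open>w\<close> avoid the origin,
so each of them is a power of \<open>2\<close> times a vector that is not zero modulo \<open>2\<close>, and \<open>colour\<close> is the
class of that vector: the classes of \<open>d\<^sub>0\<close>, \<open>d\<^sub>1\<close>, \<open>d\<^sub>2\<close> give the colours \<open>0\<close>, \<open>1\<close>, \<open>2\<close>.\<close>

definition inflate :: "point \<Rightarrow> point" where
  "inflate x = (- 2 * fst x - 1, - 2 * snd x)"

text \<open>The quantity \<open>\<bar>3a + 1\<bar>\<close> is doubled by \<open>inflate\<close> and never vanishes, so it decreases strictly when
\<open>inflate\<close> is undone.\<close>

lemma inflate_norm:
  fixes k :: int
  shows "\<bar>3 * (2 * k + 1) + 1\<bar> = 2 * \<bar>3 * k + 2\<bar>" "\<bar>3 * (- k - 1) + 1\<bar> = \<bar>3 * k + 2\<bar>" "0 < \<bar>3 * k + 2\<bar>"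
proof -
  have "3 * k + 2 \<noteq> 0" by presburger
  then show "0 < \<bar>3 * k + 2\<bar>" by simp
qed (auto simp: abs_if)

function colour :: "colouring" where
  "colour (a, b) = (if even a then (if even b then 0 else 2) else if odd b then 1
     else colour ((- a - 1) div 2, - b div 2))"
  by pat_completeness auto
termination
proof (relation "Wellfounded.measure (\<lambda>(a, b). nat (\<bar>3 * a + 1\<bar> + \<bar>b\<bar>))")
  fix a b :: int
  assume "\<not> even a" "\<not> odd b"
  then obtain k l where ab: "a = 2 * k + 1" "b = 2 * l" by (auto elim!: oddE evenE)
  have "- a - 1 = 2 * (- k - 1)" "- b = 2 * (- l)" using ab by simp_all
  then have half: "(- a - 1) div 2 = - k - 1" "- b div 2 = - l" by simp_all
  have
    "\<bar>3 * (- k - 1) + 1\<bar> + \<bar>- l\<bar> < \<bar>3 * (2 * k + 1) + 1\<bar> + \<bar>2 * l\<bar>"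
    unfolding inflate_norm using inflate_norm(3)[of k] by (simp add: abs_mult)
  then show "(((- a - 1) div 2, - b div 2), a, b) \<in> Wellfounded.measure (\<lambda>(a, b). nat (\<bar>3 * a + 1\<bar> + \<bar>b\<bar>))"
    unfolding in_measure prod.case half by (simp only: ab nat_less_eq_zless abs_ge_zero add_nonneg_nonneg)
qed simp

declare colour.simps [simp del]

lemma colour_inflate [simp]: "colour (inflate x) = colour x"
proof -
  have "colour (- 2 * a - 1, - 2 * b) = colour (a, b)" for a b
    by (subst colour.simps) simp
  then show ?thesis by (cases x) (simp add: inflate_def)
qed

lemma colour_simps:
  shows "even (fst x) \<Longrightarrow> even (snd x) \<Longrightarrow> colour x = 0"
    and "odd (fst x) \<Longrightarrow> odd (snd x) \<Longrightarrow> colour x = 1"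
    and "even (fst x) \<Longrightarrow> odd (snd x) \<Longrightarrow> colour x = 2"
  using colour.simps[of "fst x" "snd x"] by auto

lemma inflate_cases:
  obtains y where "x = inflate y" | "even (fst x) \<or> odd (snd x)"
proof (cases "even (fst x) \<or> odd (snd x)")
  case False
  then obtain k l where "fst x = 2 * k + 1" "snd x = 2 * l" by (auto elim!: oddE evenE)
  then have "x = inflate (- k - 1, - l)" by (simp add: inflate_def prod_eq_iff)
  then show ?thesis by (rule that(1))
next
  case True
  then show ?thesis by (rule that(2))
qed

lemma move_inflate: "move j (2 * n) (inflate y) = inflate (move j (- n) y)"
  by (simp add: move_def inflate_def algebra_simps)

text \<open>In a row of axis \<open>j\<close> that contains inflated points these occupy every other place, and the places
between them have colour \<open>j\<close>.\<close>

lemma colour_odd_step: "odd n \<Longrightarrow> colour (move j n (inflate y)) = j"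
  using three_cases[of j]
  by (elim disjE) (auto simp: move_def inflate_def unit_step_def intro!: colour_simps)

text \<open>One step along axis \<open>j\<close> adds the class of \<open>d\<^sub>j\<close> modulo \<open>2\<close>, which exchanges the two other nonzero
classes.\<close>

lemma colour_flip:
  assumes "even (fst x) \<or> odd (snd x)" and "colour x \<noteq> j"
  shows "colour (move j 1 x) \<noteq> j \<and> colour (move j 1 x) \<noteq> colour x"
proof -
  consider "even (fst x)" "even (snd x)" | "odd (fst x)" "odd (snd x)" | "even (fst x)" "odd (snd x)"
    using assms by blast
  then show ?thesis
    using three_cases[of j] assms(2)
    by cases (auto simp: colour_simps move_def unit_step_def)
qed

text \<open>If \<open>x\<close> is not inflated, the row alternates from place to place. Otherwise every second place is
inflated, the rest has colour \<open>j\<close>, and the claim is that for a row at half the scale, run through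
backwards because \<open>inflate\<close> reverses directions.\<close>

lemma colour_alternating: "alternating colour"
proof -
  have "0 < n \<Longrightarrow> colour x \<noteq> j \<Longrightarrow> colour (move j n x) = colour x \<Longrightarrow>
     \<exists>i. 0 < i \<and> i < n \<and> colour (move j i x) \<noteq> j" for x j n
  proof (induction "nat n" arbitrary: n x rule: less_induct)
    case less
    show ?case
    proof (cases rule: inflate_cases[of x])
      case 2
      then have f: "colour (move j 1 x) \<noteq> j \<and> colour (move j 1 x) \<noteq> colour x" using colour_flip less.prems by blast
      then have "n \<noteq> 1" using less.prems by auto
      then show ?thesis using f less.prems by (intro exI[of _ 1]) auto
    next
      case (1 y)
      have "even n" using colour_odd_step[of n j y] less.prems 1 by auto
      then obtain m where m: "n = 2 * m" by (elim evenE)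
      define z where "z = move j (- m) y"
      have nx: "move j n x = inflate z" by (simp only: 1 m move_inflate z_def)
      have cz: "colour z = colour x" using less.prems(3) by (simp add: nx)
      have "move j m z = y" by (simp add: z_def)
      then have "colour (move j m z) = colour z" using cz 1 by simp
      moreover have "0 < m" "nat m < nat n" using less.prems(1) m by auto
      ultimately obtain i where i: "0 < i" "i < m" "colour (move j i z) \<noteq> j"
        using less.hyps[of m z] less.prems(2) cz by auto
      have "move j (2 * (m - i)) x = inflate (move j i z)" unfolding 1 move_inflate by (simp add: z_def)
      then have "colour (move j (2 * (m - i)) x) \<noteq> j" using i by simp
      then show ?thesis using i m by (intro exI[of _ "2 * (m - i)"]) auto
    qed
  qed
  then show ?thesis unfolding alternating_def by blast
qed

lemma colour_base_line: "colour (a, 0) = 0"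
proof (induction "nat \<bar>3 * a + 1\<bar>" arbitrary: a rule: less_induct)
  case less
  show ?case
  proof (cases "even a")
    case False
    then obtain k where "a = 2 * k + 1" by (elim oddE)
    moreover have "\<bar>3 * (- k - 1) + 1\<bar> < \<bar>3 * (2 * k + 1) + 1\<bar>"
      unfolding inflate_norm using inflate_norm(3)[of k] by simp
    ultimately have "colour (- k - 1, 0) = 0" using less[of "- k - 1"] by simp
    moreover have "(a, 0) = inflate (- k - 1, 0)" using \<open>a = 2 * k + 1\<close> by (simp add: inflate_def)
    ultimately show ?thesis by (metis colour_inflate)
  qed (simp add: colour_simps)
qed

text \<open>The relation \<open>R\<close> is reachability in the graph. It is compatible with \<open>inflate\<close>, because inflated
neighbours have a tile of colour \<open>j\<close> between them. A tile that is not inflated, of colour \<open>j\<close>, has two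
inflated neighbours on its axis; they cannot both have colour \<open>j + 1\<close>, by alternation, so the tile
is joined to one of them. This reduces a tile to one of about half the size, down to the base row and
four small tiles that are checked by hand.\<close>

lemma colour_dendrite: "dendrite colour"
  unfolding dendrite_def
proof (intro allI impI)
  fix K
  assume "\<forall>x j. colour x \<noteq> j + 1 \<and> colour (move j 1 x) \<noteq> j + 1 \<longrightarrow> (x \<in> K \<longleftrightarrow> move j 1 x \<in> K)"
  then have K: "x \<in> K \<longleftrightarrow> move j 1 x \<in> K" if "colour x \<noteq> j + 1" "colour (move j 1 x) \<noteq> j + 1" for x j
    using that by blast
  define R where "R = (\<lambda>x y. \<exists>j. colour x \<noteq> j + 1 \<and> colour y \<noteq> j + 1 \<and> (y = move j 1 x \<or> x = move j 1 y))\<^sup>*\<^sup>*"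
  have R_edge: "R x y" if "colour x \<noteq> j + 1" "colour y \<noteq> j + 1" "y = move j 1 x \<or> x = move j 1 y" for x y j
    unfolding R_def using that by blast
  have R_step: "R x (move j s x)" if "s = 1 \<or> s = -1" "colour x \<noteq> j + 1" "colour (move j s x) \<noteq> j + 1" for x j s
    using that(1)
  proof
    assume "s = -1"
    then show ?thesis using that by (intro R_edge[of _ j]) auto
  qed (use that R_edge in blast)
  have R_refl [simp]: "R x x" for x by (simp add: R_def)
  have R_trans: "R x z" if "R x y" "R y z" for x y z using that unfolding R_def by simp
  have R_K: "x \<in> K \<longleftrightarrow> y \<in> K" if "R x y" for x y
    using that unfolding R_def by induction (use K in blast)+
  have R_inflate: "R (inflate x) (inflate y)" if "R x y" for x y
    using that unfolding R_def
  proof induction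
    case (step y z)
    from step(2) obtain j where j: "colour y \<noteq> j + 1" "colour z \<noteq> j + 1" "z = move j 1 y \<or> y = move j 1 z"
      by blast
    have "R (inflate y) (inflate z)"
    proof -
      define s :: int where "s = (if z = move j 1 y then -1 else 1)"
      have s: "s = 1 \<or> s = -1" "z = move j (- s) y" using j(3) by (auto simp: s_def)
      define m where "m = move j s (inflate y)"
      have cm: "colour m = j" using s unfolding m_def by (intro colour_odd_step) auto
      have "move j s m = move j (2 * s) (inflate y)" by (simp add: m_def)
      then have iz: "inflate z = move j s m" by (simp only: move_inflate s(2))
      have m1: "colour m \<noteq> j + 1" by (simp add: cm)
      have "R (inflate y) m" unfolding m_def using R_step[OF s(1)] j(1) m1 by (simp add: m_def)
      moreover have "R m (inflate z)" unfolding iz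
        by (rule R_step[OF s(1) m1]) (use j(2) in \<open>simp add: iz[symmetric]\<close>)
      ultimately show ?thesis by (rule R_trans)
    qed
    with step.IH show ?case unfolding R_def by simp
  qed simp
  have R_line: "R (a, 0) (0, 0)" for a
  proof (induction a rule: int_induct[where k = 0])
    case (step1 i)
    have "R (i + 1, 0) (i, 0)"
      by (rule R_edge[of _ 0]) (auto simp: colour_base_line move_def unit_step_def)
    then show ?case using step1 R_trans by blast
  next
    case (step2 i)
    have "R (i - 1, 0) (i, 0)"
      by (rule R_edge[of _ 0]) (auto simp: colour_base_line move_def unit_step_def)
    then show ?case using step2 R_trans by blast
  qed simp
  have R_up: "R (inflate x) (0, 0)" if "R x (0, 0)" for x
    using R_inflate[OF that] R_line[of "-1"] R_trans by (simp add: inflate_def)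
  define M where "M x = \<bar>3 * fst x + 1\<bar> + 3 * \<bar>snd x\<bar>" for x :: "point"
  have M_inflate: "M (inflate y) = 2 * M y" for y
  proof -
    have "3 * (- 2 * fst y - 1) + 1 = - 2 * (3 * fst y + 1)" by simp
    then show ?thesis unfolding M_def inflate_def fst_conv snd_conv by (simp only: abs_mult) simp
  qed
  have M_pos: "0 < M y" for y
  proof -
    have "3 * fst y + 1 \<noteq> 0" by presburger
    then have "0 < \<bar>3 * fst y + 1\<bar>" by simp
    then show ?thesis unfolding M_def by (simp add: add_pos_nonneg)
  qed
  have R_all: "R x (0, 0)" for x
  proof (induction "nat (M x)" arbitrary: x rule: less_induct)
    case less
    show ?case
    proof (cases rule: inflate_cases[of x])
      case (1 y)
      then have "M y < M x" using M_inflate[of y] M_pos[of y] by simp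
      then have "R y (0, 0)" using less[of y] by (simp add: M_def)
      then show ?thesis using R_up 1 by simp
    next
      case 2
      show ?thesis
      proof (cases "M x \<le> 6")
        case True
        \<comment> \<open>Off the base row only these tiles have \<open>M\<close> so small that the reduction need not decrease it.\<close>
        have v1: "R (-1, -1) (0, 0)"
        proof -
          have "R (-1, -1) (-1, 0)"
            by (rule R_edge[of _ 1]) (auto simp: colour_base_line colour_simps move_def unit_step_def)
          then show ?thesis using R_line R_trans by blast
        qed
        have v2: "R (-1, 1) (0, 0)"
        proof -
          have "R (-1, 1) (-1, 0)"
            by (rule R_edge[of _ 1]) (auto simp: colour_base_line colour_simps move_def unit_step_def)
          then show ?thesis using R_line R_trans by blast
        qed
        have v3: "R (0, 1) (0, 0)"
        proof -
          have i: "(1, 2) = inflate (-1, -1)" by (simp add: inflate_def)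
          have "colour (1, 2) = 1" unfolding i colour_inflate by (simp add: colour_simps)
          then have "R (0, 1) (1, 2)"
            by (intro R_edge[of _ 2]) (auto simp: colour_simps move_def unit_step_def)
          then show ?thesis using R_up[OF v1] R_trans i by metis
        qed
        have v4: "R (0, -1) (0, 0)"
        proof -
          have i: "(-1, -2) = inflate (0, 1)" by (simp add: inflate_def)
          have "colour (-1, -2) = 2" unfolding i colour_inflate by (simp add: colour_simps)
          then have "R (0, -1) (-1, -2)"
            by (intro R_edge[of _ 2]) (auto simp: colour_simps move_def unit_step_def)
          then show ?thesis using R_up[OF v3] R_trans i by metis
        qed
        obtain a b where x: "x = (a, b)" by (cases x)
        have ab: "\<bar>3 * a + 1\<bar> + 3 * \<bar>b\<bar> \<le> 6" using True by (simp add: M_def x)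
        then have "b = 0 \<or> (b = 1 \<or> b = -1) \<and> (a = 0 \<or> a = -1)" by presburger
        then show ?thesis using R_line v1 v2 v3 v4 x by auto
      next
        case False
        define j where "j = colour x"
        have inf: "\<exists>y. move j s x = inflate y \<and> M y < M x" if "s = 1 \<or> s = -1" for s
        proof -
          have "odd (fst (move j s x))" "even (snd (move j s x))"
            using 2 that unfolding j_def
            by (cases "even (fst x)"; cases "even (snd x)"; auto simp: colour_simps move_def unit_step_def)+
          then obtain y where y: "move j s x = inflate y" using inflate_cases[of "move j s x"] by auto
          have "2 * M y = M (inflate y)" by (simp add: M_inflate)
          also have "\<dots> \<le> M x + 6"
          proof -
            define u w where "u = s * fst (unit_step j)" and "w = s * snd (unit_step j)"
            have uw: "\<bar>u\<bar> \<le> 1" "\<bar>w\<bar> \<le> 1" using that three_cases[of j] by (auto simp: u_def w_def unit_step_def)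
            have "M (move j s x) = \<bar>(3 * fst x + 1) + 3 * u\<bar> + 3 * \<bar>snd x + w\<bar>"
              by (simp add: M_def move_def u_def w_def algebra_simps)
            then show ?thesis
              using uw abs_triangle_ineq[of "3 * fst x + 1" "3 * u"] abs_triangle_ineq[of "snd x" w]
              unfolding y[symmetric] by (simp add: M_def abs_mult)
          qed
          finally show ?thesis using y False by auto
        qed
        have "\<exists>s. (s = 1 \<or> s = -1) \<and> colour (move j s x) \<noteq> j + 1"
        proof (rule ccontr)
          assume h: "\<not> ?thesis"
          define z where "z = move j (-1) x"
          have "colour z = j + 1" "colour (move j 2 z) = j + 1" using h by (auto simp: z_def)
          then have "(0::int) < 2 \<and> colour z \<noteq> j \<and> colour (move j 2 z) = colour z" by simp
          then obtain i where i: "0 < i" "i < 2" "colour (move j i z) \<noteq> j"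
            using colour_alternating unfolding alternating_def by blast
          then have "i = 1" by linarith
          then show False using i(3) by (simp add: j_def z_def)
        qed
        then obtain s where s: "s = 1 \<or> s = -1" "colour (move j s x) \<noteq> j + 1" by blast
        obtain y where y: "move j s x = inflate y" "M y < M x" using inf s by blast
        have "R y (0, 0)" using less[of y] y by (simp add: M_def)
        moreover have "R x (inflate y)" unfolding y(1)[symmetric]
          by (rule R_step[OF s(1) _ s(2)]) (simp add: j_def[symmetric])
        ultimately show ?thesis using R_up R_trans by blast
      qed
    qed
  qed
  show "K = {} \<or> K = UNIV" using R_K R_all by blast
qed

section \<open>The tile in complex coordinates\<close>

text \<open>The plane is identified with the complex numbers, so that rotations are multiplications and the
six edge directions are powers of one sixth root of unity.\<close>

definition plane_of :: "complex \<Rightarrow> plane" where "plane_of z = vector [Re z, Im z]"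
definition complex_of :: "plane \<Rightarrow> complex" where "complex_of x = Complex (x $ 1) (x $ 2)"

lemma plane_of_complex_of [simp]: "plane_of (complex_of x) = x" by (simp add: plane_of_def complex_of_def vec_eq_iff forall_2)
lemma complex_of_plane_of [simp]: "complex_of (plane_of z) = z" by (simp add: plane_of_def complex_of_def complex_eq_iff)

lemma linear_plane_of: "linear plane_of"
  by (rule linearI) (simp_all add: plane_of_def vec_eq_iff forall_2)

lemma inj_plane_of: "inj plane_of" by (rule inj_on_inverseI[of _ complex_of]) simp
lemma surj_plane_of: "surj plane_of" by (rule surjI[of _ complex_of]) simp
lemma plane_of_add: "plane_of (x + y) = plane_of x + plane_of y" by (rule linear_add[OF linear_plane_of])
lemma plane_of_eq [simp]: "plane_of x = plane_of y \<longleftrightarrow> x = y" using inj_plane_of by (auto dest: injD)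
lemma plane_of_0: "plane_of 0 = 0" by (rule linear_0[OF linear_plane_of])
lemma plane_of_scaleR: "plane_of (r *\<^sub>R x) = r *\<^sub>R plane_of x" by (rule linear_cmul[OF linear_plane_of])

lemma interior_plane_of: "interior (plane_of ` S) = plane_of ` interior S"
  by (rule interior_bijective_linear_image[OF linear_plane_of]) (simp add: bij_def inj_plane_of surj_plane_of)

lemma inner_plane_of: "plane_of z \<bullet> plane_of w = Re (z * cnj w)"
  by (simp add: plane_of_def inner_vec_def sum_2)

definition \<omega> :: complex where "\<omega> = Complex (1/2) (sqrt 3 / 2)"

lemma omega_cis: "\<omega> = cis (pi / 3)"
  by (simp add: \<omega>_def cis.ctr cos_60 sin_60 complex_eq_iff)

lemma omega_power_cis: "\<omega> ^ k = cis (real k * pi / 3)"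
  by (simp add: omega_cis Complex.DeMoivre)

lemma norm_omega [simp]: "cmod \<omega> = 1" by (simp add: omega_cis)

lemma omega_powers:
  "\<omega> ^ 2 = Complex (-1/2) (sqrt 3 / 2)" "\<omega> ^ 3 = -1" "\<omega> ^ 4 = Complex (-1/2) (- sqrt 3 / 2)"
  "\<omega> ^ 5 = Complex (1/2) (- sqrt 3 / 2)" "\<omega> ^ 6 = 1"
proof -
  show 2: "\<omega> ^ 2 = Complex (-1/2) (sqrt 3 / 2)"
    by (simp add: \<omega>_def power2_eq_square complex_eq_iff)
  have "\<omega> ^ 3 = \<omega> ^ 2 * \<omega>" by (simp add: eval_nat_numeral)
  then show 3: "\<omega> ^ 3 = -1" unfolding 2 by (simp add: \<omega>_def complex_eq_iff)
  have "\<omega> ^ 4 = \<omega> ^ 3 * \<omega>" "\<omega> ^ 5 = \<omega> ^ 3 * \<omega> ^ 2" "\<omega> ^ 6 = \<omega> ^ 3 * \<omega> ^ 3" by (simp_all add: eval_nat_numeral)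
  then show "\<omega> ^ 4 = Complex (-1/2) (- sqrt 3 / 2)"
    "\<omega> ^ 5 = Complex (1/2) (- sqrt 3 / 2)" "\<omega> ^ 6 = 1"
    unfolding 3 2 by (simp_all add: \<omega>_def complex_eq_iff)
qed

lemma omega_mod: "\<omega> ^ (k mod 6) = \<omega> ^ k"
proof -
  have "\<omega> ^ k = \<omega> ^ (6 * (k div 6) + k mod 6)" by simp
  also have "\<dots> = \<omega> ^ (k mod 6)" by (simp only: power_add power_mult omega_powers power_one mult_1)
  finally show ?thesis by simp
qed

lemma dir_plane_of: "dir (real k * pi / 3) = plane_of (\<omega> ^ k)"
  by (simp add: dir_def plane_of_def omega_power_cis)

lemma mid_plane_of: "mid k = plane_of (\<omega> ^ k / 2)"
proof -
  have "\<omega> ^ k / 2 = (1/2) *\<^sub>R \<omega> ^ k" by (simp add: scaleR_conv_of_real)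
  then show ?thesis by (simp only: mid_def dir_plane_of plane_of_scaleR)
qed

lemma tang_plane_of: "tang k = plane_of (\<i> * \<omega> ^ k)"
  by (simp add: tang_def plane_of_def omega_power_cis)

lemma mark_plane_of: "mark \<delta> k = plane_of (\<omega> ^ k * Complex (1/2) (sgn_off k * \<delta>))"
proof -
  have "\<omega> ^ k * Complex (1/2) (sgn_off k * \<delta>) = \<omega> ^ k / 2 + (sgn_off k * \<delta>) *\<^sub>R (\<i> * \<omega> ^ k)"
    by (simp add: scaleR_conv_of_real Complex_eq algebra_simps)
  then show ?thesis by (simp only: mark_def mid_plane_of tang_plane_of plane_of_scaleR plane_of_add)
qed

text \<open>The hexagon with centre \<open>p\<close> one of whose edges has the outer unit normal \<open>u\<close>.\<close>

definition cell :: "complex \<Rightarrow> complex \<Rightarrow> complex set" where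
  "cell u p = {z. \<forall>k<6. Re ((z - p) * cnj (u * \<omega> ^ k)) \<le> 1/2}"

lemma hexagon_plane_of: "hexagon = plane_of ` cell 1 0"
proof -
  have "x \<in> hexagon \<longleftrightarrow> complex_of x \<in> cell 1 0" for x
    using inner_plane_of[of "complex_of x"] by (simp only: hexagon_def cell_def dir_plane_of mem_Collect_eq plane_of_complex_of diff_zero mult_1)
  then show ?thesis by (force simp: image_iff)
qed

definition frame :: "complex \<Rightarrow> complex \<Rightarrow> plane \<Rightarrow> plane" where
  "frame u p x = plane_of (u * complex_of x + p)"

lemma frame_plane_of [simp]: "frame u p (plane_of z) = plane_of (u * z + p)" by (simp add: frame_def)

lemma direct_isometry_frame: "direct_isometry f \<longleftrightarrow> (\<exists>u p. cmod u = 1 \<and> f = frame u p)"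
proof
  assume "direct_isometry f"
  then obtain Q c where Q: "rotation_matrix Q" "f = (\<lambda>x. Q *v x + c)" by (auto simp: direct_isometry_def)
  define a b d e where "a = Q $ 1 $ 1" and "b = Q $ 1 $ 2" and "d = Q $ 2 $ 1" and "e = Q $ 2 $ 2"
  have "orthogonal_matrix Q" "det Q = 1" using Q(1) by (auto simp: rotation_matrix_def)
  then have "transpose Q ** Q = mat 1" and det: "a * e - b * d = 1"
    by (auto simp: orthogonal_matrix_def det_2 a_def b_def d_def e_def)
  then have o: "a * a + d * d = 1" "a * b + d * e = 0" "b * b + e * e = 1"
    by (auto simp: vec_eq_iff forall_2 matrix_matrix_mult_def sum_2 transpose_def mat_def
        a_def b_def d_def e_def)
  have "(a - e)\<^sup>2 + (b + d)\<^sup>2 = 0" using o det by (simp add: power2_eq_square algebra_simps)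
  then have e: "e = a" "b = - d" by (auto simp: sum_power2_eq_zero_iff)
  have "f = frame (Complex a d) (complex_of c)"
  proof
    fix x
    have "(Q *v x) $ 1 = a * x $ 1 + b * x $ 2" "(Q *v x) $ 2 = d * x $ 1 + e * x $ 2"
      by (simp_all add: matrix_vector_mult_def sum_2 a_def b_def d_def e_def)
    then show "f x = frame (Complex a d) (complex_of c) x"
      unfolding Q(2) by (simp add: frame_def plane_of_def complex_of_def vec_eq_iff forall_2 e algebra_simps)
  qed
  moreover have "cmod (Complex a d) = 1" using o(1) by (simp add: cmod_def power2_eq_square)
  ultimately show "\<exists>u p. cmod u = 1 \<and> f = frame u p" by blast
next
  assume "\<exists>u p. cmod u = 1 \<and> f = frame u p"
  then obtain u p where u: "cmod u = 1" "f = frame u p" by blast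
  define Q :: "real^2^2" where "Q = vector [vector [Re u, - Im u], vector [Im u, Re u]]"
  have n: "Re u * Re u + Im u * Im u = 1" using u(1) by (simp add: cmod_def power2_eq_square)
  have "transpose Q ** Q = mat 1" "Q ** transpose Q = mat 1"
    using n by (auto simp: vec_eq_iff forall_2 matrix_matrix_mult_def sum_2 transpose_def mat_def Q_def algebra_simps)
  then have "rotation_matrix Q" using n
    by (auto simp: rotation_matrix_def orthogonal_matrix_def det_2 Q_def)
  moreover have "f = (\<lambda>x. Q *v x + plane_of p)"
    unfolding u(2) by (rule ext) (simp add: frame_def plane_of_def complex_of_def vec_eq_iff forall_2 matrix_vector_mult_def sum_2 Q_def)
  ultimately show "direct_isometry f" by (auto simp: direct_isometry_def)
qed

text \<open>The decorated tile with centre \<open>p\<close>, turned by \<open>u\<close>.\<close>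

definition place :: "real \<Rightarrow> complex \<Rightarrow> complex \<Rightarrow> tile" where
  "place \<delta> u p = map_tile (frame u p) (P0 \<delta>)"

text \<open>Rotating the inequalities that define the hexagon by \<open>u\<close> multiplies both arguments of the inner
product by \<open>u\<close>, and \<open>u * cnj u = 1\<close>.\<close>

lemma cell_image:
  assumes u: "cmod u = 1"
  shows "cell u p = (\<lambda>z. u * z + p) ` cell 1 0"
proof -
  have uu: "u * cnj u = 1" using u by (simp add: complex_norm_square[symmetric])
  have "Re (z * cnj (\<omega> ^ k)) = Re (((u * z + p) - p) * cnj (u * \<omega> ^ k))" for z k
  proof -
    have "((u * z + p) - p) * cnj (u * \<omega> ^ k) = (u * cnj u) * (z * cnj (\<omega> ^ k))"
      by (simp add: algebra_simps)
    then show ?thesis by (simp only: uu mult_1)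
  qed
  then have *: "z \<in> cell 1 0 \<longleftrightarrow> u * z + p \<in> cell u p" for z
    unfolding cell_def by (simp only: mem_Collect_eq diff_zero mult_1)
  have "z = u * ((z - p) / u) + p" for z using u by auto
  then show ?thesis using * by (metis (no_types, lifting) image_iff set_eqI)
qed

lemma body_place: "cmod u = 1 \<Longrightarrow> body (place \<delta> u p) = plane_of ` cell u p"
  by (simp add: place_def map_tile_def P0_def hexagon_plane_of cell_image[of u p] image_image)

lemma r1_ends_place:
  "r1_ends (place \<delta> u p) = plane_of ` (\<lambda>k. p + u * \<omega> ^ k * Complex (1/2) (sgn_off k * \<delta>)) ` {..<6}"
proof -
  have "{0..5::nat} = {..<6}" by auto
  then show ?thesis by (simp add: place_def map_tile_def P0_def mark_plane_of image_image algebra_simps)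
qed

lemma segment_affine: "(\<lambda>z. u * z + p) ` closed_segment 0 w = closed_segment p (p + u * w)"
  for u :: complex
proof -
  have "(\<lambda>z. u * z + p) ` closed_segment 0 w = (\<lambda>z. p + z) ` (*) u ` closed_segment 0 w"
    by (simp add: image_image algebra_simps)
  also have "(*) u ` closed_segment 0 w = closed_segment (u * 0) (u * w)"
    by (rule closed_segment_linear_image[symmetric]) simp
  also have "(\<lambda>z. p + z) ` closed_segment (u * 0) (u * w) = closed_segment p (p + u * w)"
    using closed_segment_translation[of p 0 "u * w"] by simp
  finally show ?thesis .
qed

lemma r2_tree_place:
  "r2_tree (place \<delta> u p) = plane_of ` (\<Union>k\<in>{0, 1, 3, 4}. closed_segment p (p + u * \<omega> ^ k / 2))"
proof -
  have "closed_segment 0 (mid k) = plane_of ` closed_segment 0 (\<omega> ^ k / 2)" for k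
    using closed_segment_linear_image[OF linear_plane_of, of 0 "\<omega> ^ k / 2"] by (simp add: plane_of_0 mid_plane_of)
  then have "frame u p ` closed_segment 0 (mid k) = plane_of ` closed_segment p (p + u * \<omega> ^ k / 2)" for k
    using segment_affine[of u p "\<omega> ^ k / 2", symmetric] by (simp add: image_image)
  then show ?thesis by (simp only: place_def map_tile_def P0_def tile.simps image_UN)
qed

lemma map_tile_place: "map_tile (\<lambda>x. x + plane_of q) (place \<delta> u p) = place \<delta> u (p + q)"
proof -
  have "(\<lambda>x. x + plane_of q) ` frame u p ` S = frame u (p + q) ` S" for S
    by (simp add: image_image frame_def plane_of_add[symmetric] add.assoc)
  then show ?thesis by (simp add: place_def map_tile_def image_image[of "(`) _" "(`) _"])
qed

section \<open>Packings that saturate the plane\<close>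

text \<open>The hexagon has sixfold symmetry, so its body does not determine the orientation of the tile.\<close>

lemma cell_orient: "cell (u * \<omega> ^ r) p = cell u p"
proof -
  have "(\<forall>k<6. P (\<omega> ^ (r + k))) \<longleftrightarrow> (\<forall>k<6. P (\<omega> ^ k))" for P
  proof
    assume h: "\<forall>k<6. P (\<omega> ^ (r + k))"
    show "\<forall>k<6. P (\<omega> ^ k)"
    proof (intro allI impI)
      fix k :: nat assume "k < 6"
      have "(r + (k + 5 * r) mod 6) mod 6 = (k + 6 * r) mod 6" by (simp add: mod_simps)
      then have "\<omega> ^ (r + (k + 5 * r) mod 6) = \<omega> ^ k"
        by (metis omega_mod mod_mult_self2)
      then show "P (\<omega> ^ k)" using h[rule_format, of "(k + 5 * r) mod 6"] by simp
    qed
  next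
    assume h: "\<forall>k<6. P (\<omega> ^ k)"
    show "\<forall>k<6. P (\<omega> ^ (r + k))"
      using h[rule_format, of "(r + _) mod 6"] by (simp add: omega_mod)
  qed
  from this[of "\<lambda>w. Re ((_ - p) * cnj (u * w)) \<le> 1/2"] show ?thesis
    unfolding cell_def by (simp only: power_add mult.assoc)
qed

lemma Re_mult_cnj_le: "cmod w = 1 \<Longrightarrow> Re (z * cnj w) \<le> cmod z"
  using complex_Re_le_cmod[of "z * cnj w"] by (simp add: norm_mult)

lemma cball_cell:
  assumes "cmod u = 1"
  shows "cball p (1/2) \<subseteq> cell u p"
proof
  fix z assume "z \<in> cball p (1/2)"
  then have "cmod (z - p) \<le> 1/2" by (simp add: dist_norm norm_minus_commute)
  moreover have "Re ((z - p) * cnj (u * \<omega> ^ k)) \<le> cmod (z - p)" for k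
    by (rule Re_mult_cnj_le) (simp add: norm_mult norm_power assms)
  ultimately show "z \<in> cell u p" unfolding cell_def mem_Collect_eq using order_trans by blast
qed

text \<open>Up to signs one of the three numbers is the sum of two others of equal sign, so its square
dominates the sum of the two other squares.\<close>

lemma width_square_sum:
  fixes a b c :: real
  assumes "b = a + c" "\<bar>a\<bar> \<le> 1/2" "\<bar>b\<bar> \<le> 1/2" "\<bar>c\<bar> \<le> 1/2"
  shows "a\<^sup>2 + b\<^sup>2 + c\<^sup>2 \<le> 1/2"
proof -
  have sq: "x\<^sup>2 \<le> 1/4" if "\<bar>x\<bar> \<le> 1/2" for x :: real
    using that power_mono[of "\<bar>x\<bar>" "1/2" 2] by (simp add: power2_eq_square)
  have "a * c \<ge> 0 \<or> a * b \<ge> 0 \<and> c * b \<le> 0 \<or> c * b \<ge> 0 \<and> a * b \<le> 0"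
    unfolding assms(1) by (smt (verit) mult_nonneg_nonneg mult_nonneg_nonpos mult_nonpos_nonneg mult_nonpos_nonpos)
  then show ?thesis
  proof (elim disjE conjE)
    assume "a * c \<ge> 0"
    then have "a\<^sup>2 + c\<^sup>2 \<le> b\<^sup>2" unfolding assms(1) by (simp add: power2_eq_square algebra_simps)
    then show ?thesis using sq[OF assms(3)] by linarith
  next
    assume "c * b \<le> 0"
    then have "b\<^sup>2 + c\<^sup>2 \<le> a\<^sup>2" using assms(1) by (simp add: power2_eq_square algebra_simps)
    then show ?thesis using sq[OF assms(2)] by linarith
  next
    assume "a * b \<le> 0"
    then have "a\<^sup>2 + b\<^sup>2 \<le> c\<^sup>2" using assms(1) by (simp add: power2_eq_square algebra_simps)
    then show ?thesis using sq[OF assms(4)] by linarith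
  qed
qed

text \<open>The sum of the squared components along three directions at mutual angle \<open>\<pi>/3\<close> is \<open>3/2\<close> times
the squared norm.\<close>

lemma cell_radius:
  assumes u: "cmod u = 1" and z: "z \<in> cell u p"
  shows "(cmod (z - p))\<^sup>2 \<le> 1/3"
proof -
  obtain w where w: "z = u * w + p" "w \<in> cell 1 0" using z unfolding cell_image[OF u] by blast
  have c: "Re (w * cnj (\<omega> ^ k)) \<le> 1/2" if "k < 6" for k using w(2) that by (simp add: cell_def)
  define s where "s = sqrt 3"
  have s: "s * s = 3" by (simp add: s_def)
  define x y where "x = Re w" and "y = Im w"
  define b where "b = x / 2 + y * s / 2"
  define d where "d = - x / 2 + y * s / 2"
  have "x \<le> 1/2" "b \<le> 1/2" "d \<le> 1/2" "- x \<le> 1/2" "- b \<le> 1/2" "- d \<le> 1/2"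
    using c[of 0] c[of 1] c[of 2] c[of 3] c[of 4] c[of 5]
    by (simp_all add: omega_powers complex_cnj_power[symmetric] del: complex_cnj_power)
       (simp_all add: \<omega>_def x_def y_def b_def d_def s_def)
  then have "\<bar>x\<bar> \<le> 1/2" "\<bar>b\<bar> \<le> 1/2" "\<bar>d\<bar> \<le> 1/2" by linarith+
  moreover have "b = x + d" by (simp add: b_def d_def)
  ultimately have "x\<^sup>2 + b\<^sup>2 + d\<^sup>2 \<le> 1/2" by (intro width_square_sum)
  moreover have "x\<^sup>2 + b\<^sup>2 + d\<^sup>2 = 3/2 * (x\<^sup>2 + y\<^sup>2)"
  proof -
    have "b\<^sup>2 + d\<^sup>2 = x * x / 2 + (s * s) / 2 * (y * y)"
      by (simp add: b_def d_def power2_eq_square algebra_simps)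
    then show ?thesis by (simp add: s power2_eq_square)
  qed
  ultimately have "x\<^sup>2 + y\<^sup>2 \<le> 1/3" by simp
  then have "(cmod w)\<^sup>2 \<le> 1/3" by (simp add: cmod_power2 x_def y_def)
  then show ?thesis by (simp add: w(1) norm_mult u)
qed

text \<open>The circumradius of the hexagon. It is also the covering radius of the triangular lattice with
minimal distance \<open>1\<close>, and the lemmas below single out the lattice by this property.\<close>

definition \<rho> :: real where "\<rho> = sqrt (1/3)"

lemma rho: "0 < \<rho>" "\<rho>\<^sup>2 = 1/3" "\<rho> < 1" by (simp_all add: \<rho>_def)

lemma le_rho: "0 \<le> x \<Longrightarrow> x \<le> \<rho> \<longleftrightarrow> x\<^sup>2 \<le> 1/3"
  unfolding rho(2)[symmetric] using abs_le_square_iff[of x \<rho>] rho(1) by simp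

definition saturated :: "complex set \<Rightarrow> bool" where
  "saturated X \<longleftrightarrow> (\<forall>x\<in>X. \<forall>y\<in>X. x \<noteq> y \<longrightarrow> 1 \<le> dist x y) \<and> (\<forall>z. \<exists>x\<in>X. dist z x \<le> \<rho>)"

text \<open>If points arbitrarily near to \<open>o'\<close>, in the direction \<open>n\<close>, are too far from \<open>F\<close> to be covered by it, then
\<open>o'\<close> itself is covered by a point outside \<open>F\<close>: separation makes \<open>X - F\<close> closed, so that a nearest
point exists.\<close>

lemma saturated_limit:
  assumes sat: "saturated X" and out: "\<And>x \<epsilon>. x \<in> F \<Longrightarrow> 0 < \<epsilon> \<Longrightarrow> \<rho> < dist (o' + of_real \<epsilon> * n) x"
    and n: "cmod n = 1"
  shows "\<exists>z\<in>X - F. dist o' z \<le> \<rho>"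
proof -
  have "closed (X - F)"
    by (rule discrete_imp_closed[of 1]) (use sat in \<open>force simp: saturated_def\<close>)+
  moreover have near: "\<exists>z\<in>X - F. dist o' z \<le> \<rho> + \<epsilon>" if "0 < \<epsilon>" for \<epsilon>
  proof -
    obtain z where z: "z \<in> X" "dist (o' + of_real \<epsilon> * n) z \<le> \<rho>"
      using sat unfolding saturated_def by blast
    moreover have "dist o' (o' + of_real \<epsilon> * n) = \<epsilon>" using that n by (simp add: dist_norm norm_mult)
    then have "dist o' z \<le> \<rho> + \<epsilon>" using dist_triangle[of o' z "o' + of_real \<epsilon> * n"] z by simp
    moreover have "z \<notin> F" using out[of z \<epsilon>] z that by auto
    ultimately show ?thesis by auto
  qed
  moreover have "X - F \<noteq> {}" using near[of 1] by auto
  ultimately obtain z where z: "z \<in> X - F" "\<And>y. y \<in> X - F \<Longrightarrow> dist o' z \<le> dist o' y"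
    using distance_attains_inf by metis
  have "dist o' z \<le> \<rho>"
  proof (rule field_le_epsilon)
    fix \<epsilon> :: real assume "0 < \<epsilon>"
    then show "dist o' z \<le> \<rho> + \<epsilon>" using near[of \<epsilon>] z(2) by (meson order_trans)
  qed
  then show ?thesis using z by blast
qed

text \<open>The circumcentre is the origin, two vertices are \<open>(\<plusminus>d/2, -t)\<close> on the circle of radius \<open>1/\<surd>3\<close>, and
\<open>(a, b)\<close> is a point in the closed disc at distance at least \<open>1\<close> from both. Adding the two distance
conditions gives \<open>t * b \<ge> 1/6\<close>, whereas \<open>t\<^sup>2 \<le> 1/12\<close> and \<open>b\<^sup>2 \<le> 1/3\<close>; all these are equalities.\<close>

lemma third_point_coordinates:
  fixes a b d t :: real
  assumes c: "a\<^sup>2 + b\<^sup>2 \<le> 1/3" and r: "d\<^sup>2 / 4 + t\<^sup>2 = 1/3" and d: "1 \<le> d" and t: "0 \<le> t"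
    and 1: "1 \<le> (a + d/2)\<^sup>2 + (b + t)\<^sup>2" and 2: "1 \<le> (a - d/2)\<^sup>2 + (b + t)\<^sup>2"
  shows "d = 1" "a = 0" "b = \<rho>" "t = \<rho> / 2"
proof -
  have e1: "(a + d/2)\<^sup>2 + (b + t)\<^sup>2 = (a\<^sup>2 + b\<^sup>2) + (d\<^sup>2 / 4 + t\<^sup>2) + a * d + 2 * (t * b)"
    and e2: "(a - d/2)\<^sup>2 + (b + t)\<^sup>2 = (a\<^sup>2 + b\<^sup>2) + (d\<^sup>2 / 4 + t\<^sup>2) - a * d + 2 * (t * b)"
    by (simp_all add: power2_eq_square field_simps)
  have tb: "1/6 \<le> t * b" using 1 2 c r unfolding e1 e2 by linarith
  have "(1/6)\<^sup>2 \<le> (t * b)\<^sup>2" using tb by (intro power_mono) auto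
  then have tb2: "1/36 \<le> t\<^sup>2 * b\<^sup>2" unfolding power_mult_distrib by (simp add: power_divide)
  have d2: "1 \<le> d\<^sup>2" using d by (simp add: one_le_power)
  have t2: "t\<^sup>2 \<le> 1/12" using r d2 by linarith
  have b2: "b\<^sup>2 \<le> 1/3" using c zero_le_power2[of a] by linarith
  have "t\<^sup>2 * b\<^sup>2 \<le> t\<^sup>2 * (1/3)" using b2 by (intro mult_left_mono) auto
  then have t2': "t\<^sup>2 = 1/12" using tb2 t2 by linarith
  then have "1/36 \<le> 1/12 * b\<^sup>2" using tb2 by (simp only:)
  then have b2': "b\<^sup>2 = 1/3" using b2 by linarith
  show "a = 0" using c b2' by simp
  have "d\<^sup>2 = 1" using r t2' by simp
  then show "d = 1" using d by (simp add: power2_eq_1_iff)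
  have "t \<noteq> 0" using t2' by auto
  then have "0 < t" "0 < t * b" using tb t by linarith+
  then have "0 < b" by (rule zero_less_mult_pos[rotated])
  then show "b = \<rho>" using b2' by (simp add: \<rho>_def real_sqrt_unique)
  have "(\<rho> / 2)\<^sup>2 = t\<^sup>2" using t2' rho by (simp add: power_divide)
  then show "t = \<rho> / 2" using t rho by (simp add: power2_eq_iff_nonneg)
qed

text \<open>Two centres that are near enough lie on a circle of radius \<open>\<rho>\<close> around a point \<open>q\<close> to the left of the
segment between them. Moving from \<open>q\<close> further to the left leaves the reach of both centres, so a
third centre is within \<open>\<rho>\<close> of \<open>q\<close>. This determines all three.\<close>

lemma third_point:
  assumes sat: "saturated X" and x: "x \<in> X" and y: "y \<in> X" and "x \<noteq> y" and le: "dist x y \<le> 2 * \<rho>"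
  shows "cmod (y - x) = 1 \<and> x + \<omega> * (y - x) \<in> X"
proof -
  define d where "d = cmod (y - x)"
  have d1: "1 \<le> d" using sat assms unfolding saturated_def d_def by (metis dist_norm norm_minus_commute)
  have d2: "d \<le> 2 * \<rho>" using le by (simp add: d_def dist_norm norm_minus_commute)
  define U where "U = (y - x) / of_real d"
  have U: "cmod U = 1" "y = x + U * of_real d" using d1 by (auto simp: U_def d_def norm_divide)
  have "(d / 2)\<^sup>2 \<le> \<rho>\<^sup>2" using d1 d2 by (intro power_mono) auto
  then have d3: "d\<^sup>2 / 4 \<le> 1/3" by (simp add: rho power_divide)
  define t where "t = sqrt (1/3 - d\<^sup>2 / 4)"
  have t: "0 \<le> t" "d\<^sup>2 / 4 + t\<^sup>2 = 1/3" using d3 by (auto simp: t_def)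
  define q where "q = x + U * Complex (d / 2) t"
  have qx: "q + of_real \<epsilon> * (U * \<i>) - x = U * Complex (d / 2) (t + \<epsilon>)" for \<epsilon>
    by (simp add: q_def Complex_eq algebra_simps)
  have qy: "q + of_real \<epsilon> * (U * \<i>) - y = U * Complex (- d / 2) (t + \<epsilon>)" for \<epsilon>
    by (simp add: q_def U(2) Complex_eq algebra_simps)
  have far: "\<rho> < dist (q + of_real \<epsilon> * (U * \<i>)) z" if "z \<in> {x, y}" "0 < \<epsilon>" for z \<epsilon>
  proof -
    have "t\<^sup>2 < (t + \<epsilon>)\<^sup>2" using t that by (intro power_strict_mono) auto
    then have "\<rho>\<^sup>2 < d\<^sup>2 / 4 + (t + \<epsilon>)\<^sup>2" using t rho by simp
    also have "\<dots> = (dist (q + of_real \<epsilon> * (U * \<i>)) z)\<^sup>2"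
    proof -
      have "q + of_real \<epsilon> * (U * \<i>) - z = U * Complex (d / 2) (t + \<epsilon>) \<or>
          q + of_real \<epsilon> * (U * \<i>) - z = U * Complex (- d / 2) (t + \<epsilon>)"
        using that(1) qx qy by blast
      then show ?thesis unfolding dist_norm
        by (elim disjE) (simp_all only: norm_mult U(1) mult_1 cmod_power2 complex.sel, simp_all add: power_divide)
    qed
    finally show ?thesis by (rule power_less_imp_less_base) simp
  qed
  have "cmod (U * \<i>) = 1" by (simp add: norm_mult U)
  from saturated_limit[OF sat far this, of "{x, y}"]
  obtain z where z: "z \<in> X" "z \<noteq> x" "z \<noteq> y" "dist q z \<le> \<rho>" by auto
  define s where "s = (z - q) / U"
  have zs: "z = q + U * s" using U(1) by (auto simp: s_def)
  define a b where "a = Re s" and "b = Im s"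
  have s: "s = Complex a b" by (simp add: a_def b_def)
  have "(dist q z)\<^sup>2 \<le> 1/3" using z(4) le_rho by simp
  then have c: "a\<^sup>2 + b\<^sup>2 \<le> 1/3" by (simp add: zs dist_norm norm_mult U s cmod_power2)
  have dx: "(dist z x)\<^sup>2 = (a + d/2)\<^sup>2 + (b + t)\<^sup>2"
  proof -
    have "z - x = U * Complex (a + d/2) (b + t)" by (simp add: zs q_def s Complex_eq algebra_simps)
    then show ?thesis by (simp add: dist_norm norm_mult U cmod_power2)
  qed
  have dy: "(dist z y)\<^sup>2 = (a - d/2)\<^sup>2 + (b + t)\<^sup>2"
  proof -
    have "z - y = U * Complex (a - d/2) (b + t)" by (simp add: zs q_def s U(2) Complex_eq algebra_simps)
    then show ?thesis by (simp add: dist_norm norm_mult U cmod_power2)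
  qed
  have "1 \<le> dist z x" "1 \<le> dist z y" using sat z x y unfolding saturated_def by blast+
  then have "1 \<le> (a + d/2)\<^sup>2 + (b + t)\<^sup>2" "1 \<le> (a - d/2)\<^sup>2 + (b + t)\<^sup>2"
    unfolding dx[symmetric] dy[symmetric] by (simp_all add: one_le_power)
  note * = third_point_coordinates[OF c t(2) d1 t(1) this]
  have "\<rho> * 3 / 2 = sqrt 3 / 2"
  proof -
    have "(\<rho> * 3)\<^sup>2 = (sqrt 3)\<^sup>2" using rho(2) by (simp add: power_mult_distrib)
    then have "\<rho> * 3 = sqrt 3"
      by (rule power2_eq_imp_eq) (simp_all add: less_imp_le[OF rho(1)])
    then show ?thesis by simp
  qed
  then have "z = x + U * \<omega>"
    by (simp add: zs q_def s * \<omega>_def complex_eq_iff algebra_simps)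
  moreover have "U = y - x" using *(1) U(2) by simp
  ultimately show ?thesis using z(1) *(1) by (simp add: d_def mult.commute)
qed

definition pos :: "point \<Rightarrow> complex" where
  "pos n = of_int (fst n) + of_int (snd n) * \<omega> ^ 2"

lemma pos_add: "pos (m + n) = pos m + pos n" by (simp add: pos_def algebra_simps)
lemma pos_diff: "pos (m - n) = pos m - pos n" by (simp add: pos_def algebra_simps)

lemma pos_norm: "(cmod (pos (a, b)))\<^sup>2 = of_int (a * a - a * b + b * b)"
proof -
  have "pos (a, b) = Complex (of_int a - of_int b / 2) (of_int b * (sqrt 3 / 2))"
    by (simp add: pos_def omega_powers complex_eq_iff)
  then show ?thesis by (simp add: cmod_power2 power_mult_distrib power_divide) (simp add: power2_eq_square field_simps)
qed

text \<open>One pair at distance \<open>1\<close> exists, because points just outside the disc of radius \<open>\<rho>\<close> around a centre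
are covered by another centre. Applying \<open>third_point\<close> repeatedly rotates the pair by \<open>\<pi>/3\<close> about
either of its points, and these rotations sweep out a triangular lattice.\<close>

lemma saturated_lattice:
  assumes sat: "saturated X"
  obtains x w where "cmod w = 1" "\<And>n. x + w * pos n \<in> X"
proof -
  obtain x where x: "x \<in> X" using sat by (auto simp: saturated_def)
  have "\<exists>z\<in>X - {x}. dist (x + \<rho>) z \<le> \<rho>"
  proof (rule saturated_limit[OF sat, of _ _ 1])
    fix y \<epsilon> assume "y \<in> {x}" "(0::real) < \<epsilon>"
    then show "\<rho> < dist (x + of_real \<rho> + of_real \<epsilon> * 1) y"
      using rho(1) by (simp add: dist_norm flip: of_real_add)
  qed simp
  then obtain y where y: "y \<in> X" "x \<noteq> y" "dist (x + \<rho>) y \<le> \<rho>" by auto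
  have "dist x (x + \<rho>) = \<rho>" using rho(1) by (simp add: dist_norm)
  then have "dist x y \<le> 2 * \<rho>" using dist_triangle[of x y "x + \<rho>"] y(3) by simp
  then have w: "cmod (y - x) = 1" using third_point[OF sat x y(1,2)] by simp
  define w where "w = y - x"
  have "cmod w = 1" using w by (simp add: w_def)
  have rot: "p + \<omega> ^ k * v \<in> X" if "p \<in> X" "p + v \<in> X" "cmod v = 1" for p v k
  proof (induction k)
    case (Suc k)
    define v' where "v' = \<omega> ^ k * v"
    have n: "cmod v' = 1" using that by (simp add: v'_def norm_mult norm_power)
    then have "p \<noteq> p + v'" by auto
    moreover have "dist p (p + v') \<le> 2 * \<rho>"
    proof -
      have "(1/2)\<^sup>2 \<le> \<rho>\<^sup>2" unfolding rho(2) by (simp add: power2_eq_square)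
      then have "1/2 \<le> \<rho>" using rho(1) by (simp add: power2_le_iff_abs_le)
      then show ?thesis using n by (simp add: dist_norm)
    qed
    ultimately have "p + \<omega> * (p + v' - p) \<in> X"
      using third_point[OF sat that(1), of "p + v'"] Suc by (simp add: v'_def)
    then show ?case by (simp add: v'_def mult.assoc)
  qed (use that in simp)
  \<comment> \<open>Carrying the second point along lets the pair be moved as a whole.\<close>
  define Q where "Q p \<longleftrightarrow> p \<in> X \<and> p + w \<in> X" for p
  have Q_step: "Q (p + w * \<omega> ^ k)" if Q: "Q p" and k: "k < 6" for p k
  proof -
    define p' where "p' = p + w * \<omega> ^ k"
    have p': "p' \<in> X" using rot[of p w k] Q \<open>cmod w = 1\<close> by (simp add: Q_def p'_def mult.commute)
    \<comment> \<open>Turning back about \<open>p'\<close>: the exponent is chosen such that \<open>\<omega> ^ (9 - k) * \<omega> ^ k = \<omega> ^ 9 = -1\<close>.\<close>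
    have turn: "p' + \<omega> ^ (9 - k) * (- (w * \<omega> ^ k)) \<in> X"
      by (rule rot) (use p' Q \<open>cmod w = 1\<close> in \<open>auto simp: p'_def Q_def norm_mult norm_power\<close>)
    have "\<omega> ^ (9 - k) * \<omega> ^ k = -1"
    proof -
      have "\<omega> ^ (9 - k) * \<omega> ^ k = \<omega> ^ 9" using k by (simp add: power_add[symmetric])
      also have "\<dots> = \<omega> ^ 3 * \<omega> ^ 6" by (simp add: power_add[symmetric])
      finally show ?thesis by (simp add: omega_powers)
    qed
    moreover have "\<omega> ^ (9 - k) * (- (w * \<omega> ^ k)) = - ((\<omega> ^ (9 - k) * \<omega> ^ k) * w)" by (simp add: algebra_simps)
    ultimately have "\<omega> ^ (9 - k) * (- (w * \<omega> ^ k)) = w" by simp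
    then have "p' + w \<in> X" using turn by (simp only:)
    then show ?thesis using p' unfolding Q_def p'_def by blast
  qed
  have Q_a: "Q (p + w * of_int a)" if "Q p" for p a
  proof (induction a rule: int_induct[where k = 0])
    case (step1 i)
    then show ?case using Q_step[OF step1(2), of 0] by (simp add: algebra_simps)
  next
    case (step2 i)
    then show ?case using Q_step[OF step2(2), of 3] by (simp add: omega_powers algebra_simps)
  qed (use that in simp)
  have omega_5: "\<omega> ^ 5 = - (\<omega> ^ 2)" by (simp add: omega_powers complex_eq_iff)
  have Q_b: "Q (p + w * (of_int b * \<omega> ^ 2))" if "Q p" for p b
  proof (induction b rule: int_induct[where k = 0])
    case (step1 i)
    then show ?case using Q_step[OF step1(2), of 2] by (simp add: algebra_simps)
  next
    case (step2 i)
    then show ?case using Q_step[OF step2(2), of 5] by (simp add: omega_5 algebra_simps)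
  qed (use that in simp)
  have "Q x" using x y by (simp add: Q_def w_def)
  have "Q (x + w * pos n)" for n
    using Q_b[OF Q_a[OF \<open>Q x\<close>, of "fst n"], of "snd n"] by (simp add: pos_def algebra_simps)
  then show ?thesis using that[of w x] \<open>cmod w = 1\<close> by (simp add: Q_def)
qed

section \<open>Honeycombs\<close>

lemma pos_sep: assumes "m \<noteq> n" shows "1 \<le> cmod (pos m - pos n)"
proof -
  obtain a b where ab: "m - n = (a, b)" by (cases "m - n")
  have "a \<noteq> 0 \<or> b \<noteq> 0" using ab assms by (auto simp: zero_prod_def[symmetric])
  then have "0 < a\<^sup>2 + b\<^sup>2" by (simp add: sum_power2_gt_zero_iff)
  moreover have "2 * (a * a - a * b + b * b) = a\<^sup>2 + b\<^sup>2 + (a - b)\<^sup>2"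
    by (simp add: power2_eq_square algebra_simps)
  ultimately have "0 < 2 * (a * a - a * b + b * b)"
    using zero_le_power2[of "a - b"] by (metis add_pos_nonneg)
  then have "1 \<le> a * a - a * b + b * b"
    using zero_le_power2[of "a - b"] by (simp add: int_one_le_iff_zero_less)
  then have "(1::real) \<le> of_int (a * a - a * b + b * b)" by linarith
  then have "1 \<le> (cmod (pos (a, b)))\<^sup>2" unfolding pos_norm .
  then have "1\<^sup>2 \<le> (cmod (pos (a, b)))\<^sup>2" by simp
  then have "1 \<le> cmod (pos (a, b))" by (rule power2_le_imp_le) simp
  then show ?thesis using ab by (simp add: pos_diff[symmetric])
qed

lemma pos_eq [simp]: "pos m = pos n \<longleftrightarrow> m = n"
  using pos_sep[of m n] by (cases "m = n") auto

definition hexdir :: "nat \<Rightarrow> point" where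
  "hexdir k = [(1, 0), (1, 1), (0, 1), (-1, 0), (-1, -1), (0, -1)] ! k"

lemma less_6_cases: "(k::nat) < 6 \<Longrightarrow> k = 0 \<or> k = 1 \<or> k = 2 \<or> k = 3 \<or> k = 4 \<or> k = 5"
  by linarith

lemma pos_hexdir: assumes "k < 6" shows "pos (hexdir k) = \<omega> ^ k"
  using less_6_cases[OF assms]
  by (elim disjE) (simp_all add: hexdir_def pos_def omega_powers, simp_all add: \<omega>_def complex_eq_iff)

text \<open>The squared norm \<open>a\<^sup>2 - ab + b\<^sup>2\<close> is an integer, so below \<open>2\<close> and away from the origin it is \<open>1\<close>.\<close>

lemma pos_unit:
  assumes "(cmod (pos n))\<^sup>2 < 2" and "n \<noteq> 0"
  shows "\<exists>k<6. n = hexdir k"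
proof -
  obtain a b where n: "n = (a, b)" by (cases n)
  have "of_int (a * a - a * b + b * b) < (2::real)" using assms(1) pos_norm[of a b] n by simp
  then have six: "a * a - a * b + b * b < 2" by linarith
  have "4 * (a * a - a * b + b * b) = (2 * a - b)\<^sup>2 + 3 * b\<^sup>2" "4 * (a * a - a * b + b * b) = (2 * b - a)\<^sup>2 + 3 * a\<^sup>2"
    by (simp_all add: power2_eq_square algebra_simps)
  then have "3 * b\<^sup>2 \<le> 4 * (a * a - a * b + b * b)" "3 * a\<^sup>2 \<le> 4 * (a * a - a * b + b * b)"
    by (metis le_add_same_cancel2 zero_le_power2)+
  moreover have "4 * (a * a - a * b + b * b) < 8" using six by simp
  ultimately have "b\<^sup>2 < 4" "a\<^sup>2 < 4" by auto
  then have "\<bar>b\<bar>\<^sup>2 < 2\<^sup>2" "\<bar>a\<bar>\<^sup>2 < 2\<^sup>2" by simp_all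
  then have "\<bar>b\<bar> < 2" "\<bar>a\<bar> < 2" using power2_less_imp_less[of "\<bar>b\<bar>" 2] power2_less_imp_less[of "\<bar>a\<bar>" 2] by simp_all
  then have "a \<in> {-1, 0, 1}" "b \<in> {-1, 0, 1}" by auto
  then have "(a, b) \<in> {(1, 0), (1, 1), (0, 1), (-1, 0), (-1, -1), (0, -1)}"
    using six assms(2) n by (auto simp: zero_prod_def)
  then have "n \<in> hexdir ` {0, 1, 2, 3, 4, 5}" by (auto simp: n hexdir_def)
  then obtain k where k: "k \<in> {0, 1, 2, 3, 4, 5}" "n = hexdir k" by (rule imageE)
  then have "k < 6" by auto
  then show ?thesis using k(2) by blast
qed

lemma omega_opposite: "\<omega> ^ ((k + 3) mod 6) = - (\<omega> ^ k)"
  by (simp add: omega_mod power_add omega_powers)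

lemma Re_norm_1: assumes "cmod z = 1" "1 \<le> Re z" shows "z = 1"
proof -
  have "(Re z)\<^sup>2 + (Im z)\<^sup>2 = 1" using assms(1) cmod_power2[of z] by simp
  moreover have "1\<^sup>2 \<le> (Re z)\<^sup>2" using assms(2) by (intro power_mono) auto
  ultimately have "(Im z)\<^sup>2 \<le> 0" unfolding one_power2 by linarith
  then have "Im z = 0" by (simp only: power2_less_eq_zero_iff)
  moreover have "Re z \<le> 1" using complex_Re_le_cmod[of z] assms(1) by simp
  ultimately have "Im z = 0" "Re z \<le> 1" by blast+
  then show ?thesis using assms(2) by (simp add: complex_eq_iff)
qed

lemma cmod_diff_sq: "(cmod (a - v))\<^sup>2 = (cmod a)\<^sup>2 - 2 * Re (a * cnj v) + (cmod v)\<^sup>2"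
  unfolding cmod_power2 by (simp add: power2_eq_square algebra_simps)

text \<open>A point lies in the hexagon about the nearest lattice point, since the hexagon is bounded by the
bisectors to the six neighbours.\<close>

lemma lattice_cell:
  assumes w: "cmod w = 1"
  shows "\<exists>n. z \<in> cell w (x + w * pos n)"
proof -
  define S where "S = range (\<lambda>n. x + w * pos n)"
  have dist: "dist (x + w * pos m) (x + w * pos n) = cmod (pos m - pos n)" for m n
  proof -
    have "(x + w * pos m) - (x + w * pos n) = w * (pos m - pos n)" by (simp add: algebra_simps)
    then show ?thesis unfolding dist_norm by (simp only: norm_mult w mult_1)
  qed
  have "closed S"
  proof (rule discrete_imp_closed[of 1])
    show "\<forall>a\<in>S. \<forall>b\<in>S. dist b a < 1 \<longrightarrow> b = a"
    proof (intro ballI impI)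
      fix a b assume "a \<in> S" "b \<in> S" "dist b a < 1"
      moreover then obtain m n where "a = x + w * pos m" "b = x + w * pos n" by (auto simp: S_def)
      ultimately show "b = a" using dist[of n m] pos_sep[of n m] by (cases "n = m") auto
    qed
  qed simp
  moreover have "S \<noteq> {}" by (simp add: S_def)
  ultimately obtain p where p: "p \<in> S" "\<And>y. y \<in> S \<Longrightarrow> dist z p \<le> dist z y"
    using distance_attains_inf[of S z] by blast
  then obtain n where n: "p = x + w * pos n" by (auto simp: S_def)
  have "Re ((z - p) * cnj (w * \<omega> ^ k)) \<le> 1/2" if "k < 6" for k
  proof -
    define v where "v = w * \<omega> ^ k"
    have v: "cmod v = 1" using w by (simp add: v_def norm_mult norm_power)
    have "p + v = x + w * pos (n + hexdir k)" using that by (simp add: n v_def pos_add pos_hexdir algebra_simps)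
    then have "p + v \<in> S" by (auto simp: S_def)
    then have "(cmod (z - p))\<^sup>2 \<le> (cmod (z - p - v))\<^sup>2"
      using p(2)[of "p + v"] by (intro power_mono) (auto simp: dist_norm diff_diff_eq)
    also have "\<dots> = (cmod (z - p))\<^sup>2 - 2 * Re ((z - p) * cnj v) + (cmod v)\<^sup>2"
      by (rule cmod_diff_sq)
    finally show ?thesis using v by (simp add: v_def)
  qed
  then show ?thesis unfolding cell_def n by auto
qed

lemma interior_cell_less:
  assumes w: "cmod w = 1" and z: "z \<in> interior (cell w p)" and k: "k < 6"
  shows "Re ((z - p) * cnj (w * \<omega> ^ k)) < 1/2"
proof -
  obtain e where e: "0 < e" "ball z e \<subseteq> cell w p" using z by (auto simp: mem_interior)
  define v where "v = w * \<omega> ^ k"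
  have v: "cmod v = 1" using w by (simp add: v_def norm_mult norm_power)
  have "z + of_real (e/2) * v \<in> ball z e" using e v by (simp add: dist_norm norm_mult)
  then have "Re ((z + of_real (e/2) * v - p) * cnj v) \<le> 1/2" using e k by (auto simp: cell_def v_def)
  moreover have vv: "v * cnj v = 1" using v by (simp add: complex_norm_square[symmetric])
  have "(z + of_real (e/2) * v - p) * cnj v = (z - p) * cnj v + of_real (e/2) * (v * cnj v)"
    by (simp add: algebra_simps)
  then have "Re ((z + of_real (e/2) * v - p) * cnj v) = Re ((z - p) * cnj v) + e/2"
    unfolding vv by (simp only: plus_complex.sel Re_complex_of_real mult_1_right)
  ultimately have "Re ((z - p) * cnj v) + e / 2 \<le> 1/2" by (simp only:)
  then show ?thesis using e by (simp add: v_def)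
qed

lemma interior_cell_I:
  assumes "\<And>k. k < 6 \<Longrightarrow> Re ((z - p) * cnj (w * \<omega> ^ k)) < 1/2"
  shows "z \<in> interior (cell w p)"
proof -
  define S where "S = (\<Inter>k\<in>{..<6}. {z. Re ((z - p) * cnj (w * \<omega> ^ k)) < 1/2})"
  have "open S" unfolding S_def
    by (intro open_INT ballI open_Collect_less continuous_intros) auto
  moreover have "S \<subseteq> cell w p" by (auto simp: S_def cell_def intro: less_imp_le)
  moreover have "z \<in> S" using assms by (simp add: S_def)
  ultimately show ?thesis by (meson interiorI)
qed

text \<open>The inscribed circle about \<open>p'\<close> lies in the hexagon about \<open>p\<close>, so \<open>p' - p\<close> has no positive component
along any of the six edge normals, which come in opposite pairs.\<close>

lemma cell_centre:
  assumes u: "cmod u = 1" "cmod u' = 1" and eq: "cell u p = cell u' p'"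
  shows "p = p'"
proof -
  define v where "v = (p' - p) * cnj u"
  have le: "Re (v * cnj (\<omega> ^ k)) \<le> 0" if "k < 6" for k
  proof -
    define a where "a = u * \<omega> ^ k"
    have a: "cmod a = 1" using u by (simp add: a_def norm_mult norm_power)
    then have "p' + of_real (1/2) * a \<in> cball p' (1/2)" by (simp add: dist_norm norm_mult)
    then have "p' + of_real (1/2) * a \<in> cell u p" using cball_cell[OF u(2), of p'] eq by blast
    then have "Re ((p' + of_real (1/2) * a - p) * cnj a) \<le> 1/2" using that by (auto simp: cell_def a_def)
    moreover have aa: "a * cnj a = 1" using a by (simp add: complex_norm_square[symmetric])
    have "(p' + of_real (1/2) * a - p) * cnj a = (p' - p) * cnj a + of_real (1/2) * (a * cnj a)"
      by (simp add: algebra_simps)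
    then have "Re ((p' + of_real (1/2) * a - p) * cnj a) = Re ((p' - p) * cnj a) + 1/2"
      unfolding aa by (simp only: plus_complex.sel Re_complex_of_real mult_1_right)
    ultimately have "Re ((p' - p) * cnj a) \<le> 0" by linarith
    moreover have "(p' - p) * cnj a = v * cnj (\<omega> ^ k)" by (simp add: a_def v_def)
    ultimately show ?thesis by (simp only:)
  qed
  have "Re v = 0" using le[of 0] le[of 3] by (simp add: omega_powers complex_cnj_power[symmetric] del: complex_cnj_power)
  moreover have omega_4: "\<omega> ^ 4 = - \<omega>" unfolding omega_powers by (simp add: \<omega>_def complex_eq_iff)
  have "Re (v * cnj \<omega>) \<le> 0" "Re (v * cnj (- \<omega>)) \<le> 0" using le[of 1] le[of 4] unfolding omega_4 by simp_all
  ultimately have "Im v = 0" by (simp add: \<omega>_def)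
  then have "v = 0" using \<open>Re v = 0\<close> by (simp add: complex_eq_iff)
  then show ?thesis using u by (auto simp: v_def)
qed

lemma place_centre:
  assumes "cmod u = 1" "cmod u' = 1" "place \<delta> u p = place \<delta> u' p'"
  shows "p = p'"
proof -
  have "body (place \<delta> u p) = body (place \<delta> u' p')" using assms(3) by simp
  then have "cell u p = cell u' p'" using inj_plane_of assms(1,2) by (simp add: body_place inj_image_eq_iff)
  then show ?thesis by (rule cell_centre[OF assms(1,2)])
qed

definition centres :: "real \<Rightarrow> tile set \<Rightarrow> complex set" where
  "centres \<delta> T = {p. \<exists>u. cmod u = 1 \<and> place \<delta> u p \<in> T}"

lemma tiling_frontier:
  assumes "is_tiling \<delta> T" and u: "cmod u = 1" "cmod u' = 1"
    and T: "place \<delta> u p \<in> T" "place \<delta> u' p' \<in> T" "place \<delta> u p \<noteq> place \<delta> u' p'"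
    and z: "z \<in> cell u p" "z \<in> cell u' p'"
  shows "z \<notin> interior (cell u p)"
proof
  assume "z \<in> interior (cell u p)"
  then have "plane_of z \<in> interior (body (place \<delta> u p))" using u by (simp add: body_place interior_plane_of)
  moreover have "plane_of z \<in> body (place \<delta> u p) \<inter> body (place \<delta> u' p')" using z u by (simp add: body_place)
  then have "plane_of z \<in> frontier (body (place \<delta> u p))" using assms(1) T unfolding is_tiling_def by blast
  ultimately show False by (simp add: frontier_def)
qed

lemma tiling_place:
  assumes "is_tiling \<delta> T" "t \<in> T"
  obtains u p where "cmod u = 1" "t = place \<delta> u p" "p \<in> centres \<delta> T"
proof -
  have "\<exists>f. direct_isometry f \<and> t = map_tile f (P0 \<delta>)" using assms by (simp add: is_tiling_def)
  then obtain f where f: "direct_isometry f" "t = map_tile f (P0 \<delta>)" by (elim exE conjE)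
  from f(1) obtain u p where "cmod u = 1" "f = frame u p"
    unfolding direct_isometry_frame by (elim exE conjE)
  then have up: "cmod u = 1" "t = place \<delta> u p" using f(2) by (simp_all add: place_def)
  then have "p \<in> centres \<delta> T" using assms(2) by (auto simp: centres_def)
  then show ?thesis using that[OF up] by simp
qed

text \<open>Otherwise the midpoint of the two centres is in the interior of both inscribed discs.\<close>

lemma tiling_separated:
  assumes til: "is_tiling \<delta> T" and u: "cmod u = 1" "cmod u' = 1"
    and T: "place \<delta> u p \<in> T" "place \<delta> u' p' \<in> T" "place \<delta> u p \<noteq> place \<delta> u' p'"
  shows "1 \<le> dist p p'"
proof (rule ccontr)
  assume "\<not> 1 \<le> dist p p'"
  then have d: "cmod (p - p') < 1" by (simp add: dist_norm)
  define z where "z = (p + p') / 2"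
  have eq: "p - z = (p - p') / 2" "p' - z = (p' - p) / 2" by (simp_all add: z_def field_simps)
  have zb: "z \<in> ball p (1/2)" "z \<in> ball p' (1/2)"
    unfolding mem_ball dist_norm eq norm_divide using d by (simp_all add: norm_minus_commute)
  have "ball p (1/2) \<subseteq> interior (cell u p)"
    using cball_cell[OF u(1), of p] by (intro interior_maximal) (auto intro: order_trans ball_subset_cball)
  moreover have "z \<in> cell u p" "z \<in> cell u' p'"
    using zb cball_cell[OF u(1), of p] cball_cell[OF u(2), of p'] ball_subset_cball by blast+
  ultimately show False using tiling_frontier[OF til u T] zb by blast
qed

lemma tiling_saturated:
  assumes til: "is_tiling \<delta> T"
  shows "saturated (centres \<delta> T)"
  unfolding saturated_def
proof (intro conjI ballI allI impI)
  fix p p' assume "p \<in> centres \<delta> T" "p' \<in> centres \<delta> T" "p \<noteq> p'"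
  then obtain u u' where u: "cmod u = 1" "cmod u' = 1" and T: "place \<delta> u p \<in> T" "place \<delta> u' p' \<in> T"
    by (auto simp: centres_def)
  have "place \<delta> u p \<noteq> place \<delta> u' p'" using place_centre[OF u] \<open>p \<noteq> p'\<close> by blast
  then show "1 \<le> dist p p'" using tiling_separated[OF til u T] by blast
next
  fix z
  have "plane_of z \<in> (\<Union>t\<in>T. body t)" using til by (simp add: is_tiling_def)
  then obtain t where t: "t \<in> T" "plane_of z \<in> body t" by auto
  obtain u p where up: "cmod u = 1" "t = place \<delta> u p" "p \<in> centres \<delta> T"
    using tiling_place[OF til t(1)] .
  then have "z \<in> cell u p" using t by (auto simp: body_place)
  then have "(dist z p)\<^sup>2 \<le> 1/3" using cell_radius[OF up(1)] by (simp add: dist_norm)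
  then show "\<exists>p\<in>centres \<delta> T. dist z p \<le> \<rho>" using up le_rho by auto
qed

lemma tiling_unique:
  assumes "is_tiling \<delta> T" "cmod u = 1" "cmod u' = 1" "place \<delta> u p \<in> T" "place \<delta> u' p \<in> T"
  shows "place \<delta> u p = place \<delta> u' p"
  using tiling_separated[OF assms] by auto

text \<open>The centres are saturated, hence contain a lattice, and nothing else since the lattice covers with
radius \<open>\<rho> < 1\<close>. The orientation is aligned with the lattice because the midpoint between two
neighbouring centres belongs to both tiles and so has to lie on the boundary; the inscribed circle
meets the boundary of the hexagon only in the midpoints of its edges.\<close>

lemma tiling_frame:
  assumes til: "is_tiling \<delta> T"
  obtains x w where "cmod w = 1"
    "\<And>u p. cmod u = 1 \<Longrightarrow> place \<delta> u p \<in> T \<Longrightarrow> (\<exists>n. p = x + w * pos n) \<and> (\<exists>r<6. u = w * \<omega> ^ r)"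
    "\<And>n. \<exists>r<6. place \<delta> (w * \<omega> ^ r) (x + w * pos n) \<in> T"
proof -
  have sat: "saturated (centres \<delta> T)" by (rule tiling_saturated[OF til])
  then obtain x w where w: "cmod w = 1" and X: "\<And>n. x + w * pos n \<in> centres \<delta> T"
    using saturated_lattice by metis
  have centre: "\<exists>n. p = x + w * pos n" if p: "p \<in> centres \<delta> T" for p
  proof -
    obtain n where "p \<in> cell w (x + w * pos n)" using lattice_cell[OF w] by blast
    then have "(dist p (x + w * pos n))\<^sup>2 \<le> 1/3" using cell_radius[OF w] by (simp add: dist_norm)
    then have "dist p (x + w * pos n) < 1" using le_rho[of "dist p (x + w * pos n)"] rho by simp
    then have "p = x + w * pos n" using sat p X[of n] unfolding saturated_def by fastforce
    then show ?thesis by blast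
  qed
  have orient: "\<exists>r<6. u = w * \<omega> ^ r" if u: "cmod u = 1" and T: "place \<delta> u p \<in> T" for u p
  proof -
    have "p \<in> centres \<delta> T" using u T by (auto simp: centres_def)
    then obtain n where n: "p = x + w * pos n" using centre by blast
    have "p + w = x + w * pos (n + (1, 0))" by (simp add: n pos_add algebra_simps) (simp add: pos_def)
    then have "p + w \<in> centres \<delta> T" using X by metis
    then obtain u' where u': "cmod u' = 1" "place \<delta> u' (p + w) \<in> T" by (auto simp: centres_def)
    have "p \<noteq> p + w" using w by auto
    then have "place \<delta> u p \<noteq> place \<delta> u' (p + w)" using place_centre[OF u u'(1)] by blast
    moreover have "p + w / 2 \<in> cell u p" using cball_cell[OF u, of p] w by (auto simp: dist_norm norm_divide)
    moreover have "(p + w) - (p + w / 2) = w / 2" by simp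
    then have "p + w / 2 \<in> cball (p + w) (1/2)" using w unfolding mem_cball dist_norm by (simp only: norm_divide) simp
    then have "p + w / 2 \<in> cell u' (p + w)" using cball_cell[OF u'(1), of "p + w"] by blast
    ultimately have "p + w / 2 \<notin> interior (cell u p)" using tiling_frontier[OF til u u'(1) T u'(2)] by blast
    then obtain k where k: "k < 6" "\<not> Re ((p + w / 2 - p) * cnj (u * \<omega> ^ k)) < 1/2"
      using interior_cell_I by blast
    define v where "v = w * cnj (u * \<omega> ^ k)"
    have "(p + w / 2 - p) * cnj (u * \<omega> ^ k) = v / 2" by (simp add: v_def)
    then have "1 \<le> Re v" using k(2) by (simp only:) simp
    moreover have "cmod v = 1" using u w by (simp add: v_def norm_mult norm_power)
    ultimately have "v = 1" by (intro Re_norm_1)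
    have "u * cnj u = 1" "\<omega> ^ k * cnj (\<omega> ^ k) = 1"
      using u by (simp_all add: complex_norm_square[symmetric] norm_power del: complex_cnj_power)
    then have "v * (u * \<omega> ^ k) = w"
      unfolding v_def complex_cnj_mult by (metis (no_types, lifting) mult.assoc mult.commute mult.right_neutral)
    then have "w = u * \<omega> ^ k" using \<open>v = 1\<close> by simp
    then have "w * \<omega> ^ (6 - k) = u * (\<omega> ^ k * \<omega> ^ (6 - k))" by (simp add: mult.assoc)
    also have "\<omega> ^ k * \<omega> ^ (6 - k) = 1" using k(1) by (simp add: power_add[symmetric] omega_powers)
    finally have "u = w * \<omega> ^ ((6 - k) mod 6)" by (simp add: omega_mod)
    then show ?thesis by (metis mod_less_divisor zero_less_numeral)
  qed
  have "\<exists>r<6. place \<delta> (w * \<omega> ^ r) (x + w * pos n) \<in> T" for n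
  proof -
    obtain u where u: "cmod u = 1" "place \<delta> u (x + w * pos n) \<in> T" using X[of n] by (auto simp: centres_def)
    then show ?thesis using orient by metis
  qed
  moreover have "(\<exists>n. p = x + w * pos n) \<and> (\<exists>r<6. u = w * \<omega> ^ r)" if "cmod u = 1" "place \<delta> u p \<in> T" for u p
    using that centre orient by (auto simp: centres_def)
  ultimately show ?thesis using that w by blast
qed

text \<open>The centres of two hexagons with a common point are at most \<open>2\<rho> < \<surd>2\<close> apart, hence neighbours, and the
common point satisfies two opposite inequalities.\<close>

lemma cells_meet:
  assumes w: "cmod w = 1" and "m \<noteq> n" and z: "z \<in> cell w (x + w * pos n)" "z \<in> cell w (x + w * pos m)"
  shows "\<exists>k<6. m = n + hexdir k \<and> Re ((z - (x + w * pos n)) * cnj (w * \<omega> ^ k)) = 1/2"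
proof -
  define p q where "p = x + w * pos n" and "q = x + w * pos m"
  have qp: "q - p = w * pos (m - n)" by (simp add: p_def q_def pos_diff algebra_simps)
  have "dist z p \<le> \<rho>" "dist z q \<le> \<rho>"
    using cell_radius[OF w] z le_rho by (auto simp: dist_norm p_def q_def)
  then have "cmod (q - p) \<le> 2 * \<rho>" using dist_triangle3[of q p z] by (simp add: dist_norm)
  then have "(cmod (q - p))\<^sup>2 \<le> (2 * \<rho>)\<^sup>2" by (intro power_mono) auto
  then have "(cmod (pos (m - n)))\<^sup>2 < 2" unfolding qp norm_mult w by (simp add: power_mult_distrib rho)
  then obtain k where k: "k < 6" "m - n = hexdir k" using pos_unit[of "m - n"] assms(2) by auto
  define v where "v = w * \<omega> ^ k"
  have v: "v * cnj v = 1" using w by (simp add: v_def norm_mult norm_power complex_norm_square[symmetric] del: complex_cnj_mult)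
  have q: "q = p + v" using qp k pos_hexdir[OF k(1)] by (simp add: v_def algebra_simps)
  have "Re ((z - p) * cnj v) \<le> 1/2" using z(1) k(1) by (auto simp: cell_def p_def v_def)
  moreover have "Re ((z - q) * cnj (w * \<omega> ^ ((k + 3) mod 6))) \<le> 1/2" using z(2) by (simp only: cell_def q_def mem_Collect_eq)
  then have "Re ((z - q) * cnj (- v)) \<le> 1/2" unfolding omega_opposite v_def by (simp only: mult_minus_right)
  moreover have "(z - q) * cnj (- v) = - ((z - p) * cnj v) + v * cnj v" by (simp add: q algebra_simps)
  then have "Re ((z - q) * cnj (- v)) = - Re ((z - p) * cnj v) + 1"
    unfolding v by (simp only: plus_complex.sel uminus_complex.sel one_complex.sel)
  ultimately have "Re ((z - p) * cnj v) = 1/2" by linarith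
  then show ?thesis using k by (intro exI[of _ k]) (auto simp: p_def v_def algebra_simps)
qed

section \<open>Marks on a common edge\<close>

lemma mem_plane_of: "x \<in> plane_of ` S \<longleftrightarrow> complex_of x \<in> S"
  by (auto intro: image_eqI[of _ _ "complex_of x"])

definition edge :: "complex \<Rightarrow> complex \<Rightarrow> nat \<Rightarrow> complex set" where
  "edge w p k = {z \<in> cell w p. Re ((z - p) * cnj (w * \<omega> ^ k)) = 1/2}"

lemma sqrt3_rho: "sqrt 3 * \<rho> = 1"
  by (simp add: \<rho>_def real_sqrt_mult[symmetric])

text \<open>The bound \<open>\<rho>/2\<close> is half the length of an edge; it comes from the inequalities of the two adjacent
edges.\<close>

lemma cell_edge_iff: "Complex (1/2) y \<in> cell 1 0 \<longleftrightarrow> \<bar>y\<bar> \<le> \<rho> / 2"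
proof -
  have "\<bar>sqrt 3 * y\<bar> \<le> 1/2 \<longleftrightarrow> sqrt 3 * \<bar>y\<bar> \<le> sqrt 3 * (\<rho> / 2)"
    using sqrt3_rho by (simp add: abs_mult)
  then have y: "\<bar>y\<bar> \<le> \<rho> / 2 \<longleftrightarrow> \<bar>sqrt 3 * y\<bar> \<le> 1/2" by simp
  have all6: "(\<forall>k<6. P k) \<longleftrightarrow> P 0 \<and> P 1 \<and> P 2 \<and> P 3 \<and> P 4 \<and> P (5::nat)" for P
    by (auto dest!: less_6_cases)
  show ?thesis unfolding cell_def mem_Collect_eq all6 y
    by (simp add: omega_powers complex_cnj_power[symmetric] del: complex_cnj_power)
       (auto simp: \<omega>_def abs_le_iff mult.commute)
qed

lemma edge_eq:
  assumes w: "cmod w = 1"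
  shows "edge w p k = (\<lambda>y. p + w * \<omega> ^ k * Complex (1/2) y) ` {- (\<rho> / 2)..\<rho> / 2}"
proof -
  define u where "u = w * \<omega> ^ k"
  have u: "cmod u = 1" "u * cnj u = 1" using w
    by (simp_all add: u_def norm_mult norm_power complex_norm_square[symmetric] del: complex_cnj_mult)
  have mem: "u * s + p \<in> edge w p k \<longleftrightarrow> s \<in> cell 1 0 \<and> Re s = 1/2" for s
  proof -
    have "(u * s + p - p) * cnj u = (u * cnj u) * s" by (simp add: algebra_simps)
    moreover have "u * s + p \<in> cell u p \<longleftrightarrow> s \<in> cell 1 0"
      unfolding cell_image[OF u(1), of p] using u(1) by (auto simp: image_iff)
    moreover have "edge w p k = {z \<in> cell u p. Re ((z - p) * cnj u) = 1/2}"
      unfolding edge_def u_def cell_orient ..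
    ultimately show ?thesis by (simp only: mem_Collect_eq u(2) mult_1)
  qed
  show ?thesis
  proof (intro equalityI subsetI)
    fix z assume z: "z \<in> edge w p k"
    define s where "s = (z - p) / u"
    have zs: "z = u * s + p" using u by (auto simp: s_def)
    then have s: "s \<in> cell 1 0" "Re s = 1/2" using mem z by auto
    then have "s = Complex (1/2) (Im s)" by (simp add: complex_eq_iff)
    then have "\<bar>Im s\<bar> \<le> \<rho> / 2" using s cell_edge_iff by metis
    then show "z \<in> (\<lambda>y. p + w * \<omega> ^ k * Complex (1/2) y) ` {- (\<rho> / 2)..\<rho> / 2}"
      using zs \<open>s = Complex (1/2) (Im s)\<close> by (intro image_eqI[of _ _ "Im s"]) (auto simp: u_def)
  next
    fix z assume "z \<in> (\<lambda>y. p + w * \<omega> ^ k * Complex (1/2) y) ` {- (\<rho> / 2)..\<rho> / 2}"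
    then obtain y where yr: "y \<in> {- (\<rho> / 2)..\<rho> / 2}" and "z = p + w * \<omega> ^ k * Complex (1/2) y" by blast
    then have y: "z = u * Complex (1/2) y + p" by (simp add: u_def)
    have "\<bar>y\<bar> \<le> \<rho> / 2" unfolding abs_le_iff using yr by simp
    then show "z \<in> edge w p k" using mem[of "Complex (1/2) y"] cell_edge_iff y by simp
  qed
qed

text \<open>An edge is shared: seen from the neighbour across it, it is the opposite edge.\<close>

lemma edge_opposite:
  assumes w: "cmod w = 1"
  shows "edge w (p + w * \<omega> ^ k) ((k + 3) mod 6) = edge w p k"
proof -
  have "(\<lambda>y. p + w * \<omega> ^ k + w * \<omega> ^ ((k + 3) mod 6) * Complex (1/2) y) ` {- (\<rho> / 2)..\<rho> / 2} =
      (\<lambda>y. p + w * \<omega> ^ k * Complex (1/2) y) ` uminus ` {- (\<rho> / 2)..\<rho> / 2}"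
    unfolding image_image omega_opposite
    by (intro image_cong refl) (simp add: Complex_eq algebra_simps)
  then show ?thesis unfolding edge_eq[OF w] by simp
qed

lemma convex_cell: "convex (cell w p)"
proof -
  have i: "Re ((z - p) * cnj a) = inner a z - inner a p" for a z
    by (simp add: inner_complex_def algebra_simps)
  have "cell w p = (\<Inter>k\<in>{..<6}. {z. inner (w * \<omega> ^ k) z \<le> 1/2 + inner (w * \<omega> ^ k) p})"
    unfolding cell_def i diff_le_eq by auto
  then show ?thesis by (simp add: convex_INT convex_halfspace_le)
qed

text \<open>An edge is the face cut out by a supporting line, and it is a nondegenerate segment.\<close>

lemma edge_face:
  assumes "cmod w = 1" "k < 6"
  shows "plane_of ` edge w p k edge_of plane_of ` cell w p"
  unfolding edge_of_def
proof
  define u where "u = w * \<omega> ^ k"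
  have i: "Re ((z - p) * cnj u) = inner u z - inner u p" for z
    by (simp add: inner_complex_def algebra_simps)
  have "cell w p \<inter> {z. inner u z = 1/2 + inner u p} face_of cell w p"
  proof (rule face_of_Int_supporting_hyperplane_le[OF convex_cell])
    fix z assume "z \<in> cell w p"
    then have "Re ((z - p) * cnj u) \<le> 1/2" using assms(2) unfolding cell_def u_def by blast
    then show "inner u z \<le> 1/2 + inner u p" unfolding i by simp
  qed
  moreover have "edge w p k = cell w p \<inter> {z. inner u z = 1/2 + inner u p}"
    unfolding edge_def u_def[symmetric] i by auto
  ultimately show "plane_of ` edge w p k face_of plane_of ` cell w p"
    by (simp add: face_of_linear_image[OF linear_plane_of inj_plane_of])
  define f where "f y = u * \<i> * of_real y" for y
  have f: "linear f" by (rule linearI) (simp_all add: f_def algebra_simps scaleR_conv_of_real)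
  have "cmod u = 1" by (simp add: u_def norm_mult norm_power assms)
  then have "u \<noteq> 0" by auto
  have inj: "inj f" by (rule injI) (use \<open>u \<noteq> 0\<close> in \<open>simp add: f_def\<close>)
  have "edge w p k = (\<lambda>z. (p + u / 2) + z) ` f ` {- (\<rho> / 2)..\<rho> / 2}"
    unfolding edge_eq[OF assms(1)] image_image u_def[symmetric]
    by (intro image_cong refl) (simp add: f_def Complex_eq algebra_simps)
  then have "aff_dim (plane_of ` edge w p k) = aff_dim {- (\<rho> / 2)..\<rho> / 2}"
    using f inj linear_plane_of inj_plane_of by (simp add: aff_dim_translation_eq)
  also have "{- (\<rho> / 2)..\<rho> / 2} = convex hull {- (\<rho> / 2), \<rho> / 2}"
    using rho(1) by (simp flip: segment_convex_hull add: closed_segment_eq_real_ivl)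
  also have "aff_dim \<dots> = 1" using rho(1) by (simp add: aff_dim_convex_hull)
  finally show "aff_dim (plane_of ` edge w p k) = 1" .
qed

text \<open>The offset of the mark on the edge in direction \<open>\<omega> ^ k\<close> of the lattice if the tile is turned by
\<open>r\<close> sixths; \<open>6 - r\<close> stands for \<open>-r\<close> to stay within the natural numbers.\<close>

definition mark_side :: "nat \<Rightarrow> nat \<Rightarrow> real" where
  "mark_side r k = sgn_off ((k + (6 - r)) mod 6)"

lemma mark_side_mod [simp]: "mark_side r (k mod 6) = mark_side r k"
  by (simp add: mark_side_def mod_simps)

lemma sgn_off_cases: "i < 6 \<Longrightarrow> sgn_off i = 1 \<or> sgn_off i = -1"
  by (drule less_6_cases) (auto simp: sgn_off_def)

lemma mark_side_cases: "mark_side r k = 1 \<or> mark_side r k = -1"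
  by (simp add: mark_side_def sgn_off_cases)

lemma mark_off_edge:
  assumes "e < 6" "e \<noteq> 0" and y: "\<bar>y\<bar> < \<rho> / 2"
  shows "Re (\<omega> ^ e * Complex (1/2) y) < 1/2"
proof -
  have "sqrt 3 * \<bar>y\<bar> < sqrt 3 * (\<rho> / 2)" using y by simp
  then have "\<bar>sqrt 3 * y\<bar> < 1/2" using sqrt3_rho by (simp add: abs_mult)
  then have y: "sqrt 3 * y < 1/2" "- (sqrt 3 * y) < 1/2" by linarith+
  show ?thesis using less_6_cases[OF assms(1)] assms(2) y
    by (elim disjE) (simp_all add: omega_powers, simp_all add: \<omega>_def)
qed

text \<open>A mark is an interior point of its edge because \<open>\<delta> < \<rho>/2\<close>, so it lies on no other edge.\<close>

lemma marks_on_edge: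
  assumes \<delta>: "0 < \<delta>" "\<delta> < \<rho> / 2" and w: "cmod w = 1" and rk: "r < 6" "k < 6"
  shows "r1_ends (place \<delta> (w * \<omega> ^ r) p) \<inter> plane_of ` edge w p k =
    {plane_of (p + w * \<omega> ^ k * Complex (1/2) (mark_side r k * \<delta>))}"
proof -
  define M where "M l = p + w * \<omega> ^ r * \<omega> ^ l * Complex (1/2) (sgn_off l * \<delta>)" for l
  define i where "i = (k + (6 - r)) mod 6"
  have i6: "i < 6" by (simp add: i_def)
  have ri: "\<omega> ^ r * \<omega> ^ i = \<omega> ^ k"
  proof -
    have "\<omega> ^ i = \<omega> ^ (k + (6 - r))" unfolding i_def by (rule omega_mod)
    then have "\<omega> ^ r * \<omega> ^ i = \<omega> ^ (r + (k + (6 - r)))" by (simp only: power_add)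
    also have "r + (k + (6 - r)) = k + 6" using rk by simp
    finally show ?thesis by (simp add: power_add omega_powers)
  qed
  have Mi: "M i = p + w * \<omega> ^ k * Complex (1/2) (mark_side r k * \<delta>)"
    unfolding M_def mult.assoc[of w "\<omega> ^ r" "\<omega> ^ i"] ri by (simp add: mark_side_def i_def)
  have sd: "\<bar>sgn_off l * \<delta>\<bar> < \<rho> / 2" if "l < 6" for l
    using sgn_off_cases[OF that] \<delta> by auto
  have "M i \<in> edge w p k"
    using sd[OF i6] unfolding Mi edge_eq[OF w] mark_side_def i_def[symmetric] abs_less_iff
    by (intro image_eqI[OF refl]) simp
  moreover have "M l \<notin> edge w p k" if l: "l < 6" "l \<noteq> i" for l
  proof
    assume "M l \<in> edge w p k"
    then have 1: "Re ((M l - p) * cnj (w * \<omega> ^ k)) = 1/2" by (simp add: edge_def)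
    define e where "e = (r + l + (6 - k)) mod 6"
    have "\<omega> ^ k * cnj (\<omega> ^ k) = 1" "w * cnj w = 1" using w
      by (simp_all add: complex_norm_square[symmetric] norm_power del: complex_cnj_power)
    moreover have "\<omega> ^ k * \<omega> ^ (6 - k) = 1" using rk by (simp add: power_add[symmetric] omega_powers)
    ultimately have c: "cnj (\<omega> ^ k) = \<omega> ^ (6 - k)" and "w * cnj w = 1"
      by (metis mult.assoc mult.commute mult.right_neutral)+
    have "(M l - p) * cnj (w * \<omega> ^ k) = (w * cnj w) * (\<omega> ^ r * \<omega> ^ l * cnj (\<omega> ^ k)) * Complex (1/2) (sgn_off l * \<delta>)"
      by (simp add: M_def)
    also have "\<omega> ^ r * \<omega> ^ l * cnj (\<omega> ^ k) = \<omega> ^ e" unfolding c e_def omega_mod by (simp only: power_add)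
    finally have 2: "(M l - p) * cnj (w * \<omega> ^ k) = \<omega> ^ e * Complex (1/2) (sgn_off l * \<delta>)"
      using \<open>w * cnj w = 1\<close> by simp
    have "e \<noteq> 0"
    proof
      assume "e = 0"
      then obtain q where q: "r + l + (6 - k) = 6 * q" unfolding e_def mod_eq_0_iff_dvd by (elim dvdE)
      then have "q = 1 \<or> q = 2" using l(1) rk by linarith
      then have "k + (6 - r) = l + 6 \<or> k + (6 - r) = l" using q rk by auto
      then have "l = i" using l(1) by (auto simp: i_def)
      then show False using l by simp
    qed
    then have "Re (\<omega> ^ e * Complex (1/2) (sgn_off l * \<delta>)) < 1/2"
      by (intro mark_off_edge sd l) (simp_all add: e_def)
    then show False using 1 unfolding 2 by simp
  qed
  ultimately have "M ` {..<6} \<inter> edge w p k = {M i}" using i6 by auto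
  then have "plane_of ` (M ` {..<6} \<inter> edge w p k) = {plane_of (M i)}" by simp
  then show ?thesis unfolding r1_ends_place M_def[symmetric] Mi[symmetric] using inj_plane_of by (simp add: image_Int)
qed

text \<open>Opposite edges have opposite tangents, hence the sign.\<close>

lemma marks_agree_iff:
  assumes \<delta>: "0 < \<delta>" "\<delta> < \<rho> / 2" and w: "cmod w = 1" and r: "r < 6" "r' < 6" "k < 6"
  shows "r1_ends (place \<delta> (w * \<omega> ^ r) p) \<inter> plane_of ` edge w p k =
      r1_ends (place \<delta> (w * \<omega> ^ r') (p + w * \<omega> ^ k)) \<inter> plane_of ` edge w p k \<longleftrightarrow>
    mark_side r k = - mark_side r' (k + 3)"
proof -
  define q where "q = p + w * \<omega> ^ k"
  have "r1_ends (place \<delta> (w * \<omega> ^ r') q) \<inter> plane_of ` edge w q ((k + 3) mod 6) =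
    {plane_of (q + w * \<omega> ^ ((k + 3) mod 6) * Complex (1/2) (mark_side r' ((k + 3) mod 6) * \<delta>))}"
    by (rule marks_on_edge[OF \<delta> w]) (use r in auto)
  then have 2: "r1_ends (place \<delta> (w * \<omega> ^ r') q) \<inter> plane_of ` edge w p k =
    {plane_of (q + w * \<omega> ^ ((k + 3) mod 6) * Complex (1/2) (mark_side r' (k + 3) * \<delta>))}"
    unfolding q_def edge_opposite[OF w] by simp
  have "q + w * \<omega> ^ ((k + 3) mod 6) * Complex (1/2) (mark_side r' (k + 3) * \<delta>) =
      p + w * \<omega> ^ k * Complex (1/2) (- mark_side r' (k + 3) * \<delta>)"
    unfolding omega_opposite by (simp add: q_def Complex_eq algebra_simps)
  moreover have "w \<noteq> 0" using w by auto
  moreover have "\<omega> \<noteq> 0" by (metis norm_zero zero_neq_one norm_omega)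
  moreover have "mark_side r k * \<delta> = - mark_side r' (k + 3) * \<delta> \<longleftrightarrow> mark_side r k = - mark_side r' (k + 3)"
    using \<delta> by (simp only: mult_cancel_right) auto
  moreover have "{a} = {b} \<longleftrightarrow> a = b" for a b :: plane by blast
  ultimately show ?thesis
    unfolding q_def[symmetric] 2 marks_on_edge[OF \<delta> w r(1,3)]
    by (simp only: plane_of_eq add_left_cancel mult_cancel_left mult_eq_0_iff power_eq_0_iff complex.inject simp_thms)
qed

definition heading :: "3 \<Rightarrow> nat" where
  "heading j = (if j = 0 then 0 else if j = 1 then 2 else 4)"

text \<open>Index of the axis along which the straight R1-segment of the tile turned by \<open>r\<close> sixths runs.\<close>

definition tile_colour :: "nat \<Rightarrow> 3" where
  "tile_colour r = [2, 1, 0, 2, 1, 0] ! r"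

lemma three_numerals: "(3::3) = 0" "(4::3) = 1" by simp_all

lemma heading_less [simp]: "heading j < 6" by (simp add: heading_def)

lemma move_heading: "move j 1 n = n + hexdir (heading j)"
  using three_cases[of j] by (auto simp: move_def unit_step_def heading_def hexdir_def prod_eq_iff)

text \<open>How the tile transmits the mark along axis \<open>j\<close>, by its colour: with the sign change between
opposite edges, equality of the two values means that the mark switches sides.\<close>

lemma mark_side_by_colour:
  assumes "r < 6"
  shows "tile_colour r = j \<Longrightarrow> mark_side r (heading j) = - mark_side r (heading j + 3)"
    and "tile_colour r = j + 1 \<Longrightarrow> mark_side r (heading j) = 1 \<and> mark_side r (heading j + 3) = 1"
    and "tile_colour r = j + 2 \<Longrightarrow> mark_side r (heading j) = -1 \<and> mark_side r (heading j + 3) = -1"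
  using less_6_cases[OF assms] three_cases[of j]
  by (auto simp: tile_colour_def mark_side_def heading_def sgn_off_def three_numerals)

definition matched :: "(point \<Rightarrow> nat) \<Rightarrow> bool" where
  "matched ori \<longleftrightarrow> (\<forall>n j. mark_side (ori n) (heading j) = - mark_side (ori (move j 1 n)) (heading j + 3))"

lemma matched_consistent:
  assumes six: "\<And>n. ori n < 6" and "matched ori"
  shows "consistent (\<lambda>n. tile_colour (ori n)) (\<lambda>j n. mark_side (ori n) (heading j) = 1)"
proof -
  have m: "mark_side (ori (move j (-1) n)) (heading j) = - mark_side (ori n) (heading j + 3)" for j n
  proof -
    have "mark_side (ori (move j (-1) n)) (heading j) = - mark_side (ori (move j 1 (move j (-1) n))) (heading j + 3)"
      using assms(2) unfolding matched_def by blast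
    then show ?thesis by simp
  qed
  show ?thesis unfolding consistent_def m using mark_side_by_colour[OF six]
    by (metis minus_equation_iff one_neq_neg_one)
qed

text \<open>The colour leaves two orientations, which differ by a half-turn and are told apart by the side of
the straight segment.\<close>

definition orient :: "3 \<Rightarrow> bool \<Rightarrow> nat" where
  "orient c s = (if c = 0 then (if s then 2 else 5) else if c = 1 then (if s then 4 else 1)
     else (if s then 0 else 3))"

lemma orient:
  "orient c s < 6" "tile_colour (orient c s) = c" "mark_side (orient c s) (heading c) = 1 \<longleftrightarrow> s"
  using three_cases[of c] by (auto simp: orient_def tile_colour_def mark_side_def heading_def sgn_off_def)

text \<open>The side \<open>\<sigma>\<close> enters the orientation only through the tile's own axis. On the two other axes
the colour alone determines the marks of the tile as well as the values of \<open>\<sigma>\<close>.\<close>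

lemma consistent_matched:
  assumes con: "consistent c \<sigma>"
  shows "matched (\<lambda>n. orient (c n) (\<sigma> (c n) n))"
proof -
  define ori where "ori n = orient (c n) (\<sigma> (c n) n)" for n
  have six: "ori n < 6" and col: "tile_colour (ori n) = c n"
    and str: "mark_side (ori n) (heading (c n)) = 1 \<longleftrightarrow> \<sigma> (c n) n" for n
    by (simp_all add: ori_def orient)
  have fwd: "mark_side (ori n) (heading j) = 1 \<longleftrightarrow> \<sigma> j n" for n j
    using three_other[of "c n" j]
  proof (elim disjE)
    assume "c n = j" then show ?thesis using str[of n] by simp
  next
    assume "c n = j + 1"
    then show ?thesis using mark_side_by_colour(2)[OF six, of n j] consistentD(2)[OF con, of n j] col by simp
  next
    assume "c n = j + 2"
    then show ?thesis using mark_side_by_colour(3)[OF six, of n j] consistentD(3)[OF con, of n j] col by simp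
  qed
  have bwd: "mark_side (ori n) (heading j + 3) = 1 \<longleftrightarrow> \<not> \<sigma> j (move j (-1) n)" for n j
    using three_other[of "c n" j]
  proof (elim disjE)
    assume "c n = j"
    then have "mark_side (ori n) (heading j) = - mark_side (ori n) (heading j + 3)"
      using mark_side_by_colour(1)[OF six, of n j] col by simp
    then show ?thesis using fwd[of n j] consistentD(1)[OF con \<open>c n = j\<close>] mark_side_cases[of "ori n" "heading j"] by auto
  next
    assume "c n = j + 1"
    then show ?thesis using mark_side_by_colour(2)[OF six, of n j] consistentD(2)[OF con, of n j] col by simp
  next
    assume "c n = j + 2"
    then show ?thesis using mark_side_by_colour(3)[OF six, of n j] consistentD(3)[OF con, of n j] col by simp
  qed
  have "mark_side (ori n) (heading j) = - mark_side (ori (move j 1 n)) (heading j + 3)" for n j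
    using fwd[of n j] bwd[of "move j 1 n" j] mark_side_cases[of "ori n" "heading j"]
      mark_side_cases[of "ori (move j 1 n)" "heading j + 3"] by auto
  then show ?thesis by (simp add: matched_def ori_def)
qed

lemma R1_matched:
  assumes \<delta>: "0 < \<delta>" "\<delta> < \<rho> / 2" and w: "cmod w = 1" and "R1 T" and six: "\<And>n. ori n < 6"
    and T: "\<And>n. place \<delta> (w * \<omega> ^ ori n) (x + w * pos n) \<in> T"
  shows "matched ori"
  unfolding matched_def
proof (intro allI)
  fix n j
  define k where "k = heading j"
  define p where "p = x + w * pos n"
  have q: "x + w * pos (move j 1 n) = p + w * \<omega> ^ k"
    unfolding move_heading by (simp add: pos_add pos_hexdir p_def k_def algebra_simps)
  define s where "s = place \<delta> (w * \<omega> ^ ori n) p"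
  define t where "t = place \<delta> (w * \<omega> ^ ori (move j 1 n)) (p + w * \<omega> ^ k)"
  have body: "body s = plane_of ` cell w p" "body t = plane_of ` cell w (p + w * \<omega> ^ k)"
    using w by (simp_all add: s_def t_def body_place norm_mult norm_power cell_orient)
  have "plane_of ` edge w p k edge_of body s" unfolding body by (rule edge_face[OF w]) (simp add: k_def)
  moreover have "plane_of ` edge w p k edge_of body t"
    unfolding body edge_opposite[OF w, of p k, symmetric] by (rule edge_face[OF w]) simp
  moreover have "s \<in> T" unfolding s_def p_def by (rule T)
  moreover have "t \<in> T" unfolding t_def q[symmetric] by (rule T)
  ultimately have "r1_ends s \<inter> plane_of ` edge w p k = r1_ends t \<inter> plane_of ` edge w p k"
    using \<open>R1 T\<close> unfolding R1_def by blast
  then have "mark_side (ori n) k = - mark_side (ori (move j 1 n)) (k + 3)"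
    unfolding s_def t_def by (subst (asm) marks_agree_iff[OF \<delta> w six six]) (simp_all add: k_def)
  then show "mark_side (ori n) (heading j) = - mark_side (ori (move j 1 n)) (heading j + 3)" by (simp add: k_def)
qed

lemma hexdir_opposite: "k < 6 \<Longrightarrow> hexdir ((k + 3) mod 6) = - hexdir k"
  by (drule less_6_cases) (auto simp: hexdir_def)

text \<open>The other three directions are the same edges seen from the other tile.\<close>

lemma matched_all:
  assumes m: "matched ori" and k: "k < 6"
  shows "mark_side (ori n) k = - mark_side (ori (n + hexdir k)) (k + 3)"
proof -
  have ev: "mark_side (ori n) k = - mark_side (ori (n + hexdir k)) (k + 3)" if "k \<in> {0, 2, 4}" for n k
  proof -
    have "\<exists>j. k = heading j"
      using that by (auto simp: heading_def intro: exI[of _ 0] exI[of _ 1] exI[of _ 2])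
    then show ?thesis using m unfolding matched_def move_heading by blast
  qed
  show ?thesis
  proof (cases "k \<in> {0, 2, 4}")
    case False
    define l where "l = (k + 3) mod 6"
    have l: "l \<in> {0, 2, 4}" using False less_6_cases[OF k] by (auto simp: l_def)
    have "mark_side (ori (n + hexdir k)) l = - mark_side (ori (n + hexdir k + hexdir l)) (l + 3)"
      using ev[OF l] .
    also have "n + hexdir k + hexdir l = n" using hexdir_opposite[OF k] by (simp add: l_def)
    also have "mark_side (ori n) (l + 3) = mark_side (ori n) ((l + 3) mod 6)" by simp
    also have "(l + 3) mod 6 = k" using k by (simp add: l_def mod_simps)
    finally show ?thesis by (simp add: l_def)
  qed (use ev in blast)
qed

text \<open>Two different tiles that have an edge in common are neighbours, and this edge is contained in the
segment along which their bodies meet, where the marks agree.\<close>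

lemma matched_R1:
  assumes \<delta>: "0 < \<delta>" "\<delta> < \<rho> / 2" and six: "\<And>n. ori n < 6" and m: "matched ori"
  shows "R1 (range (\<lambda>n. place \<delta> (\<omega> ^ ori n) (pos n)))"
  unfolding R1_def
proof (intro ballI allI impI)
  fix s t e
  assume "s \<in> range (\<lambda>n. place \<delta> (\<omega> ^ ori n) (pos n))" "t \<in> range (\<lambda>n. place \<delta> (\<omega> ^ ori n) (pos n))"
    and e: "e edge_of body s \<and> e edge_of body t"
  then obtain n m' where s: "s = place \<delta> (\<omega> ^ ori n) (pos n)" and t: "t = place \<delta> (\<omega> ^ ori m') (pos m')" by blast
  show "r1_ends s \<inter> e = r1_ends t \<inter> e"
  proof (cases "m' = n")
    case False
    have body: "body s = plane_of ` cell 1 (pos n)" "body t = plane_of ` cell 1 (pos m')"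
      using cell_orient[of 1] by (simp_all add: s t body_place norm_power)
    have sub: "e \<subseteq> plane_of ` cell 1 (pos n)" "e \<subseteq> plane_of ` cell 1 (pos m')"
      using e edge_of_imp_subset body by metis+
    have "e \<noteq> {}" using e by (auto simp: edge_of_def)
    then obtain v where "v \<in> e" by blast
    then have "v \<in> plane_of ` cell 1 (pos n)" "v \<in> plane_of ` cell 1 (pos m')" using sub by blast+
    then have z: "complex_of v \<in> cell 1 (pos n)" "complex_of v \<in> cell 1 (pos m')" by (simp_all add: mem_plane_of)
    have w1: "cmod 1 = 1" by simp
    have meet: "\<exists>k<6. m' = n + hexdir k \<and> Re ((y - pos n) * cnj (\<omega> ^ k)) = 1/2"
      if "y \<in> cell 1 (pos n)" "y \<in> cell 1 (pos m')" for y
      using cells_meet[OF w1 False, of y 0, unfolded add_0 mult_1_left, OF that] .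
    obtain k where k: "k < 6" "m' = n + hexdir k" using meet[OF z] by blast
    have "e \<subseteq> plane_of ` edge 1 (pos n) k"
    proof
      fix v assume v: "v \<in> e"
      define y where "y = complex_of v"
      have "v \<in> plane_of ` cell 1 (pos n)" "v \<in> plane_of ` cell 1 (pos m')" using v sub by blast+
      then have y: "v = plane_of y" "y \<in> cell 1 (pos n)" "y \<in> cell 1 (pos m')" by (simp_all add: mem_plane_of y_def)
      then obtain l where l: "l < 6" "m' = n + hexdir l" "Re ((y - pos n) * cnj (\<omega> ^ l)) = 1/2"
        using meet[OF y(2,3)] by blast
      have "pos (hexdir l) = pos (hexdir k)" using l k by simp
      then have "\<omega> ^ l = \<omega> ^ k" using pos_hexdir l k by metis
      then show "v \<in> plane_of ` edge 1 (pos n) k" using y l by (auto simp: edge_def)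
    qed
    then have e': "A \<inter> e = (A \<inter> plane_of ` edge 1 (pos n) k) \<inter> e" for A by blast
    have "mark_side (ori n) k = - mark_side (ori m') (k + 3)" using matched_all[OF m k(1)] k(2) by simp
    moreover have "pos m' = pos n + 1 * \<omega> ^ k" using k by (simp add: pos_add pos_hexdir)
    ultimately have "r1_ends s \<inter> plane_of ` edge 1 (pos n) k = r1_ends t \<inter> plane_of ` edge 1 (pos n) k"
      using marks_agree_iff[OF \<delta> w1 six six k(1), of n "pos n" m'] by (simp add: s t)
    then show ?thesis using e' by metis
  qed (simp add: s t)
qed

section \<open>Trees and the graph of neighbours\<close>

definition arm :: "nat \<Rightarrow> nat \<Rightarrow> bool" where
  "arm r k \<longleftrightarrow> (k + (6 - r)) mod 6 \<in> {0, 1, 3, 4}"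

text \<open>The R2-tree of the tile with centre \<open>p\<close> in a frame \<open>w\<close>, with arms indexed by the direction in which
they point instead of their number in the tile.\<close>

definition tree :: "complex \<Rightarrow> complex \<Rightarrow> nat \<Rightarrow> complex set" where
  "tree w p r = (\<Union>k\<in>{k. k < 6 \<and> arm r k}. closed_segment p (p + w * \<omega> ^ k / 2))"

lemma arms_eq: "r < 6 \<Longrightarrow> {k. k < 6 \<and> arm r k} = (\<lambda>l. (r + l) mod 6) ` {0, 1, 3, 4}"
  by (drule less_6_cases, elim disjE) (auto simp: arm_def dest!: less_6_cases, presburger+)

lemma r2_tree_place_tree:
  assumes "r < 6"
  shows "r2_tree (place \<delta> (w * \<omega> ^ r) p) = plane_of ` tree w p r"
proof -
  have "w * \<omega> ^ r * \<omega> ^ l = w * \<omega> ^ ((r + l) mod 6)" for l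
    by (simp add: omega_mod power_add)
  then show ?thesis unfolding r2_tree_place tree_def arms_eq[OF assms] UN_simps(10) by (simp only:)
qed

text \<open>A tile of colour \<open>c\<close> has no arms along the axis \<open>c + 2\<close>; that is, the axis \<open>j\<close> with \<open>c = j + 1\<close>.\<close>

lemma arm_colour:
  assumes "r < 6"
  shows "arm r (heading j) \<longleftrightarrow> tile_colour r \<noteq> j + 1"
    and "arm r ((heading j + 3) mod 6) \<longleftrightarrow> tile_colour r \<noteq> j + 1"
  using less_6_cases[OF assms] three_cases[of j]
  by (auto simp: arm_def tile_colour_def heading_def three_numerals, presburger+)

lemma centre_in_tree: assumes "r < 6" shows "p \<in> tree w p r"
proof -
  have "r mod 6 \<in> {k. k < 6 \<and> arm r k}" unfolding arms_eq[OF assms] by (rule image_eqI[of _ _ 0]) auto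
  then show ?thesis unfolding tree_def by blast
qed

lemma connected_tree: assumes "r < 6" shows "connected (tree w p r)"
  unfolding tree_def
proof (rule connected_Union)
  show "\<Inter> ((\<lambda>k. closed_segment p (p + w * \<omega> ^ k / 2)) ` {k. k < 6 \<and> arm r k}) \<noteq> {}"
    by (rule ex_in_conv[THEN iffD1], rule exI[of _ p]) auto
qed auto

lemma closed_tree: "closed (tree w p r)"
  unfolding tree_def by (intro closed_UN) auto

lemma tree_cball:
  assumes "cmod w = 1" shows "tree w p r \<subseteq> cball p (1/2)"
proof -
  have "closed_segment p (p + w * \<omega> ^ k / 2) \<subseteq> cball p (1/2)" for k
    by (rule closed_segment_subset) (simp_all add: dist_norm norm_mult norm_divide norm_power assms)
  then show ?thesis unfolding tree_def by blast
qed

lemma hexdir_inj: "k < 6 \<Longrightarrow> l < 6 \<Longrightarrow> hexdir k = hexdir l \<Longrightarrow> k = l"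
  by (drule less_6_cases, drule less_6_cases) (elim disjE; simp add: hexdir_def)

text \<open>Arms have length \<open>1/2\<close> and centres are at least \<open>1\<close> apart, so a common point is the tip of two
arms that point towards each other.\<close>

lemma trees_meet:
  assumes w: "cmod w = 1" and "m \<noteq> n"
    and z: "z \<in> tree w (x + w * pos n) r" "z \<in> tree w (x + w * pos m) r'"
  shows "\<exists>k<6. m = n + hexdir k \<and> arm r k \<and> arm r' ((k + 3) mod 6)"
proof -
  obtain k where k: "k < 6" "arm r k" "z \<in> closed_segment (x + w * pos n) (x + w * pos n + w * \<omega> ^ k / 2)"
    using z(1) by (auto simp: tree_def)
  obtain l where l: "l < 6" "arm r' l" "z \<in> closed_segment (x + w * pos m) (x + w * pos m + w * \<omega> ^ l / 2)"
    using z(2) by (auto simp: tree_def)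
  have same_run: "\<exists>t. 0 \<le> t \<and> t \<le> 1 \<and> y = p + of_real (t / 2) * v" if "y \<in> closed_segment p (p + v / 2)" for y p v :: complex
  proof -
    obtain t where "0 \<le> t" "t \<le> 1" "y = (1 - t) *\<^sub>R p + t *\<^sub>R (p + v / 2)"
      using \<open>y \<in> closed_segment p (p + v / 2)\<close> by (auto simp: in_segment)
    then show ?thesis by (intro exI[of _ t]) (simp add: scaleR_conv_of_real algebra_simps)
  qed
  obtain s where s: "0 \<le> s" "s \<le> 1" "z = x + w * pos n + of_real (s / 2) * (w * \<omega> ^ k)"
    using same_run[OF k(3)] by blast
  obtain t where t: "0 \<le> t" "t \<le> 1" "z = x + w * pos m + of_real (t / 2) * (w * \<omega> ^ l)"
    using same_run[OF l(3)] by blast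
  have "w * (pos m - pos n) = w * (of_real (s / 2) * \<omega> ^ k - of_real (t / 2) * \<omega> ^ l)"
    using s(3) t(3) by (simp add: algebra_simps)
  moreover have "w \<noteq> 0" using w by auto
  ultimately have D: "pos m - pos n = of_real (s / 2) * \<omega> ^ k - of_real (t / 2) * \<omega> ^ l" by simp
  have "cmod (pos m - pos n) \<le> cmod (of_real (s / 2) * \<omega> ^ k) + cmod (of_real (t / 2) * \<omega> ^ l)"
    unfolding D by (rule norm_triangle_ineq4)
  also have "\<dots> = s / 2 + t / 2" using s t by (simp add: norm_mult norm_power)
  finally have le: "cmod (pos m - pos n) \<le> s / 2 + t / 2" .
  moreover have ge: "1 \<le> cmod (pos m - pos n)" by (rule pos_sep[OF assms(2)])
  ultimately have st: "s = 1" "t = 1" using s t by linarith+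
  define a where "a = \<omega> ^ k * cnj (\<omega> ^ l)"
  have na: "cmod (- a) = 1" by (simp add: a_def norm_mult norm_power)
  have "cmod (pos m - pos n) = 1" using le ge st by simp
  then have "cmod ((\<omega> ^ k - \<omega> ^ l) / 2) = 1" unfolding D st by (simp add: diff_divide_distrib)
  then have "cmod (\<omega> ^ k - \<omega> ^ l) = 2" by (simp add: norm_divide)
  then have "(cmod (\<omega> ^ k))\<^sup>2 - 2 * Re a + (cmod (\<omega> ^ l))\<^sup>2 = 4"
    unfolding a_def cmod_diff_sq[symmetric] by simp
  then have "1 \<le> Re (- a)" by (simp add: norm_power)
  then have "- a = 1" by (rule Re_norm_1[OF na])
  moreover have "cnj (\<omega> ^ l) * \<omega> ^ l = 1"
    by (simp add: mult.commute[of "cnj _"] complex_norm_square[symmetric] norm_power del: complex_cnj_power)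
  then have "a * \<omega> ^ l = \<omega> ^ k" by (simp only: a_def mult.assoc mult_1_right)
  ultimately have "\<omega> ^ k = - (\<omega> ^ l)" by (metis add.inverse_inverse mult_minus1)
  then have ol: "\<omega> ^ l = - (\<omega> ^ k)" by simp
  have "pos m - pos n = pos (hexdir k)" unfolding D st ol pos_hexdir[OF k(1)] by simp
  then have "m - n = hexdir k" by (simp add: pos_diff[symmetric])
  then have m: "m = n + hexdir k" by (simp add: algebra_simps)
  have "pos (hexdir l) = pos (hexdir ((k + 3) mod 6))"
    using ol by (simp add: pos_hexdir l omega_opposite)
  then have "l = (k + 3) mod 6" using l by (intro hexdir_inj) auto
  then show ?thesis using m k l by blast
qed

lemma pos_bounded_finite: "finite {n. cmod (pos n) \<le> R}"
proof -
  define M where "M = \<lceil>2 * \<bar>R\<bar>\<rceil>"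
  have "{n. cmod (pos n) \<le> R} \<subseteq> {-M..M} \<times> {-M..M}"
  proof
    fix n assume "n \<in> {n. cmod (pos n) \<le> R}"
    then have le: "cmod (pos n) \<le> \<bar>R\<bar>" by simp
    obtain a b where n: "n = (a, b)" by (cases n)
    have "(cmod (pos n))\<^sup>2 \<le> \<bar>R\<bar>\<^sup>2" using le by (intro power_mono) auto
    then have sq: "4 * (of_int (a * a - a * b + b * b) :: real) \<le> (2 * \<bar>R\<bar>)\<^sup>2"
      using pos_norm[of a b] n by (simp add: power_mult_distrib)
    have "4 * (of_int (a * a - a * b + b * b) :: real) = (2 * of_int a - of_int b)\<^sup>2 + 3 * (of_int b)\<^sup>2"
      "4 * (of_int (a * a - a * b + b * b) :: real) = (2 * of_int b - of_int a)\<^sup>2 + 3 * (of_int a)\<^sup>2"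
      by (simp_all add: power2_eq_square algebra_simps)
    then have "(real_of_int b)\<^sup>2 \<le> (2 * \<bar>R\<bar>)\<^sup>2" "(real_of_int a)\<^sup>2 \<le> (2 * \<bar>R\<bar>)\<^sup>2"
      using sq by (smt (verit) zero_le_power2)+
    then have "\<bar>real_of_int b\<bar> \<le> \<bar>2 * \<bar>R\<bar>\<bar>" "\<bar>real_of_int a\<bar> \<le> \<bar>2 * \<bar>R\<bar>\<bar>"
      unfolding abs_le_square_iff .
    then have "\<bar>real_of_int b\<bar> \<le> 2 * \<bar>R\<bar>" "\<bar>real_of_int a\<bar> \<le> 2 * \<bar>R\<bar>" by simp_all
    then have "\<bar>b\<bar> \<le> M" "\<bar>a\<bar> \<le> M" unfolding M_def by linarith+
    then show "n \<in> {-M..M} \<times> {-M..M}" by (auto simp: n)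
  qed
  then show ?thesis by (rule finite_subset) auto
qed

text \<open>A family of sets placed along the lattice is locally finite.\<close>

lemma closed_lattice_union:
  assumes w: "cmod w = 1" and C: "\<And>n. closed (C n)" "\<And>n. C n \<subseteq> cball (x + w * pos n) (1/2)"
  shows "closed (\<Union>n\<in>K. C n)"
  unfolding closed_def
proof (subst open_subopen, intro ballI)
  fix z assume z: "z \<in> - (\<Union>n\<in>K. C n)"
  define N where "N = {n. cmod (pos n) \<le> dist z x + 2}"
  define D where "D = (\<Union>n\<in>K \<inter> N. C n)"
  have "closed D" unfolding D_def N_def using C(1) by (intro closed_UN) (auto simp: pos_bounded_finite)
  have "ball z 1 \<inter> C n = {}" if "n \<notin> N" for n
  proof (rule ccontr)
    assume "ball z 1 \<inter> C n \<noteq> {}"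
    then obtain y where "y \<in> ball z 1" "y \<in> C n" by blast
    moreover have "y \<in> cball (x + w * pos n) (1/2)" using C(2)[of n] \<open>y \<in> C n\<close> by blast
    ultimately have y: "dist z y < 1" "dist (x + w * pos n) y \<le> 1/2" by simp_all
    have "cmod (pos n) = dist (x + w * pos n) x" using w by (simp add: dist_norm norm_mult)
    also have "\<dots> \<le> dist (x + w * pos n) y + dist y z + dist z x"
      using dist_triangle[of "x + w * pos n" x y] dist_triangle[of y x z] by linarith
    finally show False using that y by (simp add: N_def dist_commute)
  qed
  then have "ball z 1 \<inter> - D \<subseteq> - (\<Union>n\<in>K. C n)" by (auto simp: D_def)
  moreover have "z \<in> ball z 1 \<inter> - D" using z by (auto simp: D_def)
  moreover have "open (ball z 1 \<inter> - D)" using \<open>closed D\<close> by (intro open_Int) auto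
  ultimately show "\<exists>T. open T \<and> z \<in> T \<and> T \<subseteq> - (\<Union>n\<in>K. C n)" by blast
qed

lemma heading_cases:
  assumes "k < 6"
  obtains j where "k = heading j" | j where "(k + 3) mod 6 = heading j" "k = (heading j + 3) mod 6"
proof -
  have "k = heading 0 \<or> k = heading 1 \<or> k = heading 2 \<or>
      (k + 3) mod 6 = heading 0 \<and> k = (heading 0 + 3) mod 6 \<or>
      (k + 3) mod 6 = heading 1 \<and> k = (heading 1 + 3) mod 6 \<or>
      (k + 3) mod 6 = heading 2 \<and> k = (heading 2 + 3) mod 6"
    using less_6_cases[OF assms] by (auto simp: heading_def)
  then show ?thesis using that by metis
qed

text \<open>A union \<open>K\<close> of components of the graph splits the union of all trees into two disjoint closed sets.\<close>

lemma connected_dendrite: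
  assumes w: "cmod w = 1" and six: "\<And>n. ori n < 6"
    and con: "connected (\<Union>n. tree w (x + w * pos n) (ori n))"
  shows "dendrite (\<lambda>n. tile_colour (ori n))"
  unfolding dendrite_def
proof (intro allI impI)
  fix K
  assume "\<forall>n j. tile_colour (ori n) \<noteq> j + 1 \<and> tile_colour (ori (move j 1 n)) \<noteq> j + 1 \<longrightarrow> (n \<in> K \<longleftrightarrow> move j 1 n \<in> K)"
  then have K: "n \<in> K \<longleftrightarrow> move j 1 n \<in> K"
    if "tile_colour (ori n) \<noteq> j + 1" "tile_colour (ori (move j 1 n)) \<noteq> j + 1" for n j
    using that by blast
  define Tr where "Tr n = tree w (x + w * pos n) (ori n)" for n
  have touch: "n \<in> K \<longleftrightarrow> m \<in> K" if z: "z \<in> Tr n" "z \<in> Tr m" for z m n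
  proof (cases "m = n")
    case False
    obtain k where k: "k < 6" "m = n + hexdir k" "arm (ori n) k" "arm (ori m) ((k + 3) mod 6)"
      using trees_meet[OF w False] z unfolding Tr_def by blast
    show ?thesis
    proof (cases rule: heading_cases[OF k(1)])
      case (1 j)
      then have m: "m = move j 1 n" using k(2) by (simp add: move_heading)
      have "tile_colour (ori n) \<noteq> j + 1" "tile_colour (ori m) \<noteq> j + 1"
        using k(3,4) 1 arm_colour[OF six] by metis+
      then show ?thesis using K m by blast
    next
      case (2 j)
      have "n = m + hexdir ((k + 3) mod 6)" using k(2) hexdir_opposite[OF k(1)] by simp
      then have n: "n = move j 1 m" using 2 by (simp add: move_heading)
      have "tile_colour (ori m) \<noteq> j + 1" "tile_colour (ori n) \<noteq> j + 1"
        using k(3,4) 2 arm_colour[OF six] by metis+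
      then show ?thesis using K n by blast
    qed
  qed simp
  have clo: "closed (\<Union>n\<in>L. Tr n)" for L
    unfolding Tr_def by (rule closed_lattice_union[OF w closed_tree tree_cball[OF w]])
  define U where "U = (\<Union>n. Tr n)"
  have dis: "(\<Union>n\<in>K. Tr n) \<inter> (\<Union>n\<in>-K. Tr n) \<inter> U = {}"
  proof (rule ccontr)
    assume "\<not> ?thesis"
    then obtain z n m where "n \<in> K" "m \<notin> K" "z \<in> Tr n" "z \<in> Tr m" by auto
    then show False using touch[of z n m] by blast
  qed
  have cov: "U \<subseteq> (\<Union>n\<in>K. Tr n) \<union> (\<Union>n\<in>-K. Tr n)" by (auto simp: U_def)
  have "connected U" using con by (simp add: U_def Tr_def)
  then have split: "(\<Union>n\<in>K. Tr n) \<inter> U = {} \<or> (\<Union>n\<in>-K. Tr n) \<inter> U = {}"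
    by (rule connected_closedD[OF _ dis cov clo clo])
  have "x + w * pos n \<in> Tr n" for n unfolding Tr_def by (rule centre_in_tree[OF six])
  then have ne: "L = {}" if "(\<Union>n\<in>L. Tr n) \<inter> U = {}" for L using that unfolding U_def by blast
  from split show "K = {} \<or> K = UNIV"
  proof
    assume "(\<Union>n\<in>-K. Tr n) \<inter> U = {}"
    then have "- K = {}" by (rule ne)
    then show ?thesis by auto
  qed (simp add: ne)
qed

text \<open>Neighbours joined in the graph share the midpoint of their common edge.\<close>

lemma dendrite_connected:
  assumes six: "\<And>n. ori n < 6" and den: "dendrite (\<lambda>n. tile_colour (ori n))"
  shows "connected (\<Union>n. tree 1 (pos n) (ori n))"
proof -
  define Tr where "Tr n = tree 1 (pos n) (ori n)" for n
  define U where "U = (\<Union>n. Tr n)"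
  define Q where "Q = connected_component_set U (pos 0)"
  have cen: "pos n \<in> Tr n" for n unfolding Tr_def by (rule centre_in_tree[OF six])
  have Tr_con: "connected (Tr n)" for n unfolding Tr_def by (rule connected_tree[OF six])
  have sub: "Tr n \<subseteq> U" for n by (auto simp: U_def)
  have "pos 0 \<in> U" using sub[of 0] cen[of 0] by blast
  then have p0: "pos 0 \<in> connected_component_set U (pos 0)" by simp
  have grow: "S \<subseteq> Q" if S: "connected S" "S \<subseteq> U" "S \<inter> Q \<noteq> {}" for S
  proof -
    have "S \<union> Q \<subseteq> Q" unfolding Q_def
    proof (rule connected_component_maximal)
      show "pos 0 \<in> S \<union> connected_component_set U (pos 0)" using p0 by simp
      show "connected (S \<union> connected_component_set U (pos 0))"
        using S by (intro connected_Un) (auto simp: Q_def)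
      show "S \<union> connected_component_set U (pos 0) \<subseteq> U" using S connected_component_subset by blast
    qed
    then show ?thesis by blast
  qed
  define K where "K = {n. pos n \<in> Q}"
  have "n \<in> K \<longleftrightarrow> move j 1 n \<in> K"
    if h: "tile_colour (ori n) \<noteq> j + 1 \<and> tile_colour (ori (move j 1 n)) \<noteq> j + 1" for n j
  proof -
    define m where "m = move j 1 n"
    have "pos n + 1 * \<omega> ^ heading j / 2 \<in> Tr n"
      using arm_colour(1)[OF six, of n j] h unfolding Tr_def tree_def by (intro UN_I[of "heading j"]) auto
    moreover have "pos m + 1 * \<omega> ^ ((heading j + 3) mod 6) / 2 \<in> Tr m"
      using arm_colour(2)[OF six, of m j] h unfolding Tr_def tree_def m_def
      by (intro UN_I[of "(heading j + 3) mod 6"]) auto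
    moreover have "pos m + 1 * \<omega> ^ ((heading j + 3) mod 6) / 2 = pos n + 1 * \<omega> ^ heading j / 2"
      unfolding omega_opposite m_def move_heading by (simp add: pos_add pos_hexdir field_simps)
    ultimately have "Tr n \<inter> Tr m \<noteq> {}" by auto
    then have "connected (Tr n \<union> Tr m)" by (intro connected_Un Tr_con)
    then have "Tr n \<union> Tr m \<subseteq> Q" if "pos n \<in> Q \<or> pos m \<in> Q"
      using grow[of "Tr n \<union> Tr m"] sub cen that by blast
    then show ?thesis using cen unfolding K_def m_def by blast
  qed
  then have "K = {} \<or> K = UNIV" using den unfolding dendrite_def by blast
  moreover have "0 \<in> K" unfolding K_def Q_def using p0 by blast
  ultimately have "pos n \<in> Q" for n by (auto simp: K_def)
  then have "Tr n \<subseteq> Q" for n using grow[OF Tr_con sub] cen by blast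
  then have "U = Q" unfolding Q_def using connected_component_subset by (fastforce simp: U_def)
  then show ?thesis using connected_connected_component[of U "pos 0"] by (simp add: Q_def U_def Tr_def)
qed

lemma linear_complex_of: "linear complex_of"
  by (rule linearI) (simp_all add: complex_of_def complex_eq_iff)

lemma connected_plane_of: "connected (plane_of ` S) \<longleftrightarrow> connected S"
proof
  assume "connected (plane_of ` S)"
  then have "connected (complex_of ` plane_of ` S)" by (rule connected_linear_image[OF linear_complex_of])
  then show "connected S" by (simp add: image_image)
qed (rule connected_linear_image[OF linear_plane_of])

section \<open>Aperiodicity\<close>

lemma lattice_tiling:
  assumes six: "\<And>n. ori n < 6"
  shows "is_tiling \<delta> (range (\<lambda>n. place \<delta> (\<omega> ^ ori n) (pos n)))"
proof -
  define t where "t n = place \<delta> (\<omega> ^ ori n) (pos n)" for n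
  have body: "body (t n) = plane_of ` cell 1 (pos n)" for n
    using cell_orient[of 1] by (simp add: t_def body_place norm_power)
  have w1: "cmod 1 = 1" by simp
  have "direct_isometry (frame (\<omega> ^ ori n) (pos n))" for n
    unfolding direct_isometry_frame
    by (rule exI[of _ "\<omega> ^ ori n"], rule exI[of _ "pos n"]) (simp add: norm_power)
  then have "\<exists>f. direct_isometry f \<and> t n = map_tile f (P0 \<delta>)" for n
    unfolding t_def place_def by blast
  moreover have "(\<Union>n. body (t n)) = UNIV"
  proof -
    have "y \<in> (\<Union>n. body (t n))" for y
    proof -
      obtain n where "complex_of y \<in> cell 1 (0 + 1 * pos n)" using lattice_cell[OF w1] by blast
      then show ?thesis unfolding body by (auto simp: mem_plane_of)
    qed
    then show ?thesis by blast
  qed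
  moreover have front: "body (t n) \<inter> body (t m) \<subseteq> frontier (body (t n))" if "m \<noteq> n" for m n
  proof
    fix y assume y: "y \<in> body (t n) \<inter> body (t m)"
    then have z: "complex_of y \<in> cell 1 (0 + 1 * pos n)" "complex_of y \<in> cell 1 (0 + 1 * pos m)" by (simp_all add: body mem_plane_of)
    from cells_meet[OF w1 that z] obtain k where "k < 6" "Re ((complex_of y - (0 + 1 * pos n)) * cnj (1 * \<omega> ^ k)) = 1/2"
      by blast
    then have "complex_of y \<notin> interior (cell 1 (0 + 1 * pos n))" using interior_cell_less[OF w1] by force
    then have "y \<notin> interior (body (t n))" by (simp add: body interior_plane_of mem_plane_of)
    moreover have "y \<in> closure (body (t n))" using y closure_subset by blast
    ultimately show "y \<in> frontier (body (t n))" by (simp add: frontier_def)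
  qed
  have "body s \<inter> body t' \<subseteq> frontier (body s) \<inter> frontier (body t')"
    if "s \<in> range t" "t' \<in> range t" "s \<noteq> t'" for s t'
  proof -
    obtain n m where "s = t n" "t' = t m" using \<open>s \<in> range t\<close> \<open>t' \<in> range t\<close> by blast
    moreover have "n \<noteq> m" using calculation \<open>s \<noteq> t'\<close> by auto
    ultimately show ?thesis using front[of n m] front[of m n] by blast
  qed
  ultimately show ?thesis unfolding is_tiling_def t_def[symmetric] by simp
qed

lemma rho_half: "\<rho> / 2 = 1 / (2 * sqrt 3)"
  by (simp add: \<rho>_def real_sqrt_divide)

lemma aperiodic_tiling_exists:
  assumes \<delta>: "0 < \<delta>" "\<delta> < \<rho> / 2"
  shows "\<exists>T. is_tiling \<delta> T \<and> R1 T \<and> R2 T"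
proof -
  obtain \<sigma> where "consistent colour \<sigma>" using alternating_consistent[OF colour_alternating] by blast
  define ori where "ori n = orient (colour n) (\<sigma> (colour n) n)" for n
  have six: "ori n < 6" for n by (simp add: ori_def orient)
  have m: "matched ori" using consistent_matched[OF \<open>consistent colour \<sigma>\<close>] by (simp add: ori_def[abs_def])
  have "(\<lambda>n. tile_colour (ori n)) = colour" by (simp add: ori_def orient)
  then have "connected (\<Union>n. tree 1 (pos n) (ori n))"
    using dendrite_connected[of ori] six colour_dendrite by simp
  moreover have "r2_tree (place \<delta> (\<omega> ^ ori n) (pos n)) = plane_of ` tree 1 (pos n) (ori n)" for n
    using r2_tree_place_tree[OF six, of \<delta> 1] by simp
  ultimately have "R2 (range (\<lambda>n. place \<delta> (\<omega> ^ ori n) (pos n)))"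
    unfolding R2_def by (simp add: image_UN[symmetric] connected_plane_of)
  then show ?thesis using lattice_tiling[of ori \<delta>] matched_R1[OF \<delta> _ m] six by blast
qed

text \<open>A translation that preserves the tiling maps the lattice of centres to itself, so it is a period
of the colouring.\<close>

lemma tiling_nonperiodic:
  assumes \<delta>: "0 < \<delta>" "\<delta> < \<rho> / 2" and til: "is_tiling \<delta> T" and "R1 T" and "R2 T"
  shows "nonperiodic T"
  unfolding nonperiodic_def
proof
  assume "\<exists>v. v \<noteq> 0 \<and> map_tile (\<lambda>x. x + v) ` T = T"
  then obtain v where v: "v \<noteq> 0" "map_tile (\<lambda>x. x + v) ` T = T" by blast
  define q where "q = complex_of v"
  have vq: "v = plane_of q" by (simp add: q_def)
  obtain x w where w: "cmod w = 1"
    and inT: "\<And>u p. cmod u = 1 \<Longrightarrow> place \<delta> u p \<in> T \<Longrightarrow> (\<exists>n. p = x + w * pos n) \<and> (\<exists>r<6. u = w * \<omega> ^ r)"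
    and ex: "\<And>n. \<exists>r<6. place \<delta> (w * \<omega> ^ r) (x + w * pos n) \<in> T"
    by (rule tiling_frame[OF til]) blast
  have unit: "cmod (w * \<omega> ^ r) = 1" for r by (simp add: w norm_mult norm_power)
  have fwd: "place \<delta> u (p + q) \<in> T" if "place \<delta> u p \<in> T" for u p
  proof -
    have "map_tile (\<lambda>x. x + plane_of q) (place \<delta> u p) \<in> T" using v(2) that unfolding vq by blast
    then show ?thesis by (simp only: map_tile_place)
  qed
  have bwd: "place \<delta> u p \<in> T" if "place \<delta> u (p + q) \<in> T" for u p
  proof -
    have "place \<delta> u (p + q) \<in> map_tile (\<lambda>x. x + plane_of q) ` T" using v(2) that unfolding vq by simp
    then obtain s where s: "s \<in> T" "place \<delta> u (p + q) = map_tile (\<lambda>x. x + plane_of q) s" by blast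
    obtain u' p' where s': "s = place \<delta> u' p'" using tiling_place[OF til s(1)] by blast
    have "place \<delta> u (p + q) = place \<delta> u' (p' + q)" using s(2) by (simp only: s' map_tile_place)
    then have "map_tile (\<lambda>x. x + plane_of (- q)) (place \<delta> u (p + q)) = map_tile (\<lambda>x. x + plane_of (- q)) (place \<delta> u' (p' + q))"
      by simp
    then have "place \<delta> u p = place \<delta> u' p'" unfolding map_tile_place by simp
    then show ?thesis using s s' by simp
  qed
  \<comment> \<open>The choice depends only on the set of orientations that occur at the centre of \<open>n\<close>, and this set
    is invariant under the translation; hence so is \<open>ori\<close>.\<close>
  define ori where "ori n = (SOME r. r < 6 \<and> place \<delta> (w * \<omega> ^ r) (x + w * pos n) \<in> T)" for n
  have ori: "ori n < 6 \<and> place \<delta> (w * \<omega> ^ ori n) (x + w * pos n) \<in> T" for n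
    unfolding ori_def by (rule someI_ex) (use ex in blast)
  then have six: "ori n < 6" for n by blast
  obtain d where d: "x + w * pos 0 + q = x + w * pos d" using inT[OF unit fwd] ori by blast
  have q: "q = w * pos d" using d by (simp add: pos_def)
  have "ori (n + d) = ori n" for n
  proof -
    have "x + w * pos (n + d) = x + w * pos n + q" by (simp add: q pos_add algebra_simps)
    then have "place \<delta> u (x + w * pos (n + d)) \<in> T \<longleftrightarrow> place \<delta> u (x + w * pos n) \<in> T" for u
      using fwd bwd by metis
    then show ?thesis by (simp add: ori_def)
  qed
  then have per: "period (\<lambda>n. tile_colour (ori n)) d" by (simp add: period_def)
  have "matched ori"
    by (rule R1_matched[where ori = ori and x = x, OF \<delta> w \<open>R1 T\<close> six]) (use ori in blast)
  from matched_consistent[where ori = ori, OF six this]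
  have alt: "alternating (\<lambda>n. tile_colour (ori n))" by (rule consistent_alternating)
  have T: "T = range (\<lambda>n. place \<delta> (w * \<omega> ^ ori n) (x + w * pos n))"
  proof
    show "T \<subseteq> range (\<lambda>n. place \<delta> (w * \<omega> ^ ori n) (x + w * pos n))"
    proof
      fix t assume t: "t \<in> T"
      obtain u p where up: "cmod u = 1" "t = place \<delta> u p" using tiling_place[OF til t] by blast
      then obtain n where n: "p = x + w * pos n" using inT t by blast
      have "place \<delta> u p = place \<delta> (w * \<omega> ^ ori n) p"
        using tiling_unique[OF til up(1) unit] t up(2) ori[of n] n by blast
      then show "t \<in> range (\<lambda>n. place \<delta> (w * \<omega> ^ ori n) (x + w * pos n))" using up n by blast
    qed
  qed (use ori in blast)
  have "(\<Union>t\<in>T. r2_tree t) = plane_of ` (\<Union>n. tree w (x + w * pos n) (ori n))"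
    unfolding T by (simp add: r2_tree_place_tree[OF six] image_UN)
  then have "connected (\<Union>n. tree w (x + w * pos n) (ori n))"
    using \<open>R2 T\<close> by (simp add: R2_def connected_plane_of)
  then have den: "dendrite (\<lambda>n. tile_colour (ori n))"
    by (rule connected_dendrite[where ori = ori and x = x, OF w six])
  have "d = 0" by (rule alternating_dendrite_nonperiodic[OF alt den per])
  then have "v = 0" by (simp add: vq q pos_def plane_of_0)
  then show False using v by simp
qed

theorem theorem1:
  fixes \<delta> :: real
  assumes "0 < \<delta>" and "\<delta> < 1 / (2 * sqrt 3)"
  shows "(\<exists>T. is_tiling \<delta> T \<and> R1 T \<and> R2 T) \<and>
         (\<forall>T. is_tiling \<delta> T \<and> R1 T \<and> R2 T \<longrightarrow> nonperiodic T)"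
  using aperiodic_tiling_exists[of \<delta>] tiling_nonperiodic[of \<delta>] assms unfolding rho_half by blast

end
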